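(* Let $m\ge1$, let $U\subseteq\mathbb{R}^m$ be a bounded open set and $H$ a Hilbert space. Suppose that $A,A_n\in C^{0,1}(\overline U,K(H))$, for $n\ge1$, are Lipschitz families of compact self-adjoint nonnegative operators. Assume that $A(x)$ is positive definite for all $x\in U$ and $A_n\to A$ in $C^{0,1}(\overline U,K(H))$ as $n\to\infty$. Then: (1) The decreasingly ordered eigenvalues $\lambda_i(A)$ and $\lambda_i(A_n)$, for all $i$ and large enough $n$, belong to $C^{0,1}(\overline U)$. (2) For all $1\le j\le m$ and almost every $x\in U$, $$\lim_{n\to\infty}\partial_j(\lambda_i(A_n))(x)=\partial_j(\lambda_i(A))(x),\qquad i=1,2,\ldots$$ (3) For every $1\le q<\infty$, $$\lim_{n\to\infty}\|\lambda_i(A)-\lambda_i(A_n)\|_{W^{1,q}(U)}=0,\qquad i=1,2,\ldots$$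
   Context: $K(H)$ is the Banach space of compact bounded operators on $H$ with the operator norm. $C^{0,1}(\overline U,K(H))$ carries the norm $\sup_{x\in U}\|A(x)\|_{\mathrm{op}}+\sup_{x\ne y\in U}\frac{\|A(x)-A(y)\|_{\mathrm{op}}}{\|x-y\|_2}$; $C^{0,1}(\overline U)$ is defined analogously for real-valued functions. For a compact self-adjoint nonnegative operator $B$ on $H$, $\lambda_1(B)\ge\lambda_2(B)\ge\cdots$ are the eigenvalues counted with multiplicity in decreasing order, given by the min-max principle $\lambda_i(B)=\min_{M\subseteq H,\ \dim M=i-1}\ \max_{\|x\|=1,\ x\perp M}\langle Bx,x\rangle$ (so $\lambda_i(B)=0$ if $B$ has fewer than $i$ positive eigenvalues; if $\dim H<\infty$, only $i\le\dim H$ is considered). For a family $A$ of such operators, $\lambda_i(A)$ is the function $x\mapsto\lambda_i(A(x))$. Positive definite means $\langle A(x)v,v\rangle>0$ for all $v\in H\setminus\{0\}$. $W^{1,q}(U)$ has the norm $\|f\|_{L^q}+\sum_i\|\partial_if\|_{L^q}$. *)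

theory Defs
  imports "HOL-Analysis.Analysis"
begin

section \<open>Real and complex Hilbert spaces\<close>

text \<open>
  The scalar field of a Hilbert space is the real or the complex field. A scalar field is
  presented by its embedding into the complex numbers (automatically injective).
\<close>

class real_or_complex = field +
  fixes to_complex :: "'a \<Rightarrow> complex"
  assumes to_complex_add: "to_complex (a + b) = to_complex a + to_complex b"
    and to_complex_mult: "to_complex (a * b) = to_complex a * to_complex b"
    and to_complex_one: "to_complex 1 = 1"
    and range_to_complex: "range to_complex = \<real> \<or> range to_complex = UNIV"

instantiation real :: real_or_complex
begin
definition to_complex_real :: "real \<Rightarrow> complex" where "to_complex_real = of_real"
instance by standard (auto simp: to_complex_real_def Reals_def)
end

instantiation complex :: real_or_complex
begin
definition to_complex_complex :: "complex \<Rightarrow> complex" where "to_complex_complex = id"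
instance by standard (auto simp: to_complex_complex_def)
end

text \<open>
  The type \<open>'h\<close> carries the underlying real Hilbert space, whose inner product is the real
  part of \<open>ip\<close>; this determines the norm and the topology. The inner product \<open>ip\<close> is linear in
  its first argument.
\<close>

locale hilbert_space = vector_space smul
  for smul :: "'k::real_or_complex \<Rightarrow> 'h::{real_inner,complete_space} \<Rightarrow> 'h" +
  fixes ip :: "'h \<Rightarrow> 'h \<Rightarrow> 'k"
  assumes scale_of_real: "to_complex a = of_real r \<Longrightarrow> smul a v = r *\<^sub>R v"
    and ip_add_left: "ip (u + v) w = ip u w + ip v w"
    and ip_scale_left: "ip (smul a v) w = a * ip v w"
    and ip_commute: "to_complex (ip w v) = cnj (to_complex (ip v w))"
    and Re_ip: "Re (to_complex (ip v w)) = v \<bullet> w"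

lemma hilbert_space_real:
  "hilbert_space (scaleR :: real \<Rightarrow> 'h::{real_inner,complete_space} \<Rightarrow> 'h) inner"
  by unfold_locales (auto simp: to_complex_real_def algebra_simps inner_commute)

lemma hilbert_space_complex:
  "hilbert_space ((*) :: complex \<Rightarrow> complex \<Rightarrow> complex) (\<lambda>z w. z * cnj w)"
  by unfold_locales
    (auto simp: to_complex_complex_def algebra_simps inner_complex_def scaleR_conv_of_real)

section \<open>Compact self-adjoint nonnegative operators and their eigenvalues\<close>

text \<open>
  Elements of the type \<open>'h \<Rightarrow>\<^sub>L 'h\<close> are bounded real-linear operators with the operator norm,
  so linearity over the scalar field has to be required separately.
\<close>

definition compact_operator ::
  "('k \<Rightarrow> 'h \<Rightarrow> 'h) \<Rightarrow> ('h::real_normed_vector \<Rightarrow>\<^sub>L 'h) \<Rightarrow> bool" where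
  "compact_operator smul B \<longleftrightarrow>
     (\<forall>a v. blinfun_apply B (smul a v) = smul a (blinfun_apply B v)) \<and>
     compact (closure (blinfun_apply B ` cball 0 1))"

definition selfadjoint_operator ::
  "('h \<Rightarrow> 'h \<Rightarrow> 'k) \<Rightarrow> ('h::real_normed_vector \<Rightarrow>\<^sub>L 'h) \<Rightarrow> bool" where
  "selfadjoint_operator ip B \<longleftrightarrow>
     (\<forall>v w. ip (blinfun_apply B v) w = ip v (blinfun_apply B w))"

text \<open>
  For self-adjoint \<open>B\<close> the value \<open>ip (B v) v\<close> is real, so that taking the real part only
  changes its type.
\<close>

definition quad_form ::
  "('h \<Rightarrow> 'h \<Rightarrow> 'k::real_or_complex) \<Rightarrow> ('h::real_normed_vector \<Rightarrow>\<^sub>L 'h) \<Rightarrow> 'h \<Rightarrow> real" where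
  "quad_form ip B v = Re (to_complex (ip (blinfun_apply B v) v))"

definition nonneg_operator ::
  "('h \<Rightarrow> 'h \<Rightarrow> 'k::real_or_complex) \<Rightarrow> ('h::real_normed_vector \<Rightarrow>\<^sub>L 'h) \<Rightarrow> bool" where
  "nonneg_operator ip B \<longleftrightarrow> (\<forall>v. 0 \<le> quad_form ip B v)"

definition posdef_operator ::
  "('h \<Rightarrow> 'h \<Rightarrow> 'k::real_or_complex) \<Rightarrow> ('h::real_normed_vector \<Rightarrow>\<^sub>L 'h) \<Rightarrow> bool" where
  "posdef_operator ip B \<longleftrightarrow> (\<forall>v. v \<noteq> 0 \<longrightarrow> 0 < quad_form ip B v)"

text \<open>
  \<open>vector_space.dim\<close> is \<open>0\<close> for infinite-dimensional spaces, hence the explicit requirement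
  of a finite spanning set.
\<close>

definition subspaces_of_dim ::
  "('k::field \<Rightarrow> 'h::ab_group_add \<Rightarrow> 'h) \<Rightarrow> nat \<Rightarrow> 'h set set" where
  "subspaces_of_dim smul d =
     {M. (\<exists>S. finite S \<and> module.span smul S = M) \<and> vector_space.dim smul M = d}"

definition index_ok :: "('k::field \<Rightarrow> 'h::ab_group_add \<Rightarrow> 'h) \<Rightarrow> nat \<Rightarrow> bool" where
  "index_ok smul i \<longleftrightarrow>
     1 \<le> i \<and> ((\<exists>S. finite S \<and> module.span smul S = UNIV) \<longrightarrow> i \<le> vector_space.dim smul UNIV)"

text \<open>
  The min-max principle for the \<open>i\<close>-th eigenvalue, counted with multiplicity in decreasing
  order. For compact self-adjoint nonnegative \<open>B\<close> and admissible \<open>i\<close> the supremum and the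
  infimum range over nonempty bounded sets and are attained, i.e. they are a maximum and a
  minimum.
\<close>

definition eigval ::
  "('k::real_or_complex \<Rightarrow> 'h \<Rightarrow> 'h) \<Rightarrow> ('h \<Rightarrow> 'h \<Rightarrow> 'k) \<Rightarrow> nat
    \<Rightarrow> ('h::real_normed_vector \<Rightarrow>\<^sub>L 'h) \<Rightarrow> real" where
  "eigval smul ip i B =
     (INF M \<in> subspaces_of_dim smul (i - 1).
        SUP v \<in> {v. norm v = 1 \<and> (\<forall>w\<in>M. ip v w = 0)}. quad_form ip B v)"

section \<open>Lipschitz functions\<close>

definition C01_norm :: "'a::metric_space set \<Rightarrow> ('a \<Rightarrow> 'b::real_normed_vector) \<Rightarrow> ennreal" where
  "C01_norm U f =
     (SUP x\<in>U. ennreal (norm (f x))) +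
     (SUP (x, y)\<in>{(x, y). x \<in> U \<and> y \<in> U \<and> x \<noteq> y}. ennreal (norm (f x - f y) / dist x y))"

definition C01 :: "'a::metric_space set \<Rightarrow> ('a \<Rightarrow> 'b::real_normed_vector) set" where
  "C01 U = {f. continuous_on (closure U) f \<and> C01_norm U f < \<infinity>}"

section \<open>Partial derivatives and Sobolev norms\<close>

definition partially_differentiable :: "'m::finite \<Rightarrow> (real^'m \<Rightarrow> real) \<Rightarrow> real^'m \<Rightarrow> bool" where
  "partially_differentiable j f x \<longleftrightarrow> (\<lambda>t. f (x + t *\<^sub>R axis j 1)) differentiable (at 0)"

definition partial :: "'m::finite \<Rightarrow> (real^'m \<Rightarrow> real) \<Rightarrow> real^'m \<Rightarrow> real" where
  "partial j f x = deriv (\<lambda>t. f (x + t *\<^sub>R axis j 1)) 0"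

text \<open>Smoothness: all iterated partial derivatives are differentiable everywhere.\<close>

definition test_function :: "(real^'m::finite) set \<Rightarrow> (real^'m \<Rightarrow> real) \<Rightarrow> bool" where
  "test_function U \<phi> \<longleftrightarrow>
     (\<forall>js x. foldr partial js \<phi> differentiable (at x)) \<and>
     (\<exists>K. compact K \<and> K \<subseteq> U \<and> (\<forall>x. x \<notin> K \<longrightarrow> \<phi> x = 0))"

definition locally_integrable :: "(real^'m::finite) set \<Rightarrow> (real^'m \<Rightarrow> real) \<Rightarrow> bool" where
  "locally_integrable U f \<longleftrightarrow> (\<forall>K. compact K \<and> K \<subseteq> U \<longrightarrow> integrable (lebesgue_on K) f)"

definition has_weak_partial ::
  "(real^'m::finite) set \<Rightarrow> 'm \<Rightarrow> (real^'m \<Rightarrow> real) \<Rightarrow> (real^'m \<Rightarrow> real) \<Rightarrow> bool" where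
  "has_weak_partial U j f g \<longleftrightarrow>
     locally_integrable U f \<and> locally_integrable U g \<and>
     (\<forall>\<phi>. test_function U \<phi> \<longrightarrow>
        (LINT x|lebesgue_on U. f x * partial j \<phi> x) = - (LINT x|lebesgue_on U. g x * \<phi> x))"

definition Lq_norm :: "real \<Rightarrow> (real^'m::finite) set \<Rightarrow> (real^'m \<Rightarrow> real) \<Rightarrow> ennreal" where
  "Lq_norm q U f =
     (let I = (\<integral>\<^sup>+x. ennreal (\<bar>f x\<bar> powr q) \<partial>lebesgue_on U)
      in if I = \<infinity> then \<infinity> else ennreal (enn2real I powr (1 / q)))"

text \<open>
  Weak partial derivatives are unique up to null sets, so all weak gradients \<open>g\<close> give the same
  value below; the infimum merely avoids choosing one of them, and it yields \<open>\<infinity>\<close> if \<open>f\<close>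
  has no weak gradient. Thus the norm is finite exactly for \<open>f\<close> in the Sobolev space.
\<close>

definition W1q_norm :: "real \<Rightarrow> (real^'m::finite) set \<Rightarrow> (real^'m \<Rightarrow> real) \<Rightarrow> ennreal" where
  "W1q_norm q U f =
     (INF g \<in> {g. \<forall>j. has_weak_partial U j f (g j)}. Lq_norm q U f + (\<Sum>j\<in>UNIV. Lq_norm q U (g j)))"

end

theory Submission
  imports Defs
begin

text \<open>
  The sum \<open>s k B\<close> of the \<open>k\<close> largest eigenvalues is the maximum of
  \<open>\<Sum>j<k. \<langle>B (v j), v j\<rangle>\<close> over orthonormal frames \<open>v\<close> (Ky Fan). If the \<open>k\<close>-th eigenvalue of \<open>B\<close>
  is positive, maximizing sequences of frames for \<open>B\<close> have norm convergent subsequences, because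
  \<open>B\<close> is compact and the part of a frame outside the span of finitely many eigenvectors is
  controlled by the spectral gap.

  Along a line, let \<open>v\<close> be a maximizing frame for \<open>An n t\<close>, where \<open>t > 0\<close> is tiny depending on \<open>n\<close>.
  Testing \<open>An n 0\<close> with the same frame bounds the difference quotient of \<open>s k (An n t)\<close> by
  \<open>\<Sum>j<k. \<langle>X (v j), v j\<rangle>\<close> with \<open>X = (A t - A 0) / t\<close>, up to an error governed by the Lipschitz norm of
  \<open>An n - A\<close>. As \<open>n\<close> grows these frames maximize for \<open>A 0\<close> and converge to an exact maximizer \<open>w\<close>
  of \<open>A 0\<close>; since \<open>X\<close> stays bounded, \<open>v\<close> may be replaced by \<open>w\<close>, and \<open>\<Sum>j<k. \<langle>X (w j), w j\<rangle>\<close> is at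
  most the difference quotient of \<open>s k (A t)\<close>. So \<open>limsup\<close> of the derivatives of \<open>s k (An n)\<close>
  is at most the derivative of \<open>s k A\<close>, and reversing \<open>t\<close> gives the other inequality. No
  differentiability of \<open>A\<close> as an operator-valued map is used, only that of the Lipschitz functions
  \<open>s k A\<close> and \<open>s k (An n)\<close>, which holds almost everywhere. The Sobolev convergence follows by
  dominated convergence.
\<close>

text \<open>Eigenvalue sums are used because \<open>s k\<close> is a maximum of functionals that are
  linear in the operator: a frame optimal for one operator competes for every other one, which
  bounds increments from one side. A single eigenvalue beyond the first is only a min-max and allows
  no such comparison; it is recovered as the difference of two consecutive sums.

  The obstacle is loss of compactness. If the k-th eigenvalue vanished, maximizing frames could
  wander through an infinite-dimensional kernel and converge only weakly. Positive definiteness of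
  \<open>A 0\<close> makes its k-th eigenvalue positive, and since eigenvalues decay to 0, some
  later one lies strictly below it. This is the gap. It lies behind the whole cluster of eigenvalues
  equal to the k-th, so the maximizer need not be unique and the frames converge only along
  subsequences; hence the argument by contradiction.

  Only partial derivatives occur, so differentiability is needed along one direction at a time,
  which reduces it to functions of one real variable.\<close>

section \<open>Almost everywhere differentiability of Lipschitz functions\<close>

text \<open>A growth estimate in the style of Lebesgue's differentiation theorem. Vitali's theorem
  picks disjoint short intervals of small slope inside an open \<open>G\<close>; they miss only a
  null part of \<open>E\<close>, which a Lipschitz map keeps null, and outer regularity lets
  \<open>G\<close> shrink towards \<open>E\<close>.\<close>

lemma emeasure_image_le_slope:
  fixes f :: "real \<Rightarrow> real"
  assumes smono: "strict_mono f" and lip: "L-lipschitz_on UNIV f"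
    and E: "E \<in> sets borel" and fE: "f ` E \<in> sets borel" and p: "0 \<le> p"
    and slope: "\<And>x d. x \<in> E \<Longrightarrow> 0 < d \<Longrightarrow>
      \<exists>a b. a < x \<and> x < b \<and> b - a < d \<and> f b - f a \<le> p * (b - a)"
  shows "emeasure lborel (f ` E) \<le> ennreal p * emeasure lborel E"
proof (rule ennreal_le_epsilon)
  have mono: "mono f" using smono by (rule strict_mono_mono)
  have *: "emeasure lborel (f ` E) \<le> ennreal p * emeasure lborel G" if G: "open G" "E \<subseteq> G" for G
  proof -
    define K where "K = {(a, r). 0 < r \<and> cball a r \<subseteq> G \<and> f (a + r) - f (a - r) \<le> p * (2 * r)}"
    have vit: "\<exists>i. i \<in> K \<and> x \<in> cball (fst i) (snd i) \<and> snd i < d" if x: "x \<in> E" and d: "0 < d" for x d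
    proof -
      obtain e where e: "e > 0" "ball x e \<subseteq> G"
        using G x by (meson openE subsetD)
      obtain a b where ab: "a < x" "x < b" "b - a < min d e" "f b - f a \<le> p * (b - a)"
        using slope[OF x, of "min d e"] d e by auto
      \<comment> \<open>The given interval contains \<open>x\<close> possibly off centre; the
        covering theorem accepts any ball containing \<open>x\<close>, so the midpoint becomes the
        centre.\<close>
      define c r where "c = (a + b) / 2" and "r = (b - a) / 2"
      have 1: "b = c + r" "a = c - r"
        unfolding c_def r_def by argo+
      note ab = ab[unfolded 1]
      have "cball c r \<subseteq> ball x e"
        using ab unfolding cball_eq_atLeastAtMost by (auto simp: dist_real_def)
      moreover have "f (c + r) - f (c - r) \<le> p * (2 * r)" using ab(4) by simp
      ultimately have "(c, r) \<in> K"
        unfolding K_def using ab(1,2) e(2) by auto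
      moreover have "x \<in> cball c r"
        using ab unfolding cball_eq_atLeastAtMost by auto
      moreover have "r < d" using ab by auto
      ultimately show ?thesis by (intro exI[of _ "(c, r)"]) simp
    qed
    have "0 < snd i" if "i \<in> K" for i
      using that by (auto simp: K_def)
    then obtain C where C: "countable C" "C \<subseteq> K"
        "pairwise (\<lambda>i j. disjnt (cball (fst i) (snd i)) (cball (fst j) (snd j))) C"
        "negligible (E - (\<Union>i\<in>C. cball (fst i) (snd i)))"
      using Vitali_covering_theorem_cballs[of K snd E fst, OF _ vit] by blast
    define I where "I i = cball (fst i) (snd i :: real)" for i :: "real \<times> real"
    define N where "N = f ` (E - (\<Union>i\<in>C. I i))"
    have "negligible N"
      unfolding N_def
    proof (rule negligible_locally_Lipschitz_image)
      show "negligible (E - (\<Union>i\<in>C. I i))" using C(4) by (simp add: I_def)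
      show "\<exists>T B. open T \<and> x \<in> T \<and>
          (\<forall>y\<in>(E - (\<Union>i\<in>C. I i)) \<inter> T. norm (f y - f x) \<le> B * norm (y - x))" for x
        using lipschitz_on_normD[OF lip] by (intro exI[of _ UNIV] exI[of _ L]) simp
    qed simp
    then have N: "N \<in> null_sets lebesgue" by (simp add: negligible_iff_null_sets)
    have If: "f ` I i \<subseteq> {f (fst i - snd i) .. f (fst i + snd i)}" for i
      using mono by (auto simp: I_def cball_eq_atLeastAtMost mono_def)
    define J where "J i = {f (fst i - snd i) .. f (fst i + snd i)}" for i
    have eJ: "emeasure lborel (J i) \<le> ennreal p * emeasure lborel (I i)" if "i \<in> C" for i
    proof -
      have i: "0 < snd i" "f (fst i + snd i) - f (fst i - snd i) \<le> p * (2 * snd i)"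
        using C(2) that by (auto simp: K_def)
      have "f (fst i - snd i) \<le> f (fst i + snd i)" using i mono by (simp add: mono_def)
      then show ?thesis using i p
        by (simp add: J_def I_def cball_eq_atLeastAtMost ennreal_mult[symmetric] ennreal_leI)
    qed
    have "f ` E \<subseteq> (\<Union>i\<in>C. J i) \<union> N"
    proof
      fix y assume "y \<in> f ` E"
      then obtain x where x: "x \<in> E" "y = f x" by auto
      show "y \<in> (\<Union>i\<in>C. J i) \<union> N"
      proof (cases "x \<in> (\<Union>i\<in>C. I i)")
        case True
        then obtain i where "i \<in> C" "x \<in> I i" by auto
        then show ?thesis using If[of i] x unfolding J_def by blast
      next
        case False
        then show ?thesis using x by (auto simp: N_def)
      qed
    qed
    moreover have Jm: "(\<Union>i\<in>C. J i) \<in> sets borel"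
      by (rule sets.countable_UN'[OF C(1)]) (auto simp: J_def)
    moreover have "(\<Union>i\<in>C. J i) \<in> sets lebesgue" using Jm by simp
    ultimately have "emeasure lebesgue (f ` E) \<le> emeasure lebesgue ((\<Union>i\<in>C. J i) \<union> N)"
      using N by (intro emeasure_mono sets.Un) auto
    also have "\<dots> = emeasure lebesgue (\<Union>i\<in>C. J i)"
      using N Jm by (intro emeasure_Un_null_set) auto
    also have "\<dots> = emeasure lborel (\<Union>i\<in>C. J i)" using Jm by simp
    also have "\<dots> = (\<integral>\<^sup>+i. emeasure lborel (J i) \<partial>count_space C)"
    proof (rule emeasure_UN_countable)
      \<comment> \<open>Strict monotonicity keeps the image intervals disjoint, so their measures
        add up like those of the selected intervals.\<close>
      show "disjoint_family_on J C"
        unfolding disjoint_family_on_def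
      proof (intro ballI impI)
        fix i j assume ij: "i \<in> C" "j \<in> C" "i \<noteq> j"
        then have "I i \<inter> I j = {}"
          using C(3) by (auto simp: I_def pairwise_def disjnt_def)
        moreover have "0 < snd i" "0 < snd j" using C(2) ij by (auto simp: K_def)
        ultimately have "fst i + snd i < fst j - snd j \<or> fst j + snd j < fst i - snd i"
          by (auto simp: I_def cball_eq_atLeastAtMost)
        then have "f (fst i + snd i) < f (fst j - snd j) \<or> f (fst j + snd j) < f (fst i - snd i)"
          using smono by (auto simp: strict_mono_def)
        then show "J i \<inter> J j = {}" by (auto simp: J_def)
      qed
    qed (use C(1) in \<open>auto simp: J_def\<close>)
    also have "\<dots> \<le> (\<integral>\<^sup>+i. ennreal p * emeasure lborel (I i) \<partial>count_space C)"
      by (intro nn_integral_mono) (use eJ in auto)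
    also have "\<dots> = ennreal p * (\<integral>\<^sup>+i. emeasure lborel (I i) \<partial>count_space C)"
      by (rule nn_integral_cmult) auto
    also have "(\<integral>\<^sup>+i. emeasure lborel (I i) \<partial>count_space C) = emeasure lborel (\<Union>i\<in>C. I i)"
      by (rule emeasure_UN_countable[symmetric])
        (use C in \<open>auto simp: I_def disjoint_family_on_def pairwise_def disjnt_def\<close>)
    also have "\<dots> \<le> emeasure lborel G"
    proof (rule emeasure_mono)
      show "(\<Union>i\<in>C. I i) \<subseteq> G" using C(2) unfolding I_def K_def by fastforce
    qed (use G in auto)
    finally show ?thesis using fE by (simp add: mult_left_mono)
  qed
  fix e :: real assume e: "0 < e" 
  \<comment> \<open>The divisor \<open>p + 1\<close> stays positive when \<open>p = 0\<close>, and
    \<open>p * (e / (p + 1))\<close> is at most \<open>e\<close>.\<close>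
  have "0 < e / (p + 1)" using e p by auto
  then obtain G where G: "open G" "E \<subseteq> G" "emeasure lborel (G - E) < ennreal (e / (p + 1))"
    using outer_regular_lborel[of E "e / (p+1)"] E by auto
  have "emeasure lborel G = emeasure lborel E + emeasure lborel (G - E)"
    using G E by (subst plus_emeasure) (auto simp: Un_absorb1)
  then have "ennreal p * emeasure lborel G \<le> ennreal p * emeasure lborel E + ennreal p * ennreal (e / (p + 1))"
    using G(3) by (simp add: distrib_left mult_left_mono less_imp_le add_left_mono)
  also have "\<dots> \<le> ennreal p * emeasure lborel E + ennreal e"
  proof -
    have "p * (e / (p + 1)) \<le> e" using p e by (simp add: field_simps)
    then show ?thesis using p e by (intro add_left_mono) (simp add: ennreal_mult[symmetric] ennreal_leI)
  qed
  finally show "emeasure lborel (f ` E) \<le> ennreal p * emeasure lborel E + ennreal e"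
    using *[OF G(1,2)] by (simp add: add_left_mono order_trans)
qed

lemma differentiable_at_real_iff:
  fixes f :: "real \<Rightarrow> real"
  shows "f differentiable (at x) \<longleftrightarrow> (\<exists>l. ((\<lambda>t. (f (x + t) - f x) / t) \<longlongrightarrow> l) (at 0))"
  unfolding real_differentiable_def DERIV_def by simp

text \<open>Rational thresholds are supplied so that the points without a derivative lie in
  countably many sets. \<open>Sup S\<close> in the proof is the lower limit of \<phi>.\<close>

lemma bounded_tendsto_iff_no_oscillation:
  fixes \<phi> :: "'a \<Rightarrow> real"
  assumes F: "F \<noteq> bot" and bd: "eventually (\<lambda>t. a \<le> \<phi> t \<and> \<phi> t \<le> b) F"
    and nolim: "\<not> (\<exists>l. (\<phi> \<longlongrightarrow> l) F)"
  obtains p q where "p \<in> \<rat>" "q \<in> \<rat>" "p < q" "\<exists>\<^sub>F t in F. \<phi> t < p" "\<exists>\<^sub>F t in F. q < \<phi> t"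
proof (rule ccontr)
  note witness = that
  assume no: "\<not> thesis"
  have osc: "eventually (\<lambda>t. p \<le> \<phi> t) F \<or> eventually (\<lambda>t. \<phi> t \<le> q) F"
    if pq: "p \<in> \<rat>" "q \<in> \<rat>" "p < q" for p q
  proof (rule ccontr)
    assume "\<not> ?thesis"
    then have "\<exists>\<^sub>F t in F. \<phi> t < p" "\<exists>\<^sub>F t in F. q < \<phi> t"
      by (simp_all add: frequently_def not_less)
    with witness[OF pq] no show False by blast
  qed
  define S where "S = {p. eventually (\<lambda>t. p \<le> \<phi> t) F}"
  have aS: "a \<in> S" using bd unfolding S_def by (auto elim: eventually_mono)
  have bS: "p \<le> b" if "p \<in> S" for p
  proof -
    have "eventually (\<lambda>t. p \<le> \<phi> t \<and> \<phi> t \<le> b) F"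
      using that bd unfolding S_def by (auto elim: eventually_elim2)
    then have "eventually (\<lambda>t. p \<le> b) F" by (auto elim: eventually_mono)
    then show ?thesis using F by simp
  qed
  have bdd: "bdd_above S" using bS by (auto simp: bdd_above_def)
  have "(\<phi> \<longlongrightarrow> Sup S) F"
  proof (rule order_tendstoI)
    fix c assume "c < Sup S"
    then obtain p where p: "p \<in> S" "c < p" using less_cSup_iff[OF _ bdd] aS by auto
    then show "eventually (\<lambda>t. c < \<phi> t) F" unfolding S_def by (auto elim: eventually_mono)
  next
    fix c assume "Sup S < c"
    \<comment> \<open>Two rationals are inserted: \<open>p\<close> lies outside \<open>S\<close>, so
      it is no eventual lower bound, and the absence of oscillation then makes the larger
      \<open>q\<close> an eventual upper bound.\<close>
    then obtain q where q: "q \<in> \<rat>" "Sup S < q" "q < c" using Rats_dense_in_real by auto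
    then obtain p where p: "p \<in> \<rat>" "Sup S < p" "p < q" using Rats_dense_in_real by blast
    have "p \<notin> S" using cSup_upper[OF _ bdd, of p] p by auto
    then have "eventually (\<lambda>t. \<phi> t \<le> q) F" using osc[OF p(1) q(1) p(3)] by (auto simp: S_def)
    then show "eventually (\<lambda>t. \<phi> t < c) F" using q by (auto elim: eventually_mono)
  qed
  then show False using nolim by blast
qed

text \<open>Intervals straddling the point, instead of quotients based at it, make each union open;
  the set is thus Borel for arbitrary \<open>f\<close> and \<open>P\<close>.\<close>

definition slope_set :: "(real \<Rightarrow> real) \<Rightarrow> (real \<Rightarrow> bool) \<Rightarrow> real set" where
  "slope_set f P = (\<Inter>n. \<Union>{{a<..<b} |a b. b - a < inverse (Suc n) \<and> P ((f b - f a) / (b - a))})"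

lemma borel_slope_set: "slope_set f P \<in> sets borel"
  unfolding slope_set_def
  by (rule sets.countable_INT) (auto intro!: borel_open open_Union)

lemma slope_setD:
  assumes "x \<in> slope_set f P" "0 < d"
  obtains a b where "a < x" "x < b" "b - a < d" "P ((f b - f a) / (b - a))"
proof -
  obtain n where n: "inverse (Suc n) < d" using reals_Archimedean assms(2) by auto
  have "x \<in> \<Union>{{a<..<b} |a b. b - a < inverse (Suc n) \<and> P ((f b - f a) / (b - a))}"
    using assms(1) unfolding slope_set_def by blast
  then show ?thesis using n that by (auto simp: of_nat_Suc)
qed

text \<open>A quotient based at \<open>x\<close> has \<open>x\<close> as an endpoint of its
  interval. As \<open>P\<close> is open and \<open>f\<close> continuous, that endpoint can be pushed
  slightly beyond \<open>x\<close> without losing \<open>P\<close>, and \<open>x\<close> becomes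
  interior.\<close>

lemma slope_setI:
  fixes f :: "real \<Rightarrow> real"
  assumes cont: "continuous_on UNIV f" and P: "open {t. P t}"
    and freq: "\<exists>\<^sub>F t in at 0. P ((f (x + t) - f x) / t)"
  shows "x \<in> slope_set f P"
  unfolding slope_set_def
proof (rule INT_I)
  fix n :: nat
  let ?d = "inverse (real (Suc n))"
  have c: "isCont f y" for y using cont by (simp add: continuous_on_eq_continuous_at)
  have "eventually (\<lambda>t. t \<noteq> 0 \<and> \<bar>t\<bar> < ?d) (at (0::real))"
    unfolding eventually_at by (intro exI[of _ ?d]) auto
  then obtain t where t: "P ((f (x + t) - f x) / t)" "t \<noteq> 0" "\<bar>t\<bar> < ?d"
    using frequently_eventually_frequently[OF freq] by (auto dest!: frequently_ex)
  show "x \<in> \<Union>{{a<..<b} |a b. b - a < ?d \<and> P ((f b - f a) / (b - a))}"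
  proof (cases "0 < t")
    case True
    have "((\<lambda>s. (f (x + t) - f (x - s)) / (x + t - (x - s))) \<longlongrightarrow> (f (x + t) - f (x - 0)) / (x + t - (x - 0))) (at_right 0)"
      using True by (intro tendsto_intros isCont_tendsto_compose[OF c, of "\<lambda>s. x - s"]) auto
    then have 1: "eventually (\<lambda>s. (f (x + t) - f (x - s)) / (x + t - (x - s)) \<in> {t. P t}) (at_right 0)"
      by (rule topological_tendstoD) (use t P in auto)
    have 2: "eventually (\<lambda>s. 0 < s \<and> s < ?d - t) (at_right 0)"
      using eventually_at_right_real[of 0 "?d - t"] t(3) True by auto
    have "eventually (\<lambda>s. P ((f (x + t) - f (x - s)) / (x + t - (x - s))) \<and> 0 < s \<and> s < ?d - t) (at_right (0::real))"
      using 1 2 by eventually_elim auto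
    then obtain s where s: "P ((f (x + t) - f (x - s)) / (x + t - (x - s)))" "0 < s" "s < ?d - t"
      using eventually_happens'[of "at_right (0::real)"] by fastforce
    have "x + t - (x - s) < ?d" using s by linarith
    then have "{x - s<..<x + t} \<in> {{a<..<b} |a b. b - a < ?d \<and> P ((f b - f a) / (b - a))}"
      using s(1) by blast
    moreover have "x \<in> {x - s<..<x + t}" using s True by auto
    ultimately show ?thesis by (rule UnionI)
  next
    case False
    then have tn: "t < 0" using t by auto
    have "((\<lambda>s. (f (x + s) - f (x + t)) / (x + s - (x + t))) \<longlongrightarrow> (f (x + 0) - f (x + t)) / (x + 0 - (x + t))) (at_right 0)"
      using tn by (intro tendsto_intros isCont_tendsto_compose[OF c, of "\<lambda>s. x + s"]) auto
    moreover have "(f (x + 0) - f (x + t)) / (x + 0 - (x + t)) = (f (x + t) - f x) / t"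
      using tn by (auto simp: field_simps)
    ultimately have 1: "eventually (\<lambda>s. (f (x + s) - f (x + t)) / (x + s - (x + t)) \<in> {t. P t}) (at_right 0)"
      by (intro topological_tendstoD) (use t P in auto)
    have 2: "eventually (\<lambda>s. 0 < s \<and> s < ?d + t) (at_right 0)"
      using eventually_at_right_real[of 0 "?d + t"] t(3) tn by auto
    have "eventually (\<lambda>s. P ((f (x + s) - f (x + t)) / (x + s - (x + t))) \<and> 0 < s \<and> s < ?d + t) (at_right (0::real))"
      using 1 2 by eventually_elim auto
    then obtain s where s: "P ((f (x + s) - f (x + t)) / (x + s - (x + t)))" "0 < s" "s < ?d + t"
      using eventually_happens'[of "at_right (0::real)"] by fastforce
    have "x + s - (x + t) < ?d" using s by linarith
    then have "{x + t<..<x + s} \<in> {{a<..<b} |a b. b - a < ?d \<and> P ((f b - f a) / (b - a))}"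
      using s(1) by blast
    moreover have "x \<in> {x + t<..<x + s}" using s tn by auto
    ultimately show ?thesis by (rule UnionI)
  qed
qed

text \<open>
  Adding \<open>(L + 1) x\<close> turns \<open>f\<close> into a bi-Lipschitz homeomorphism \<open>h\<close>. On a bounded set \<open>M\<close> where the
  difference quotients of \<open>h\<close> oscillate across \<open>p < q\<close>, the covering estimate applied to \<open>h\<close> and to its
  inverse gives \<open>q |M| \<le> |h M| \<le> p |M|\<close>.
\<close>

lemma lipschitz_AE_differentiable:
  fixes f :: "real \<Rightarrow> real"
  assumes lip: "L-lipschitz_on UNIV f"
  shows "AE x in lborel. f differentiable (at x)"
proof -
  define h where "h x = f x + (L + 1) * x" for x
  have L: "0 \<le> L" using lip by (rule lipschitz_on_nonneg)
  have f: "\<bar>f y - f x\<bar> \<le> L * (y - x)" if "x \<le> y" for x y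
    using lipschitz_onD[OF lip, of y x] that by (simp add: dist_real_def)
  have h1: "y - x \<le> h y - h x" and h2: "h y - h x \<le> (2 * L + 1) * (y - x)" if "x \<le> y" for x y
    using f[OF that] by (auto simp: h_def algebra_simps)
  have smono: "strict_mono h"
  proof (rule strict_monoI)
    show "h x < h y" if "x < y" for x y using h1[of x y] that by simp
  qed
  have hlip: "(2 * L + 1)-lipschitz_on UNIV h"
  proof (rule lipschitz_on_leI)
    fix x y :: real assume "x \<le> y"
    then show "dist (h x) (h y) \<le> (2 * L + 1) * dist x y"
      using h1[of x y] h2[of x y] by (simp add: dist_real_def)
  qed (use L in auto)
  have hcont: "continuous_on UNIV h"
    using hlip by (rule lipschitz_on_continuous_on)
  have "\<exists>x. h x = y" for y
  proof -
    define a where "a = min 0 (y - h 0)"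
    define b where "b = max 0 (y - h 0)"
    have "h a \<le> y" "y \<le> h b"
      using h1[of a 0] h1[of 0 b] by (auto simp: a_def b_def)
    moreover have "a \<le> b" by (auto simp: a_def b_def)
    ultimately show ?thesis
      using IVT'[of h a y b] continuous_on_subset[OF hcont] by blast
  qed
  then have surj: "surj h" unfolding surj_def by metis
  have inj: "inj h" using smono by (rule strict_mono_imp_inj_on)
  define g where "g = inv h"
  have hg: "h (g y) = y" and gh: "g (h x) = x" for x y
    using surj inj by (simp_all add: g_def surj_f_inv_f)
  have gmono: "strict_mono g"
    using strict_mono_less[OF smono, of "g x" "g y" for x y] by (simp add: strict_mono_def hg)
  have glip: "1-lipschitz_on UNIV g"
  proof (rule lipschitz_on_leI)
    fix x y :: real assume "x \<le> y"
    then have "g x \<le> g y" using gmono by (simp add: strict_mono_less_eq)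
    then show "dist (g x) (g y) \<le> 1 * dist x y"
      using h1[of "g x" "g y"] \<open>x \<le> y\<close> by (simp add: dist_real_def hg)
  qed auto
  have gcont: "continuous_on UNIV g"
    using glip by (rule lipschitz_on_continuous_on)
  \<comment> \<open>The ball makes the measure finite, so that q |M| \<le> p |M| can be turned into
    |M| = 0.\<close>
  define E where "E p q n = slope_set h (\<lambda>s. s < p) \<inter> slope_set h (\<lambda>s. q < s) \<inter> ball 0 (real n)"
    for p q n
  have null: "E p q n \<in> null_sets lborel" if pq: "p < q" for p q n
  proof (cases "E p q n = {}")
    case False
    let ?M = "E p q n"
    have lt: "a < b" if "a < x" "x < b" for a x b :: real using that by auto
    obtain x where x: "x \<in> ?M" using False by auto
    then obtain a b where ab: "a < x" "x < b" "(h b - h a) / (b - a) < p"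
      unfolding E_def by (auto elim: slope_setD[of x h _ 1])
    \<comment> \<open>Slopes of \<open>h\<close> are at least 1, so a single point of the set forces
      \<open>p > 0\<close>; then \<open>q\<close> is positive and may be divided by.\<close>
    then have "1 \<le> (h b - h a) / (b - a)" using h1[of a b] by (simp add: le_divide_eq)
    with ab have p: "0 < p" by linarith
    then have q: "0 < q" using pq by simp
    have M: "?M \<in> sets borel" unfolding E_def by (intro sets.Int borel_slope_set) auto
    have "h ` ?M = g -` ?M"
    proof (intro set_eqI iffI)
      show "y \<in> g -` ?M" if "y \<in> h ` ?M" for y using that gh by auto
      show "y \<in> h ` ?M" if "y \<in> g -` ?M" for y using that hg[of y] by (metis image_eqI vimageD)
    qed
    then have hM: "h ` ?M \<in> sets borel"
      using measurable_sets_borel[OF borel_measurable_continuous_onI[OF gcont] M] by simp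
    have ghM: "g ` (h ` ?M) = ?M" by (simp add: image_image gh)
    have fin: "emeasure lborel ?M < \<infinity>"
      by (rule emeasure_bounded_finite) (auto simp: E_def intro: bounded_subset[OF bounded_ball])
    have 1: "emeasure lborel (h ` ?M) \<le> ennreal p * emeasure lborel ?M"
    proof (rule emeasure_image_le_slope[OF smono hlip M hM])
      fix x d :: real assume "x \<in> ?M" "0 < d"
      then obtain a b where "a < x" "x < b" "b - a < d" "(h b - h a) / (b - a) < p"
        unfolding E_def by (auto elim: slope_setD[of x h _ d])
      then show "\<exists>a b. a < x \<and> x < b \<and> b - a < d \<and> h b - h a \<le> p * (b - a)"
        by (intro exI[of _ a] exI[of _ b]) (auto simp: divide_less_eq)
    qed (use p in simp)
    have "emeasure lborel (g ` (h ` ?M)) \<le> ennreal (1 / q) * emeasure lborel (h ` ?M)"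
    proof (rule emeasure_image_le_slope[OF gmono glip hM])
      show "g ` (h ` ?M) \<in> sets borel" using M ghM by simp
      fix y d :: real assume "y \<in> h ` ?M" and d: "0 < d"
      then obtain x where x: "x \<in> ?M" "y = h x" by auto
      \<comment> \<open>\<open>2 * L + 1\<close> bounds the slopes of \<open>h\<close>, so an
        interval this short has an image shorter than \<open>d\<close>.\<close>
      have "0 < d / (2 * L + 1)" using d L by simp
      with x obtain a b where ab: "a < x" "x < b" "b - a < d / (2 * L + 1)" "q < (h b - h a) / (b - a)"
        unfolding E_def by (auto elim: slope_setD[of x h _ "d / (2 * L + 1)"])
      have "h a < y" "y < h b" using x ab smono by (auto simp: strict_mono_less)
      moreover have "h b - h a < d"
        using h2[of a b] ab L by (simp add: less_divide_eq mult.commute)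
      moreover have "b - a \<le> 1 / q * (h b - h a)"
        using ab q by (simp add: field_simps)
      ultimately show "\<exists>a b. a < y \<and> y < b \<and> b - a < d \<and> g b - g a \<le> 1 / q * (b - a)"
        by (intro exI[of _ "h a"] exI[of _ "h b"]) (simp add: gh)
    qed (use q in simp)
    then have "emeasure lborel ?M \<le> ennreal (1 / q) * (ennreal p * emeasure lborel ?M)"
      using 1 unfolding ghM by (meson mult_left_mono order_trans zero_le)
    moreover obtain m where m: "emeasure lborel ?M = ennreal m" "0 \<le> m"
      using fin by (cases "emeasure lborel ?M") auto
    ultimately have "m \<le> 1 / q * (p * m)"
      using p q by (simp add: ennreal_mult[symmetric] ennreal_le_iff)
    then have "m * (q - p) \<le> 0" using q by (simp add: field_simps)
    then have "m = 0" using m pq by (simp add: mult_le_0_iff)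
    then show ?thesis using m M by (auto simp: null_sets_def)
  qed simp
  let ?I = "{(p, q). p \<in> \<rat> \<and> q \<in> \<rat> \<and> p < (q::real)} \<times> (UNIV :: nat set)"
  have cI: "countable ?I"
    by (rule countable_subset[of _ "(\<rat> \<times> \<rat>) \<times> UNIV"]) (auto simp: countable_rat)
  have N: "(\<Union>((p, q), n)\<in>?I. E p q n) \<in> null_sets lborel"
    by (rule null_sets_UN'[OF cI]) (auto intro!: null)
  show ?thesis
  proof (rule AE_I'[OF N], safe)
    fix x assume nd: "\<not> f differentiable (at x)"
    have "\<not> h differentiable (at x)"
    proof
      assume "h differentiable (at x)"
      then have "(\<lambda>x. h x - (L + 1) * x) differentiable (at x)"
        by (intro differentiable_diff differentiable_mult differentiable_const differentiable_ident)
      then show False using nd by (simp add: h_def)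
    qed
    then have nolim: "\<not> (\<exists>l. ((\<lambda>t. (h (x + t) - h x) / t) \<longlongrightarrow> l) (at 0))"
      by (simp add: differentiable_at_real_iff)
    have bd: "eventually (\<lambda>t. 1 \<le> (h (x + t) - h x) / t \<and> (h (x + t) - h x) / t \<le> 2 * L + 1) (at 0)"
    proof -
      have "1 \<le> (h (x + t) - h x) / t \<and> (h (x + t) - h x) / t \<le> 2 * L + 1" if "t \<noteq> 0" for t
      proof (cases "0 < t")
        case True
        then show ?thesis using h1[of x "x + t"] h2[of x "x + t"]
          by (simp add: le_divide_eq divide_le_eq)
      next
        case False
        then have "t < 0" using that by simp
        then show ?thesis using h1[of "x + t" x] h2[of "x + t" x]
          by (simp add: le_divide_eq divide_le_eq)
      qed
      then show ?thesis by (simp add: eventually_at_filter)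
    qed
    obtain p q where pq: "p \<in> \<rat>" "q \<in> \<rat>" "p < q"
      and fr: "\<exists>\<^sub>F t in at 0. (h (x + t) - h x) / t < p" "\<exists>\<^sub>F t in at 0. q < (h (x + t) - h x) / t"
      by (rule bounded_tendsto_iff_no_oscillation[OF at_neq_bot bd nolim])
    have "open {t. t < p}" "open {t. q < t}" by (simp_all add: open_Collect_less)
    then have "x \<in> slope_set h (\<lambda>s. s < p)" "x \<in> slope_set h (\<lambda>s. q < s)"
      using slope_setI[OF hcont] fr by blast+
    moreover obtain n :: nat where "norm x < n" using reals_Archimedean2 by blast
    ultimately have "x \<in> E p q n" unfolding E_def by simp
    then show "x \<in> (\<Union>((p, q), n)\<in>?I. E p q n)"
      using pq by (intro UN_I[of "((p, q), n)"]) simp_all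
  qed
qed

section \<open>Differentiability along a fixed direction in Euclidean space\<close>

text \<open>A Cauchy criterion avoids naming the limit: the tolerances range over naturals, and the
  weak inequality at the end is a closed condition when \<phi> depends continuously on a base
  point.\<close>

lemma tendsto_at_0_iff_Cauchy:
  fixes \<phi> :: "real \<Rightarrow> real"
  shows "(\<exists>l. (\<phi> \<longlongrightarrow> l) (at 0)) \<longleftrightarrow>
    (\<forall>k. \<exists>m. \<forall>s t. s \<noteq> 0 \<longrightarrow> t \<noteq> 0 \<longrightarrow> \<bar>s\<bar> < inverse (real (Suc m)) \<longrightarrow> \<bar>t\<bar> < inverse (real (Suc m)) \<longrightarrow>
      \<bar>\<phi> s - \<phi> t\<bar> \<le> inverse (real (Suc k)))" (is "?L \<longleftrightarrow> ?R")
proof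
  assume ?L
  then obtain l where l: "(\<phi> \<longlongrightarrow> l) (at 0)" by blast
  show ?R
  proof
    fix k
    have "0 < inverse (real (Suc k)) / 2" by simp
    then obtain d where d: "d > 0" "\<And>t. t \<noteq> 0 \<Longrightarrow> \<bar>t\<bar> < d \<Longrightarrow> \<bar>\<phi> t - l\<bar> < inverse (real (Suc k)) / 2"
      using l unfolding LIM_def dist_real_def by (metis diff_zero)
    obtain m where m: "inverse (real (Suc m)) < d" using reals_Archimedean d(1) by blast
    have "\<bar>\<phi> s - \<phi> t\<bar> \<le> inverse (real (Suc k))"
      if "s \<noteq> 0" "t \<noteq> 0" "\<bar>s\<bar> < inverse (real (Suc m))" "\<bar>t\<bar> < inverse (real (Suc m))" for s t
      using d(2)[of s] d(2)[of t] that m by linarith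
    then show "\<exists>m. \<forall>s t. s \<noteq> 0 \<longrightarrow> t \<noteq> 0 \<longrightarrow> \<bar>s\<bar> < inverse (real (Suc m)) \<longrightarrow> \<bar>t\<bar> < inverse (real (Suc m)) \<longrightarrow>
      \<bar>\<phi> s - \<phi> t\<bar> \<le> inverse (real (Suc k))" by blast
  qed
next
  assume R: ?R
  define a where "a n = \<phi> (inverse (real (Suc (Suc n))))" for n
  have a_small: "\<bar>inverse (real (Suc (Suc n)))\<bar> < inverse (real (Suc m))" if "m \<le> n" for m n
    using that by (simp add: field_simps)
  have "Cauchy a"
    unfolding Cauchy_altdef2
  proof (intro allI impI)
    fix e :: real assume "0 < e"
    then obtain k where k: "inverse (real (Suc k)) < e" using reals_Archimedean by blast
    obtain m where m: "\<And>s t. s \<noteq> 0 \<Longrightarrow> t \<noteq> 0 \<Longrightarrow> \<bar>s\<bar> < inverse (real (Suc m)) \<Longrightarrow>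
      \<bar>t\<bar> < inverse (real (Suc m)) \<Longrightarrow> \<bar>\<phi> s - \<phi> t\<bar> \<le> inverse (real (Suc k))"
      using R by blast
    have "dist (a n) (a m) < e" if "m \<le> n" for n
      using m[OF _ _ a_small[OF that] a_small[of m m]] k
      by (simp add: a_def dist_real_def)
    then show "\<exists>N. \<forall>n\<ge>N. dist (a n) (a N) < e" by blast
  qed
  then obtain l where l: "a \<longlonglongrightarrow> l" by (auto simp: Cauchy_convergent_iff convergent_def)
  have "(\<phi> \<longlongrightarrow> l) (at 0)"
  proof (rule LIM_I)
    fix e :: real assume "0 < e"
    then obtain k where k: "inverse (real (Suc k)) < e" using reals_Archimedean by blast
    obtain m where m: "\<And>s t. s \<noteq> 0 \<Longrightarrow> t \<noteq> 0 \<Longrightarrow> \<bar>s\<bar> < inverse (real (Suc m)) \<Longrightarrow>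
      \<bar>t\<bar> < inverse (real (Suc m)) \<Longrightarrow> \<bar>\<phi> s - \<phi> t\<bar> \<le> inverse (real (Suc k))"
      using R by blast
    have "norm (\<phi> t - l) < e" if t: "t \<noteq> 0" "norm (t - 0) < inverse (real (Suc m))" for t
    proof -
      have "(\<lambda>n. \<bar>\<phi> t - a n\<bar>) \<longlonglongrightarrow> \<bar>\<phi> t - l\<bar>" by (intro tendsto_intros l)
      moreover have "\<bar>\<phi> t - a n\<bar> \<le> inverse (real (Suc k))" if "m \<le> n" for n
        unfolding a_def using m[OF t(1) _ _ a_small[OF that]] t(2) by simp
      ultimately have "\<bar>\<phi> t - l\<bar> \<le> inverse (real (Suc k))"
        by (intro LIMSEQ_le_const2) auto
      then show ?thesis using k by simp
    qed
    then show "\<exists>s>0. \<forall>x. x \<noteq> 0 \<and> norm (x - 0) < s \<longrightarrow> norm (\<phi> x - l) < e"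
      by (intro exI[of _ "inverse (real (Suc m))"]) simp
  qed
  then show ?L by blast
qed

text \<open>For fixed tolerances the points form an intersection of closed sets, uncountable but
  still closed, because each difference quotient is continuous in the base point. Only the
  tolerances contribute unions, and these are countable.\<close>

lemma borel_directionally_differentiable:
  fixes F :: "'a::euclidean_space \<Rightarrow> real"
  assumes F: "continuous_on UNIV F"
  shows "{x. (\<lambda>t. F (x + t *\<^sub>R e)) differentiable (at 0)} \<in> sets borel"
proof -
  define q where "q x t = (F (x + t *\<^sub>R e) - F x) / t" for x t
  \<comment> \<open>At \<open>t = 0\<close> the quotient is 0 by the convention for division by
    zero, hence still continuous.\<close>
  have q: "continuous_on UNIV (\<lambda>x. q x t)" for t
    unfolding q_def by (cases "t = 0") (auto intro!: continuous_intros continuous_on_compose2[OF F])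
  have "closed {x. \<bar>q x s - q x t\<bar> \<le> c}" for s t c
    by (intro closed_Collect_le continuous_intros q)
  moreover have "{x. \<forall>s t. s \<noteq> 0 \<longrightarrow> t \<noteq> 0 \<longrightarrow> \<bar>s\<bar> < d \<longrightarrow> \<bar>t\<bar> < d \<longrightarrow> \<bar>q x s - q x t\<bar> \<le> c}
      = (\<Inter>(s, t)\<in>{(s, t). s \<noteq> 0 \<and> t \<noteq> 0 \<and> \<bar>s\<bar> < d \<and> \<bar>t\<bar> < d}. {x. \<bar>q x s - q x t\<bar> \<le> c})" for c d
    by auto
  ultimately have cl: "closed {x. \<forall>s t. s \<noteq> 0 \<longrightarrow> t \<noteq> 0 \<longrightarrow> \<bar>s\<bar> < d \<longrightarrow> \<bar>t\<bar> < d \<longrightarrow> \<bar>q x s - q x t\<bar> \<le> c}" for c d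
    by (auto intro!: closed_INT)
  have "{x. (\<lambda>t. F (x + t *\<^sub>R e)) differentiable (at 0)} =
    (\<Inter>k. \<Union>m. {x. \<forall>s t. s \<noteq> 0 \<longrightarrow> t \<noteq> 0 \<longrightarrow> \<bar>s\<bar> < inverse (real (Suc m)) \<longrightarrow> \<bar>t\<bar> < inverse (real (Suc m)) \<longrightarrow>
      \<bar>q x s - q x t\<bar> \<le> inverse (real (Suc k))})"
    unfolding differentiable_at_real_iff tendsto_at_0_iff_Cauchy q_def by auto
  also have "\<dots> \<in> sets borel"
  proof (rule sets.countable_INT)
    show "range (\<lambda>k. \<Union>m. {x. \<forall>s t. s \<noteq> 0 \<longrightarrow> t \<noteq> 0 \<longrightarrow> \<bar>s\<bar> < inverse (real (Suc m)) \<longrightarrow> \<bar>t\<bar> < inverse (real (Suc m)) \<longrightarrow>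
      \<bar>q x s - q x t\<bar> \<le> inverse (real (Suc k))}) \<subseteq> sets borel"
      using borel_closed[OF cl] by (intro image_subsetI sets.countable_UN) blast
  qed auto
  finally show ?thesis .
qed

text \<open>
  Translating the exceptional set \<open>N\<close> along \<open>t e\<close> with \<open>0 \<le> t \<le> 1\<close> and applying Fubini reduces the
  claim to lines, without choosing coordinates adapted to \<open>e\<close>.
\<close>

lemma lipschitz_AE_directionally_differentiable:
  fixes F :: "'a::euclidean_space \<Rightarrow> real"
  assumes lip: "L-lipschitz_on UNIV F"
  shows "AE x in lborel. (\<lambda>t. F (x + t *\<^sub>R e)) differentiable (at 0)"
proof -
  define N where "N = {x. \<not> (\<lambda>t. F (x + t *\<^sub>R e)) differentiable (at 0)}"
  have F: "continuous_on UNIV F" using lip by (rule lipschitz_on_continuous_on)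
  have "N = UNIV - {x. (\<lambda>t. F (x + t *\<^sub>R e)) differentiable (at 0)}" by (auto simp: N_def)
  then have N[measurable]: "N \<in> sets borel" using borel_directionally_differentiable[OF F, of e] by auto
  define \<psi> where "\<psi> = (\<lambda>(x, t). indicator {0..1::real} t * indicator N (x + t *\<^sub>R e) :: ennreal)"
  have \<psi>: "\<psi> \<in> borel_measurable (lborel \<Otimes>\<^sub>M lborel)"
    unfolding \<psi>_def by measurable
  have line: "(\<integral>\<^sup>+t. \<psi> (x, t) \<partial>lborel) = 0" for x
  proof -
    have "(L * norm e)-lipschitz_on UNIV (\<lambda>t. F (x + t *\<^sub>R e))"
    proof (rule lipschitz_onI)
      fix s t :: real
      have "dist (F (x + s *\<^sub>R e)) (F (x + t *\<^sub>R e)) \<le> L * dist (x + s *\<^sub>R e) (x + t *\<^sub>R e)"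
        by (rule lipschitz_onD[OF lip]) auto
      also have "dist (x + s *\<^sub>R e) (x + t *\<^sub>R e) = norm e * dist s t"
        by (simp add: dist_norm scaleR_diff_left[symmetric])
      finally show "dist (F (x + s *\<^sub>R e)) (F (x + t *\<^sub>R e)) \<le> L * norm e * dist s t" by simp
    qed (use lipschitz_on_nonneg[OF lip] in simp)
    then have "AE t in lborel. (\<lambda>t. F (x + t *\<^sub>R e)) differentiable (at t)"
      by (rule lipschitz_AE_differentiable)
    then have "AE t in lborel. \<psi> (x, t) = 0"
    proof (rule AE_mp, intro AE_I2 impI)
      fix t assume d: "(\<lambda>t. F (x + t *\<^sub>R e)) differentiable (at t)"
      have "(\<lambda>s. F (x + (t + s) *\<^sub>R e)) differentiable (at 0)"
        using differentiable_compose[of "\<lambda>t. F (x + t *\<^sub>R e)" "\<lambda>s. t + s" 0 UNIV] d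
        by (simp add: derivative_intros)
      then have "x + t *\<^sub>R e \<notin> N" by (simp add: N_def scaleR_add_left add.assoc)
      then show "\<psi> (x, t) = 0" by (simp add: \<psi>_def)
    qed
    moreover have "(\<lambda>t. \<psi> (x, t)) \<in> borel_measurable lborel"
      using \<psi> by measurable
    ultimately show ?thesis by (simp add: nn_integral_0_iff_AE)
  qed
  \<comment> \<open>Translation invariance makes the inner integral the same for all
    \<open>t\<close> in the unit interval, so this order of integration returns the measure of
    \<open>N\<close>, while the other order gives 0.\<close>
  have shift: "(\<integral>\<^sup>+x. \<psi> (x, t) \<partial>lborel) = indicator {0..1} t * emeasure lborel N" for t
  proof -
    have "(\<integral>\<^sup>+x. indicator N (x + t *\<^sub>R e) \<partial>lborel)
        = (\<integral>\<^sup>+x. indicator N x \<partial>distr lborel borel (\<lambda>x. x + t *\<^sub>R e))"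
      by (subst nn_integral_distr) auto
    also have "distr lborel borel (\<lambda>x. x + t *\<^sub>R e) = lborel"
      using lborel_distr_plus[of "t *\<^sub>R e"] by (simp add: add.commute[of _ "t *\<^sub>R e"])
    finally show ?thesis
      unfolding \<psi>_def by (simp add: nn_integral_cmult)
  qed
  have "emeasure lborel N = (\<integral>\<^sup>+t. indicator {0..1} t * emeasure lborel N \<partial>(lborel :: real measure))"
    by (subst nn_integral_multc) auto
  also have "\<dots> = (\<integral>\<^sup>+t. \<integral>\<^sup>+x. \<psi> (x, t) \<partial>lborel \<partial>lborel)"
    by (simp add: shift)
  also have "\<dots> = (\<integral>\<^sup>+x. \<integral>\<^sup>+t. \<psi> (x, t) \<partial>lborel \<partial>lborel)"
    by (rule lborel_pair.Fubini) (rule \<psi>)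
  also have "\<dots> = 0" by (simp add: line)
  finally have "N \<in> null_sets lborel" by (simp add: null_sets_def)
  then show ?thesis by (rule AE_I') (auto simp: N_def)
qed

text \<open>McShane's extension, the lower envelope of the cones of slope \<open>L\<close> over the
  graph. On the whole space, difference quotients and translations can be formed without regard to
  the boundary of \<open>U\<close>, and the constant is kept.\<close>

lemma lipschitz_extension:
  fixes f :: "'a::metric_space \<Rightarrow> real"
  assumes lip: "L-lipschitz_on U f"
  obtains F where "L-lipschitz_on UNIV F" "\<And>x. x \<in> U \<Longrightarrow> F x = f x"
proof (cases "U = {}")
  case True
  then show ?thesis using that[of "\<lambda>_. 0"] lipschitz_on_nonneg[OF lip]
    by (auto intro: lipschitz_on_mono[OF lipschitz_on_constant])
next
  case False
  then obtain y0 where y0: "y0 \<in> U" by auto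
  have L: "0 \<le> L" using lip by (rule lipschitz_on_nonneg)
  define F where "F x = (INF y\<in>U. f y + L * dist x y)" for x
  have bdd: "bdd_below ((\<lambda>y. f y + L * dist x y) ` U)" for x
  proof (rule bdd_belowI2)
    fix y assume y: "y \<in> U"
    have "f y0 - f y \<le> L * dist y0 y" using lipschitz_onD[OF lip y0 y] by (simp add: dist_real_def)
    also have "\<dots> \<le> L * (dist x y0 + dist x y)"
      by (rule mult_left_mono) (use L dist_triangle3[of y0 y x] in \<open>auto simp: dist_commute\<close>)
    finally show "f y0 - L * dist x y0 \<le> f y + L * dist x y" by (simp add: algebra_simps)
  qed
  have le: "F x \<le> F x' + L * dist x x'" for x x'
  proof -
    have "F x - L * dist x x' \<le> F x'"
      unfolding F_def[of x']
    proof (rule cINF_greatest[OF False])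
      fix y assume y: "y \<in> U"
      have "F x \<le> f y + L * dist x y" unfolding F_def by (rule cINF_lower[OF bdd y])
      also have "L * dist x y \<le> L * (dist x x' + dist x' y)"
        by (rule mult_left_mono[OF dist_triangle L])
      finally show "F x - L * dist x x' \<le> f y + L * dist x' y" by (simp add: algebra_simps)
    qed
    then show ?thesis by simp
  qed
  have "L-lipschitz_on UNIV F"
  proof (rule lipschitz_onI[OF _ L])
    show "dist (F x) (F y) \<le> L * dist x y" for x y
      using le[of x y] le[of y x] by (simp add: dist_real_def dist_commute)
  qed
  moreover have "F x = f x" if x: "x \<in> U" for x
  proof (rule antisym)
    show "F x \<le> f x" unfolding F_def using cINF_lower[OF bdd x, of x] by simp
    show "f x \<le> F x" unfolding F_def
    proof (rule cINF_greatest[OF False])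
      fix y assume y: "y \<in> U"
      show "f x \<le> f y + L * dist x y" using lipschitz_onD[OF lip x y] by (simp add: dist_real_def)
    qed
  qed
  ultimately show ?thesis by (rule that)
qed

section \<open>Weak partial derivatives of Lipschitz functions\<close>

lemma AE_lebesgue_onI:
  assumes "S \<in> sets lebesgue" "AE x in lborel. P x"
  shows "AE x in lebesgue_on S. P x"
  using AE_completion[OF assms(2)] assms(1) by (auto simp: AE_restrict_space_iff elim: eventually_mono)

lemma integrable_lebesgue_on_bounded:
  fixes h :: "'a::euclidean_space \<Rightarrow> real"
  assumes K: "K \<in> lmeasurable" and h: "h \<in> borel_measurable lborel"
    and B: "AE x in lebesgue_on K. \<bar>h x\<bar> \<le> B"
  shows "integrable (lebesgue_on K) h"
proof -
  interpret finite_measure "lebesgue_on K" using K by (rule finite_measure_lebesgue_on)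
  have "h \<in> borel_measurable (lebesgue_on K)"
    by (intro measurable_restrict_space1 measurable_completion h)
  then show ?thesis using B by (intro integrable_const_bound[of _ B]) auto
qed

lemma integrable_compact_support:
  fixes h :: "'a::euclidean_space \<Rightarrow> real"
  assumes "continuous_on UNIV h" "compact K" "\<And>x. x \<notin> K \<Longrightarrow> h x = 0"
  shows "integrable lborel h"
proof -
  have "integrable lborel (\<lambda>x. indicator K x *\<^sub>R h x)"
    using assms by (intro borel_integrable_compact) (auto intro: continuous_on_subset)
  moreover have "(\<lambda>x. indicator K x *\<^sub>R h x) = h" by (intro ext) (use assms(3) in \<open>auto simp: indicator_def\<close>)
  ultimately show ?thesis by simp
qed

lemma lborel_integral_translate:
  fixes h :: "'a::euclidean_space \<Rightarrow> real"
  assumes "h \<in> borel_measurable borel"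
  shows "(LINT x|lborel. h (x + c)) = (LINT x|lborel. h x)"
proof -
  have "(LINT x|lborel. h x) = (LINT x|distr lborel borel ((+) c). h x)"
    by (simp add: lborel_distr_plus)
  also have "\<dots> = (LINT x|lborel. h (c + x))"
    by (rule integral_distr) (use assms in auto)
  finally show ?thesis by (simp add: add.commute)
qed

lemma partial_DERIV:
  assumes "f differentiable (at (x + s *\<^sub>R axis j 1))"
  shows "((\<lambda>t. f (x + t *\<^sub>R axis j 1)) has_real_derivative partial j f (x + s *\<^sub>R axis j 1)) (at s)"
proof -
  let ?e = "axis j 1 :: real^'a"
  have d: "(\<lambda>t. f (y + t *\<^sub>R ?e)) differentiable (at t)" if "f differentiable (at (y + t *\<^sub>R ?e))" for y t
  proof -
    have "(\<lambda>t. y + t *\<^sub>R ?e) differentiable (at t)" by (intro derivative_intros)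
    with that show ?thesis
      using differentiable_chain_at[of "\<lambda>t. y + t *\<^sub>R ?e" t f] by (simp add: o_def)
  qed
  let ?y = "x + s *\<^sub>R ?e"
  have "(\<lambda>t. f (?y + t *\<^sub>R ?e)) differentiable (at 0)" using assms by (intro d) simp
  then have "((\<lambda>t. f (?y + t *\<^sub>R ?e)) has_real_derivative partial j f ?y) (at 0)"
    unfolding partial_def by (simp add: DERIV_deriv_iff_real_differentiable)
  then show ?thesis
    unfolding DERIV_def by (simp add: scaleR_add_left add.assoc)
qed

lemma partial_cong_open:
  assumes "open U" "x \<in> U" "\<And>y. y \<in> U \<Longrightarrow> f y = g y"
  shows "partial j f x = partial j g x" "partially_differentiable j f x = partially_differentiable j g x"
proof -
  have "open ((\<lambda>t::real. x + t *\<^sub>R axis j 1) -` U)"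
    by (intro open_vimage assms continuous_intros)
  then have "eventually (\<lambda>t::real. t \<in> (\<lambda>t. x + t *\<^sub>R axis j 1) -` U) (nhds 0)"
    by (rule eventually_nhds_in_open) (use assms in simp)
  then have ev: "eventually (\<lambda>t::real. f (x + t *\<^sub>R axis j 1) = g (x + t *\<^sub>R axis j 1)) (nhds 0)"
    by (rule eventually_mono) (use assms in auto)
  show "partial j f x = partial j g x"
    unfolding partial_def by (rule deriv_cong_ev[OF ev refl])
  show "partially_differentiable j f x = partially_differentiable j g x"
    unfolding partially_differentiable_def real_differentiable_def
    using DERIV_cong_ev[OF refl ev refl] by simp
qed

lemma partially_differentiable_tendsto:
  assumes "partially_differentiable j f x"
  shows "((\<lambda>t. (f (x + t *\<^sub>R axis j 1) - f x) / t) \<longlongrightarrow> partial j f x) (at 0)"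
  using assms unfolding partially_differentiable_def partial_def
  by (simp add: DERIV_deriv_iff_real_differentiable[symmetric] DERIV_def)

lemma partial_lipschitz_bound:
  assumes lip: "L-lipschitz_on UNIV F" and d: "partially_differentiable j F x"
  shows "\<bar>partial j F x\<bar> \<le> L"
proof -
  have "\<bar>(F (x + t *\<^sub>R axis j 1) - F x) / t\<bar> \<le> L" for t
  proof (cases "t = 0")
    case False
    have "dist (F (x + t *\<^sub>R axis j 1)) (F x) \<le> L * dist (x + t *\<^sub>R axis j 1) x"
      by (rule lipschitz_onD[OF lip]) auto
    then show ?thesis using False by (simp add: dist_real_def dist_norm pos_divide_le_eq norm_axis_1)
  qed (use lipschitz_on_nonneg[OF lip] in simp)
  then show ?thesis
    by (intro tendsto_upperbound[OF tendsto_rabs[OF partially_differentiable_tendsto[OF d]]]) auto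
qed

text \<open>The ingredients of the integration by parts. The partial derivative is supported in the
  same \<open>K\<close>, because \<phi> vanishes on the open complement. The quotient is a backward
  one, since translation moves a forward step of the other factor onto \<phi> with the opposite
  sign.\<close>

lemma test_function_properties:
  fixes \<phi> :: "real^'m::finite \<Rightarrow> real"
  assumes "test_function U \<phi>"
  obtains K M where "compact K" "K \<subseteq> U" "\<And>x. x \<notin> K \<Longrightarrow> \<phi> x = 0" "\<And>x. x \<notin> K \<Longrightarrow> partial j \<phi> x = 0"
    "continuous_on UNIV \<phi>" "continuous_on UNIV (partial j \<phi>)"
    "0 \<le> M" "\<And>x t. \<bar>\<phi> (x + t *\<^sub>R axis j 1) - \<phi> x\<bar> \<le> M * \<bar>t\<bar>"
    "\<And>x. ((\<lambda>t. (\<phi> x - \<phi> (x - t *\<^sub>R axis j 1)) / t) \<longlongrightarrow> partial j \<phi> x) (at 0)"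
proof -
  let ?e = "axis j 1 :: real^'m"
  obtain K where K: "compact K" "K \<subseteq> U" "\<And>x. x \<notin> K \<Longrightarrow> \<phi> x = 0"
    using assms unfolding test_function_def by blast
  have "foldr partial [] \<phi> differentiable (at x)" "foldr partial [j] \<phi> differentiable (at x)" for x
    using assms unfolding test_function_def by blast+
  then have diff: "\<phi> differentiable (at x)" "partial j \<phi> differentiable (at x)" for x
    by simp_all
  have cont: "continuous_on UNIV \<phi>" "continuous_on UNIV (partial j \<phi>)"
    using diff by (auto intro!: differentiable_imp_continuous_on simp: differentiable_on_def
        intro: differentiable_at_withinI)
  have "partial j \<phi> x = partial j (\<lambda>_. 0) x" if "x \<notin> K" for x
    by (rule partial_cong_open[of "- K"]) (use that K in \<open>auto simp: compact_imp_closed\<close>)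
  then have p0: "partial j \<phi> x = 0" if "x \<notin> K" for x
    using that by (simp add: partial_def)
  have "bounded (partial j \<phi> ` K)"
    using K(1) cont(2) by (intro compact_imp_bounded compact_continuous_image) (auto intro: continuous_on_subset)
  then obtain M where "0 < M" and M: "\<And>x. x \<in> K \<Longrightarrow> \<bar>partial j \<phi> x\<bar> \<le> M"
    unfolding bounded_pos by auto
  have M': "\<bar>partial j \<phi> x\<bar> \<le> M" for x
    using M[of x] p0[of x] \<open>0 < M\<close> by (cases "x \<in> K") auto
  have D: "((\<lambda>t. \<phi> (x + t *\<^sub>R ?e)) has_real_derivative partial j \<phi> (x + s *\<^sub>R ?e)) (at s)" for x s
    by (rule partial_DERIV[OF diff(1)])
  have lip: "\<bar>\<phi> (x + t *\<^sub>R ?e) - \<phi> x\<bar> \<le> M * \<bar>t\<bar>" for x t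
    using field_differentiable_bound[of UNIV "\<lambda>t. \<phi> (x + t *\<^sub>R ?e)" "\<lambda>s. partial j \<phi> (x + s *\<^sub>R ?e)" M t 0]
      D M' by simp
  have "((\<lambda>t. (\<phi> x - \<phi> (x - t *\<^sub>R ?e)) / t) \<longlongrightarrow> partial j \<phi> x) (at 0)" for x
  proof -
    have "((\<lambda>t. (\<phi> (x + t *\<^sub>R ?e) - \<phi> x) / t) \<longlongrightarrow> partial j \<phi> x) (at 0)"
      using D[of x 0] by (simp add: DERIV_def)
    moreover have "filterlim uminus (at 0) (at (0::real))"
      by (intro filterlim_atI) (auto intro!: tendsto_eq_intros simp: eventually_at_filter)
    ultimately have "((\<lambda>t. (\<phi> (x + (- t) *\<^sub>R ?e) - \<phi> x) / (- t)) \<longlongrightarrow> partial j \<phi> x) (at 0)"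
      by (rule filterlim_compose)
    then show ?thesis by (simp add: minus_divide_left[symmetric] diff_divide_distrib)
  qed
  then show ?thesis
    using that[OF K p0 cont _ lip] \<open>0 < M\<close> by simp
qed

text \<open>Discrete integration by parts followed by two passages to the limit under dominating
  functions. Since the quotients of \<open>F\<close> converge to the classical derivative almost
  everywhere, that derivative is also the weak one.\<close>

lemma lipschitz_weak_partial:
  fixes f :: "real^'m::finite \<Rightarrow> real"
  assumes U: "open U" and lip: "L-lipschitz_on U f"
  obtains g where "has_weak_partial U j f g" "g \<in> borel_measurable borel"
    "AE x in lebesgue_on U. partially_differentiable j f x \<and> g x = partial j f x \<and> \<bar>g x\<bar> \<le> L"
proof -
  let ?e = "axis j 1 :: real^'m"
  obtain F where F: "L-lipschitz_on UNIV F" and Ff: "\<And>x. x \<in> U \<Longrightarrow> F x = f x"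
    using lipschitz_extension[OF lip] by blast
  have L: "0 \<le> L" using lip by (rule lipschitz_on_nonneg)
  have Fc: "continuous_on UNIV F" using F by (rule lipschitz_on_continuous_on)
  then have Fm[measurable]: "F \<in> borel_measurable borel" by (rule borel_measurable_continuous_onI)
  define h where "h n = inverse (real (Suc n))" for n
  have h: "h n > 0" "h n \<le> 1" for n by (auto simp: h_def inverse_le_1_iff)
  have h0: "h \<longlonglongrightarrow> 0" unfolding h_def by (rule LIMSEQ_inverse_real_of_nat)
  have hat: "filterlim h (at 0) sequentially"
    using h0 h(1) by (intro filterlim_atI) (auto intro!: always_eventually simp: less_imp_neq[symmetric])
  define q where "q n x = (F (x + h n *\<^sub>R ?e) - F x) / h n" for n x
  have qm[measurable]: "q n \<in> borel_measurable borel" for n unfolding q_def by measurable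
  have qb: "\<bar>q n x\<bar> \<le> L" for n x
  proof -
    have "dist (F (x + h n *\<^sub>R ?e)) (F x) \<le> L * dist (x + h n *\<^sub>R ?e) x"
      by (rule lipschitz_onD[OF F]) auto
    then show ?thesis using h(1)[of n]
      by (simp add: q_def dist_real_def dist_norm pos_divide_le_eq norm_axis_1)
  qed
  \<comment> \<open>\<open>lim\<close> has some value even where the quotients diverge; this keeps
    \<open>g\<close> Borel measurable on the whole space, and such points form a null set.\<close>
  define g where "g x = lim (\<lambda>n. q n x)" for x
  have gm[measurable]: "g \<in> borel_measurable borel"
    unfolding g_def by (rule borel_measurable_lim_metric) simp
  have AEF: "AE x in lborel. partially_differentiable j F x"
    using lipschitz_AE_directionally_differentiable[OF F] by (simp add: partially_differentiable_def)
  have lim: "(\<lambda>n. q n x) \<longlonglongrightarrow> partial j F x" if "partially_differentiable j F x" for x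
    unfolding q_def using filterlim_compose[OF partially_differentiable_tendsto[OF that] hat] .
  have AEg: "AE x in lborel. partially_differentiable j F x \<and> (\<lambda>n. q n x) \<longlonglongrightarrow> g x
      \<and> g x = partial j F x \<and> \<bar>g x\<bar> \<le> L"
    using AEF
  proof eventually_elim
    fix x assume x: "partially_differentiable j F x"
    have "g x = partial j F x" using limI[OF lim[OF x]] by (simp add: g_def)
    then show "partially_differentiable j F x \<and> (\<lambda>n. q n x) \<longlonglongrightarrow> g x
      \<and> g x = partial j F x \<and> \<bar>g x\<bar> \<le> L"
      using x lim[OF x] partial_lipschitz_bound[OF F x] by simp
  qed
  have Um: "U \<in> sets lebesgue" using U by simp
  have AE_U: "AE x in lebesgue_on U. partially_differentiable j f x \<and> g x = partial j f x \<and> \<bar>g x\<bar> \<le> L"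
  proof -
    have "AE x in lborel. x \<in> U \<longrightarrow> partially_differentiable j f x \<and> g x = partial j f x \<and> \<bar>g x\<bar> \<le> L"
      using AEg
    proof eventually_elim
      case (elim x)
      then show ?case using partial_cong_open[OF U _ Ff, where j=j] by auto
    qed
    then have "AE x in lebesgue. x \<in> U \<longrightarrow> partially_differentiable j f x \<and> g x = partial j f x \<and> \<bar>g x\<bar> \<le> L"
      by (rule AE_completion)
    then show ?thesis
      using AE_restrict_space_iff[of U lebesgue] Um by (subst AE_restrict_space_iff) (simp_all del: AE_conj_iff)
  qed
  have "has_weak_partial U j f g"
    unfolding has_weak_partial_def
  proof (intro conjI allI impI)
    show "locally_integrable U f"
      unfolding locally_integrable_def
    proof (intro allI impI)
      fix K assume K: "compact K \<and> K \<subseteq> U"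
      have "bounded (F ` K)"
        using K Fc by (intro compact_imp_bounded compact_continuous_image) (auto intro: continuous_on_subset)
      then obtain B where B: "\<And>x. x \<in> K \<Longrightarrow> \<bar>F x\<bar> \<le> B" unfolding bounded_iff by auto
      have "integrable (lebesgue_on K) F"
        by (rule integrable_lebesgue_on_bounded[of _ _ B])
          (use K B in \<open>auto simp: lmeasurable_compact intro!: AE_I2\<close>)
      then show "integrable (lebesgue_on K) f"
        by (subst Bochner_Integration.integrable_cong[OF refl, of _ _ F]) (use K Ff in auto)
    qed
    show "locally_integrable U g"
      unfolding locally_integrable_def
    proof (intro allI impI)
      fix K assume K: "compact K \<and> K \<subseteq> U"
      then have Kl: "K \<in> lmeasurable" by (simp add: lmeasurable_compact)
      have "AE x in lborel. \<bar>g x\<bar> \<le> L" using AEg by eventually_elim auto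
      then have "AE x in lebesgue_on K. \<bar>g x\<bar> \<le> L"
        using Kl by (intro AE_lebesgue_onI) auto
      then show "integrable (lebesgue_on K) g"
        by (intro integrable_lebesgue_on_bounded[OF Kl]) auto
    qed
  next
    fix \<phi> assume "test_function U \<phi>"
    then obtain K M where K: "compact K" "K \<subseteq> U" "\<And>x. x \<notin> K \<Longrightarrow> \<phi> x = 0" "\<And>x. x \<notin> K \<Longrightarrow> partial j \<phi> x = 0"
      and \<phi>c: "continuous_on UNIV \<phi>" and pc: "continuous_on UNIV (partial j \<phi>)"
      and M: "0 \<le> M" "\<And>x t. \<bar>\<phi> (x + t *\<^sub>R ?e) - \<phi> x\<bar> \<le> M * \<bar>t\<bar>"
      and \<phi>lim: "\<And>x. ((\<lambda>t. (\<phi> x - \<phi> (x - t *\<^sub>R ?e)) / t) \<longlongrightarrow> partial j \<phi> x) (at 0)"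
      by (rule test_function_properties[of U \<phi> j]) blast
    have [measurable]: "\<phi> \<in> borel_measurable borel" "partial j \<phi> \<in> borel_measurable borel"
      using \<phi>c pc by (auto intro: borel_measurable_continuous_onI)
    \<comment> \<open>Factors vanishing outside \<open>K\<close> turn integrals over
      \<open>U\<close> into integrals over the whole space, where \<open>f\<close> may be replaced
      by its extension \<open>F\<close>.\<close>
    have toR: "(LINT x|lebesgue_on U. u x * v x) = (LINT x|lborel. u' x * v x)"
      if "\<And>x. x \<in> U \<Longrightarrow> u x = u' x" "\<And>x. x \<notin> K \<Longrightarrow> v x = 0"
        and [measurable]: "u' \<in> borel_measurable borel" "v \<in> borel_measurable borel" for u u' v :: "real^'m \<Rightarrow> real"
    proof -
      have "(LINT x|lebesgue_on U. u x * v x) = (LINT x|lebesgue. indicator U x *\<^sub>R (u x * v x))"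
        using Um by (intro integral_restrict_space) auto
      also have "(\<lambda>x. indicator U x *\<^sub>R (u x * v x)) = (\<lambda>x. u' x * v x)"
        by (intro ext) (use that(1,2) K(2) in \<open>auto simp: indicator_def\<close>)
      also have "(LINT x|lebesgue. u' x * v x) = (LINT x|lborel. u' x * v x)"
        by (rule integral_completion) simp
      finally show ?thesis .
    qed
    obtain R where R: "K \<subseteq> cball 0 R"
      using compact_imp_bounded[OF K(1)] bounded_subset_ballD[of K 0] ball_subset_cball by blast
    \<comment> \<open>The steps satisfy \<open>h n \<le> 1\<close>, so one more unit of radius
      contains the supports of all translates.\<close>
    define K' where "K' = cball (0::real^'m) (R + 1)"
    have K': "compact K'" unfolding K'_def by simp
    have KK': "x \<in> K'" if "x - t *\<^sub>R ?e \<in> K" "0 \<le> t" "t \<le> 1" for x t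
    proof -
      have "norm x \<le> norm (x - t *\<^sub>R ?e) + norm (t *\<^sub>R ?e)"
        using norm_triangle_ineq[of "x - t *\<^sub>R ?e" "t *\<^sub>R ?e"] by simp
      moreover have "norm (x - t *\<^sub>R ?e) \<le> R" using R that by auto
      ultimately show ?thesis using that by (simp add: K'_def norm_axis_1)
    qed
    have KK0: "x \<in> K'" if "x \<in> K" for x using KK'[of x 0] that by simp
    have "bounded (F ` K')"
      using K' Fc by (intro compact_imp_bounded compact_continuous_image) (auto intro: continuous_on_subset)
    then obtain B where B: "\<And>x. x \<in> K' \<Longrightarrow> \<bar>F x\<bar> \<le> B" unfolding bounded_iff by auto
    have sh: "continuous_on UNIV (\<lambda>x. \<phi> (x - t *\<^sub>R ?e))" for t
      by (intro continuous_on_compose2[OF \<phi>c] continuous_intros) auto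
    have i1: "integrable lborel (\<lambda>x. F x * \<phi> (x - h n *\<^sub>R ?e))" for n
      by (rule integrable_compact_support[OF _ K']) (use K(3) KK' h[of n] in \<open>auto intro!: continuous_intros Fc sh intro: less_imp_le\<close>)
    have i2: "integrable lborel (\<lambda>x. F x * \<phi> x)"
      by (rule integrable_compact_support[OF _ K(1)]) (use K(3) in \<open>auto intro!: continuous_intros Fc \<phi>c\<close>)
    have i3: "integrable lborel (\<lambda>x. F (x + h n *\<^sub>R ?e) * \<phi> x)" for n
      by (rule integrable_compact_support[OF _ K(1)])
        (use K(3) in \<open>auto intro!: continuous_intros continuous_on_compose2[OF Fc] \<phi>c\<close>)
    \<comment> \<open>Summation by parts with step \<open>h n\<close>: translating along the axis
      turns the backward quotient of \<phi> into the forward quotient of \<open>F\<close>, with a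
      change of sign.\<close>
    have eq: "(LINT x|lborel. F x * ((\<phi> x - \<phi> (x - h n *\<^sub>R ?e)) / h n)) = - (LINT x|lborel. q n x * \<phi> x)" for n
    proof -
      have "(LINT x|lborel. F x * \<phi> (x - h n *\<^sub>R ?e)) = (LINT x|lborel. F (x + h n *\<^sub>R ?e) * \<phi> x)"
        using lborel_integral_translate[of "\<lambda>x. F x * \<phi> (x - h n *\<^sub>R ?e)" "h n *\<^sub>R ?e"] by simp
      moreover have "(LINT x|lborel. F x * ((\<phi> x - \<phi> (x - h n *\<^sub>R ?e)) / h n))
          = ((LINT x|lborel. F x * \<phi> x) - (LINT x|lborel. F x * \<phi> (x - h n *\<^sub>R ?e))) / h n"
        unfolding Bochner_Integration.integral_diff[OF i2 i1, symmetric]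
        by (subst Bochner_Integration.integral_divide_zero[symmetric])
          (simp add: right_diff_distrib diff_divide_distrib)
      moreover have "(LINT x|lborel. q n x * \<phi> x)
          = ((LINT x|lborel. F (x + h n *\<^sub>R ?e) * \<phi> x) - (LINT x|lborel. F x * \<phi> x)) / h n"
        unfolding Bochner_Integration.integral_diff[OF i3 i2, symmetric]
        by (subst Bochner_Integration.integral_divide_zero[symmetric])
          (simp add: q_def left_diff_distrib diff_divide_distrib)
      ultimately show ?thesis by (simp add: minus_divide_left)
    qed
    \<comment> \<open>\<open>B\<close> bounds \<open>F\<close> on \<open>K'\<close> and
      \<open>M\<close> bounds the quotients of \<phi>; outside \<open>K'\<close> both \<phi> and its
      translate vanish.\<close>
    have "(\<lambda>n. LINT x|lborel. F x * ((\<phi> x - \<phi> (x - h n *\<^sub>R ?e)) / h n)) \<longlonglongrightarrow> (LINT x|lborel. F x * partial j \<phi> x)"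
    proof (rule integral_dominated_convergence[where w="\<lambda>x. indicator K' x *\<^sub>R (B * M)"])
      show "integrable lborel (\<lambda>x. indicator K' x *\<^sub>R (B * M))"
        by (rule borel_integrable_compact[OF K']) simp
      show "AE x in lborel. (\<lambda>n. F x * ((\<phi> x - \<phi> (x - h n *\<^sub>R ?e)) / h n)) \<longlonglongrightarrow> F x * partial j \<phi> x"
        by (intro AE_I2 tendsto_mult tendsto_const filterlim_compose[OF \<phi>lim hat])
      fix n
      show "AE x in lborel. norm (F x * ((\<phi> x - \<phi> (x - h n *\<^sub>R ?e)) / h n)) \<le> indicator K' x *\<^sub>R (B * M)"
      proof (rule AE_I2)
        fix x
        show "norm (F x * ((\<phi> x - \<phi> (x - h n *\<^sub>R ?e)) / h n)) \<le> indicator K' x *\<^sub>R (B * M)"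
        proof (cases "x \<in> K'")
          case True
          have "\<bar>\<phi> x - \<phi> (x - h n *\<^sub>R ?e)\<bar> \<le> M * h n"
            using M(2)[of "x - h n *\<^sub>R ?e" "h n"] h(1)[of n] by simp
          then have "\<bar>(\<phi> x - \<phi> (x - h n *\<^sub>R ?e)) / h n\<bar> \<le> M"
            using h(1)[of n] by (simp add: pos_divide_le_eq)
          moreover have "0 \<le> B" using B[OF True] by linarith
          ultimately have "\<bar>F x\<bar> * \<bar>(\<phi> x - \<phi> (x - h n *\<^sub>R ?e)) / h n\<bar> \<le> B * M"
            using B[OF True] by (intro mult_mono) auto
          then show ?thesis using True by (simp add: abs_mult)
        next
          case False
          then have "x \<notin> K" "x - h n *\<^sub>R ?e \<notin> K" using KK0 KK' h[of n] by (auto intro: less_imp_le)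
          then show ?thesis using K(3) False by simp
        qed
      qed
    qed simp_all
    moreover have "(\<lambda>n. LINT x|lborel. q n x * \<phi> x) \<longlonglongrightarrow> (LINT x|lborel. g x * \<phi> x)"
    proof (rule integral_dominated_convergence[where w="\<lambda>x. L * \<bar>\<phi> x\<bar>"])
      show "integrable lborel (\<lambda>x. L * \<bar>\<phi> x\<bar>)"
        by (rule integrable_compact_support[OF _ K(1)]) (use K(3) in \<open>auto intro!: continuous_intros \<phi>c\<close>)
      show "AE x in lborel. (\<lambda>n. q n x * \<phi> x) \<longlonglongrightarrow> g x * \<phi> x"
        using AEg by eventually_elim (auto intro!: tendsto_intros)
      show "AE x in lborel. norm (q n x * \<phi> x) \<le> L * \<bar>\<phi> x\<bar>" for n
        by (intro AE_I2) (simp add: abs_mult mult_right_mono[OF qb])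
    qed simp_all
    ultimately have "(LINT x|lborel. F x * partial j \<phi> x) = - (LINT x|lborel. g x * \<phi> x)"
      unfolding eq by (rule LIMSEQ_unique[OF _ tendsto_minus])
    then show "(LINT x|lebesgue_on U. f x * partial j \<phi> x) = - (LINT x|lebesgue_on U. g x * \<phi> x)"
      using toR[of f F "partial j \<phi>"] toR[of g g \<phi>] K Ff by simp
  qed
  then show ?thesis using that gm AE_U by blast
qed

section \<open>Convergence in the Sobolev norm\<close>

lemma Lq_norm_tendsto_0:
  fixes h :: "nat \<Rightarrow> real^'m::finite \<Rightarrow> real"
  assumes U: "U \<in> lmeasurable" and q: "1 \<le> q"
    and meas[measurable]: "\<And>n. h n \<in> borel_measurable (lebesgue_on U)"
    and bound: "\<And>n. AE x in lebesgue_on U. \<bar>h n x\<bar> \<le> C"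
    and lim: "AE x in lebesgue_on U. (\<lambda>n. h n x) \<longlonglongrightarrow> 0"
  shows "(\<lambda>n. Lq_norm q U (h n)) \<longlonglongrightarrow> 0"
proof -
  interpret finite_measure "lebesgue_on U" using U by (rule finite_measure_lebesgue_on)
  define I where "I n = (\<integral>\<^sup>+x. ennreal (\<bar>h n x\<bar> powr q) \<partial>lebesgue_on U)" for n
  let ?w = "\<lambda>x. ennreal (\<bar>C\<bar> powr q)"
  have w: "(\<integral>\<^sup>+x. ?w x \<partial>lebesgue_on U) < \<infinity>"
    using emeasure_finite[of U] by (simp add: ennreal_mult_eq_top_iff less_top[symmetric])
  have le: "AE x in lebesgue_on U. ennreal (\<bar>h n x\<bar> powr q) \<le> ?w x" for n
    using bound[of n] by eventually_elim (use q in \<open>auto intro!: ennreal_leI powr_mono2\<close>)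
  have "I n \<le> (\<integral>\<^sup>+x. ?w x \<partial>lebesgue_on U)" for n
    unfolding I_def by (rule nn_integral_mono_AE[OF le])
  then have fin: "I n < \<infinity>" for n using w by (rule le_less_trans)
  have "(\<lambda>n. I n) \<longlonglongrightarrow> (\<integral>\<^sup>+x. 0 \<partial>lebesgue_on U)"
    unfolding I_def
  proof (rule nn_integral_dominated_convergence[OF _ _ _ _ w])
    show "AE x in lebesgue_on U. (\<lambda>n. ennreal (\<bar>h n x\<bar> powr q)) \<longlonglongrightarrow> 0"
      using lim
    proof eventually_elim
      fix x assume "(\<lambda>n. h n x) \<longlonglongrightarrow> 0"
      then have "(\<lambda>n. \<bar>h n x\<bar> powr q) \<longlonglongrightarrow> 0"
        using q by (intro tendsto_zero_powrI[of _ _ _ q]) (auto intro: tendsto_rabs_zero)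
      from tendsto_ennrealI[OF this] show "(\<lambda>n. ennreal (\<bar>h n x\<bar> powr q)) \<longlonglongrightarrow> 0"
        by simp
    qed
    show "AE x in lebesgue_on U. ennreal (\<bar>h n x\<bar> powr q) \<le> ?w x" for n by (rule le)
  qed auto
  then have "(\<lambda>n. enn2real (I n)) \<longlonglongrightarrow> 0"
    using tendsto_enn2real[of I 0 sequentially] by simp
  then have "(\<lambda>n. enn2real (I n) powr (1 / q)) \<longlonglongrightarrow> 0"
    using q by (intro tendsto_zero_powrI[of _ _ _ "1 / q"]) auto
  from tendsto_ennrealI[OF this] have "(\<lambda>n. ennreal (enn2real (I n) powr (1 / q))) \<longlonglongrightarrow> 0"
    by simp
  moreover have "Lq_norm q U (h n) = ennreal (enn2real (I n) powr (1 / q))" for n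
    using fin[of n] by (simp add: Lq_norm_def I_def Let_def)
  ultimately show ?thesis by simp
qed

text \<open>The Sobolev norm is an infimum over weak gradients, so exhibiting a single one bounds it
  from above. The Lipschitz constant shared by all \<open>f n\<close> dominates these gradients, and
  it is integrable because \<open>U\<close> is bounded.\<close>

lemma W1q_norm_tendsto_0:
  fixes f :: "nat \<Rightarrow> real^'m::finite \<Rightarrow> real"
  assumes U: "open U" "bounded U" and q: "1 \<le> q"
    and lip: "\<And>n. L-lipschitz_on U (f n)"
    and bound: "\<And>n x. x \<in> U \<Longrightarrow> \<bar>f n x\<bar> \<le> B n" and B: "B \<longlonglongrightarrow> 0"
    and lim: "\<And>j. AE x in lebesgue_on U. (\<lambda>n. partial j (f n) x) \<longlonglongrightarrow> 0"
  shows "(\<lambda>n. W1q_norm q U (f n)) \<longlonglongrightarrow> 0"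
proof -
  have Ul: "U \<in> lmeasurable" using U by (simp add: lmeasurable_open)
  define W where "W n j g \<longleftrightarrow> has_weak_partial U j (f n) g \<and> g \<in> borel_measurable borel \<and>
    (AE x in lebesgue_on U. partially_differentiable j (f n) x \<and> g x = partial j (f n) x \<and> \<bar>g x\<bar> \<le> L)"
    for n j g
  have ex: "\<exists>g. W n j g" for n j
  proof -
    obtain g where "has_weak_partial U j (f n) g" "g \<in> borel_measurable borel"
      "AE x in lebesgue_on U. partially_differentiable j (f n) x \<and> g x = partial j (f n) x \<and> \<bar>g x\<bar> \<le> L"
      by (rule lipschitz_weak_partial[OF U(1) lip])
    then show ?thesis unfolding W_def by blast
  qed
  define g where "g n j = (SOME g. W n j g)" for n j
  have W: "W n j (g n j)" for n j
    unfolding g_def by (rule someI_ex[OF ex])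
  have g: "has_weak_partial U j (f n) (g n j)" "g n j \<in> borel_measurable borel"
      "AE x in lebesgue_on U. partially_differentiable j (f n) x \<and> g n j x = partial j (f n) x \<and> \<bar>g n j x\<bar> \<le> L"
      for n j
    using W[of n j] unfolding W_def by blast+
  have "(\<lambda>n. Lq_norm q U (g n j)) \<longlonglongrightarrow> 0" for j
  proof (rule Lq_norm_tendsto_0[OF Ul q])
    show "g n j \<in> borel_measurable (lebesgue_on U)" for n
      by (intro measurable_restrict_space1 measurable_completion) (simp add: g(2))
    show "AE x in lebesgue_on U. \<bar>g n j x\<bar> \<le> L" for n
      using g(3)[of j n] by eventually_elim auto
    have "AE x in lebesgue_on U. \<forall>n. g n j x = partial j (f n) x"
      unfolding AE_all_countable
    proof
      show "AE x in lebesgue_on U. g n j x = partial j (f n) x" for n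
        using g(3)[of j n] by eventually_elim auto
    qed
    then show "AE x in lebesgue_on U. (\<lambda>n. g n j x) \<longlonglongrightarrow> 0"
      using lim[of j] by eventually_elim simp
  qed
  moreover obtain C where C: "\<And>n. norm (B n) \<le> C"
    using convergent_imp_Bseq[OF convergentI[OF B]] unfolding Bseq_def by blast
  have "(\<lambda>n. Lq_norm q U (f n)) \<longlonglongrightarrow> 0"
  proof (rule Lq_norm_tendsto_0[OF Ul q])
    show "f n \<in> borel_measurable (lebesgue_on U)" for n
      using U(1) by (simp add: continuous_imp_measurable_on_sets_lebesgue lipschitz_on_continuous_on[OF lip])
    show "AE x in lebesgue_on U. \<bar>f n x\<bar> \<le> C" for n
    proof (rule AE_I2)
      fix x assume "x \<in> space (lebesgue_on U)"
      then show "\<bar>f n x\<bar> \<le> C" using bound[of x n] C[of n] by simp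
    qed
    show "AE x in lebesgue_on U. (\<lambda>n. f n x) \<longlonglongrightarrow> 0"
    proof (rule AE_I2)
      fix x assume "x \<in> space (lebesgue_on U)"
      then have "x \<in> U" by simp
      then show "(\<lambda>n. f n x) \<longlonglongrightarrow> 0"
        using bound by (intro Lim_null_comparison[OF _ B] eventually_sequentiallyI[of 0]) simp
    qed
  qed
  ultimately have "(\<lambda>n. Lq_norm q U (f n) + (\<Sum>j\<in>UNIV. Lq_norm q U (g n j))) \<longlonglongrightarrow> 0 + (\<Sum>j\<in>(UNIV::'m set). 0)"
    by (intro tendsto_add tendsto_sum)
  then have lim0: "(\<lambda>n. Lq_norm q U (f n) + (\<Sum>j\<in>UNIV. Lq_norm q U (g n j))) \<longlonglongrightarrow> 0"
    by simp
  have "W1q_norm q U (f n) \<le> Lq_norm q U (f n) + (\<Sum>j\<in>UNIV. Lq_norm q U (g n j))" for n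
    unfolding W1q_norm_def using g(1) by (intro INF_lower) simp
  then show ?thesis
    by (intro tendsto_sandwich[OF _ _ tendsto_const lim0] eventually_sequentiallyI[of 0]) simp_all
qed

section \<open>Spectral theory of compact nonnegative operators\<close>

lemma to_complex_0 [simp]: "to_complex (0::'k::real_or_complex) = 0"
  using to_complex_add[of 0 "0::'k"] by simp

lemma to_complex_eq_0_iff [simp]: "to_complex a = 0 \<longleftrightarrow> a = (0::'k::real_or_complex)"
proof
  show "a = 0" if "to_complex a = 0"
  proof (rule ccontr)
    assume "a \<noteq> 0"
    then have "to_complex (a * inverse a) = 1" by (simp add: to_complex_one)
    then show False using that by (simp add: to_complex_mult)
  qed
qed simp

lemma to_complex_diff: "to_complex (a - b) = to_complex a - to_complex (b::'k::real_or_complex)"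
  using to_complex_add[of "a - b" b] by simp

lemma to_complex_eq_iff [simp]: "to_complex a = to_complex b \<longleftrightarrow> a = (b::'k::real_or_complex)"
  using to_complex_eq_0_iff[of "a - b"] by (simp add: to_complex_diff)

lemma to_complex_of_real_ex: "\<exists>a::'k::real_or_complex. to_complex a = of_real r"
proof -
  have "of_real r \<in> range (to_complex :: 'k \<Rightarrow> complex)"
    using range_to_complex[where 'a='k] by auto
  then show ?thesis by (metis imageE)
qed

context hilbert_space
begin

text \<open>Complex values treat both scalar fields at once and make conjugation and modulus
  available; \<open>ip\<close> is kept for coefficients passed to \<open>smul\<close>.\<close>

definition cip :: "'h \<Rightarrow> 'h \<Rightarrow> complex" where
  "cip v w = to_complex (ip v w)"

lemma cip_eq_0_iff: "cip v w = 0 \<longleftrightarrow> ip v w = 0"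
  by (simp add: cip_def)

lemma cip_commute: "cip w v = cnj (cip v w)"
  unfolding cip_def by (rule ip_commute)

lemma Re_cip: "Re (cip v w) = v \<bullet> w"
  by (simp add: cip_def Re_ip)

lemma cip_add_left: "cip (u + v) w = cip u w + cip v w"
  by (simp add: cip_def ip_add_left to_complex_add)

lemma cip_scale_left: "cip (smul a v) w = to_complex a * cip v w"
  by (simp add: cip_def ip_scale_left to_complex_mult)

lemma cip_0_left [simp]: "cip 0 w = 0"
  using cip_add_left[of 0 0 w] by simp

lemma cip_diff_left: "cip (u - v) w = cip u w - cip v w"
  using cip_add_left[of "u - v" v w] by simp

lemma cip_sum_left: "cip (\<Sum>i\<in>I. f i) w = (\<Sum>i\<in>I. cip (f i) w)"
  by (induction I rule: infinite_finite_induct) (simp_all add: cip_add_left)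

lemma cip_scaleR_left: "cip (r *\<^sub>R v) w = of_real r * cip v w"
proof -
  obtain a :: 'k where a: "to_complex a = of_real r" using to_complex_of_real_ex by blast
  show ?thesis using cip_scale_left[of a v w] scale_of_real[OF a, of v] a by simp
qed

lemma cip_add_right: "cip w (u + v) = cip w u + cip w v"
  by (metis cip_add_left cip_commute complex_cnj_add)

lemma cip_0_right [simp]: "cip w 0 = 0"
  by (metis cip_0_left cip_commute complex_cnj_zero)

lemma cip_scale_right: "cip w (smul a v) = cnj (to_complex a) * cip w v"
  by (metis cip_scale_left cip_commute complex_cnj_mult)

lemma cip_scaleR_right: "cip w (r *\<^sub>R v) = of_real r * cip w v"
  by (metis cip_scaleR_left cip_commute complex_cnj_mult complex_cnj_complex_of_real)

lemma cip_self: "cip v v = of_real ((norm v)\<^sup>2)"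
proof (rule complex_eqI)
  show "Re (cip v v) = Re (of_real ((norm v)\<^sup>2))"
    by (simp add: Re_cip power2_norm_eq_inner)
  have "Im (cip v v) = - Im (cip v v)" using arg_cong[OF cip_commute[of v v], of Im] by simp
  then show "Im (cip v v) = Im (of_real ((norm v)\<^sup>2))" by simp
qed

lemma norm_smul: "norm (smul a v) = cmod (to_complex a) * norm v"
proof -
  have "complex_of_real ((norm (smul a v))\<^sup>2) = to_complex a * (cnj (to_complex a) * of_real ((norm v)\<^sup>2))"
    by (simp only: cip_self[symmetric] cip_scale_left cip_scale_right mult.left_commute)
  also have "\<dots> = of_real ((cmod (to_complex a))\<^sup>2) * of_real ((norm v)\<^sup>2)"
    by (simp only: complex_norm_square mult.assoc)
  also have "\<dots> = of_real ((cmod (to_complex a) * norm v)\<^sup>2)"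
    by (simp add: power_mult_distrib)
  finally have "(norm (smul a v))\<^sup>2 = (cmod (to_complex a) * norm v)\<^sup>2"
    using of_real_eq_iff by blast
  then show ?thesis by (rule power2_eq_imp_eq) auto
qed

lemma orthogonal_span:
  assumes "\<And>w. w \<in> S \<Longrightarrow> ip v w = 0" "w \<in> span S"
  shows "ip v w = 0"
  using assms(2)
proof (induction rule: span_induct_alt)
  case base
  then show ?case using cip_eq_0_iff[of v 0] by simp
next
  case (step c x y)
  have "cip v (smul c x + y) = 0"
    using assms(1)[OF step(1)] step(2) by (simp add: cip_add_right cip_scale_right cip_eq_0_iff[THEN iffD2])
  then show ?case by (simp add: cip_eq_0_iff)
qed

section \<open>Orthonormal frames, projections and dimension counts\<close>

definition orthonormal :: "nat \<Rightarrow> (nat \<Rightarrow> 'h) \<Rightarrow> bool" where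
  "orthonormal n e \<longleftrightarrow> (\<forall>i<n. \<forall>j<n. cip (e i) (e j) = (if i = j then 1 else 0))"

lemma orthonormalD: "orthonormal n e \<Longrightarrow> i < n \<Longrightarrow> j < n \<Longrightarrow> cip (e i) (e j) = (if i = j then 1 else 0)"
  by (simp add: orthonormal_def)

lemma orthonormal_norm:
  assumes "orthonormal n e" "i < n"
  shows "norm (e i) = 1"
proof -
  have "complex_of_real ((norm (e i))\<^sup>2) = of_real 1"
    using orthonormalD[OF assms assms(2)] by (simp only: cip_self[symmetric] if_True of_real_1 simp_thms)
  then have "(norm (e i))\<^sup>2 = 1" using of_real_eq_iff by blast
  then show ?thesis using norm_ge_zero[of "e i"] by (auto simp: power2_eq_1_iff simp del: norm_ge_zero)
qed

lemma orthonormal_mono: "orthonormal n e \<Longrightarrow> m \<le> n \<Longrightarrow> orthonormal m e"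
  by (simp add: orthonormal_def)

definition proj :: "nat \<Rightarrow> (nat \<Rightarrow> 'h) \<Rightarrow> 'h \<Rightarrow> 'h" where
  "proj n e v = (\<Sum>i<n. smul (ip v (e i)) (e i))"

lemma cip_combination:
  assumes "orthonormal n e" "i < n"
  shows "cip (\<Sum>j<n. smul (a j) (e j)) (e i) = to_complex (a i)"
proof -
  have "cip (\<Sum>j<n. smul (a j) (e j)) (e i) = (\<Sum>j<n. to_complex (a j) * (if j = i then 1 else 0))"
    using assms by (simp add: cip_sum_left cip_scale_left orthonormalD)
  then show ?thesis using assms by (simp add: if_distrib[of "\<lambda>x. _ * x"] sum.delta cong: if_cong)
qed

lemma proj_combination:
  assumes "orthonormal n e"
  shows "proj n e (\<Sum>j<n. smul (a j) (e j)) = (\<Sum>j<n. smul (a j) (e j))"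
proof -
  have "ip (\<Sum>j<n. smul (a j) (e j)) (e i) = a i" if "i < n" for i
    using cip_combination[OF assms that, of a] by (simp add: cip_def)
  then show ?thesis by (simp add: proj_def)
qed

lemma cip_proj:
  assumes "orthonormal n e" "i < n"
  shows "cip (proj n e v) (e i) = cip v (e i)"
  unfolding proj_def cip_combination[OF assms] by (simp add: cip_def)

lemma cip_minus_proj:
  assumes "orthonormal n e" "i < n"
  shows "cip (v - proj n e v) (e i) = 0"
  using cip_proj[OF assms] by (simp add: cip_diff_left)

lemma inner_proj_left: "proj n e v \<bullet> w = (\<Sum>i<n. Re (cip v (e i) * cnj (cip w (e i))))"
  unfolding Re_cip[symmetric] proj_def
  by (simp add: cip_sum_left cip_scale_left cip_def[symmetric] cip_commute[symmetric])

lemma inner_proj_minus_proj: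
  assumes "orthonormal n e"
  shows "proj n e v \<bullet> (w - proj n e w) = 0"
  using cip_minus_proj[OF assms] by (simp add: inner_proj_left)

lemma norm_proj:
  assumes "orthonormal n e"
  shows "(norm (proj n e v))\<^sup>2 = (\<Sum>i<n. (cmod (cip v (e i)))\<^sup>2)"
proof -
  have "(norm (proj n e v))\<^sup>2 = proj n e v \<bullet> v"
    using inner_proj_minus_proj[OF assms, of v v] by (simp add: power2_norm_eq_inner inner_diff_right)
  also have "\<dots> = (\<Sum>i<n. (cmod (cip v (e i)))\<^sup>2)"
    by (simp add: inner_proj_left complex_norm_square[symmetric] del: of_real_power)
  finally show ?thesis .
qed

lemma pythagoras_proj:
  assumes "orthonormal n e"
  shows "(norm v)\<^sup>2 = (\<Sum>i<n. (cmod (cip v (e i)))\<^sup>2) + (norm (v - proj n e v))\<^sup>2"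
proof -
  have "(norm v)\<^sup>2 = (norm (proj n e v + (v - proj n e v)))\<^sup>2" by simp
  also have "\<dots> = (norm (proj n e v))\<^sup>2 + (norm (v - proj n e v))\<^sup>2"
    using inner_proj_minus_proj[OF assms, of v v]
    unfolding power2_norm_eq_inner inner_add_left inner_add_right by (simp add: inner_commute)
  finally show ?thesis by (simp add: norm_proj[OF assms])
qed

lemma orthonormal_independent:
  assumes "orthonormal n e"
  shows "inj_on e {..<n}" "independent (e ` {..<n})"
proof -
  show inj: "inj_on e {..<n}"
  proof (rule inj_onI, rule ccontr)
    fix i j assume "i \<in> {..<n}" "j \<in> {..<n}" "e i = e j" "i \<noteq> j"
    then show False using orthonormalD[OF assms, of i j] orthonormalD[OF assms, of i i] by simp
  qed
  show "independent (e ` {..<n})"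
    unfolding dependent_def
  proof safe
    fix i assume i: "i < n" "e i \<in> span (e ` {..<n} - {e i})"
    have "ip (e i) w = 0" if w: "w \<in> e ` {..<n} - {e i}" for w
    proof -
      obtain j where j: "j < n" "w = e j" "w \<noteq> e i" using w by blast
      then have "i \<noteq> j" by auto
      then show ?thesis using orthonormalD[OF assms i(1) j(1)] j(2) by (simp add: cip_eq_0_iff)
    qed
    then have "ip (e i) (e i) = 0" by (rule orthogonal_span[OF _ i(2)])
    then show False using orthonormalD[OF assms i(1) i(1)] by (simp add: cip_def)
  qed
qed

lemma span_orthonormal_dim:
  assumes "orthonormal n e"
  shows "dim (span (e ` {..<n})) = n"
  using orthonormal_independent[OF assms] by (simp add: dim_eq_card_independent card_image)

lemma span_orthonormal_in:
  assumes "orthonormal n e"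
  shows "span (e ` {..<n}) \<in> subspaces_of_dim smul n"
  unfolding subspaces_of_dim_def using span_orthonormal_dim[OF assms] by blast

lemma proj_in_span: "proj n e v \<in> span (e ` {..<n})"
  unfolding proj_def by (intro span_sum span_scale span_base) auto

text \<open>Either some vector differs from its projection, and the normalized difference serves, or
  the frame spans the space; the dimension is then \<open>n\<close>, which contradicts admissibility
  of \<open>Suc n\<close>.\<close>

lemma exists_unit_orthogonal:
  assumes e: "orthonormal n e" and ok: "index_ok smul (Suc n)"
  obtains v where "norm v = 1" "\<And>i. i < n \<Longrightarrow> cip v (e i) = 0"
proof (cases "\<exists>v. v - proj n e v \<noteq> 0")
  case True
  then obtain v where v: "v - proj n e v \<noteq> 0" by blast
  show ?thesis
    by (rule that[of "(1 / norm (v - proj n e v)) *\<^sub>R (v - proj n e v)"])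
      (use v cip_minus_proj[OF e] in \<open>auto simp: cip_scaleR_left\<close>)
next
  case False
  then have "v \<in> span (e ` {..<n})" for v
    using proj_in_span[of n e v] by (metis eq_iff_diff_eq_0)
  then have UN: "span (e ` {..<n}) = UNIV" by auto
  then have "Suc n \<le> dim (UNIV :: 'h set)"
    using ok unfolding index_ok_def by (meson finite_imageI finite_lessThan)
  then show ?thesis using span_orthonormal_dim[OF e] UN by simp
qed

text \<open>The dimension count behind the lower min-max bounds: \<open>n + 1\<close> independent
  directions cannot all be absorbed by the \<open>n\<close> linear conditions of orthogonality to
  \<open>M\<close>.\<close>

lemma exists_unit_in_span_orthogonal:
  assumes M: "M \<in> subspaces_of_dim smul n" and e: "orthonormal (Suc n) e"
  obtains v where "norm v = 1" "proj (Suc n) e v = v" "\<And>w. w \<in> M \<Longrightarrow> ip v w = 0"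
proof -
  obtain S where S: "finite S" "span S = M" and dimM: "dim M = n"
    using M unfolding subspaces_of_dim_def by blast
  obtain b where b: "b \<subseteq> M" "independent b" "M \<subseteq> span b" "card b = n"
    using basis_exists[of M] dimM by metis
  have finb: "finite b" using independent_span_bound[OF S(1) b(2)] b(1) S(2) by blast
  \<comment> \<open>\<open>b\<close> is not orthonormal, so \<open>T\<close> is no projection. It
    serves because \<langle>T v, v\<rangle> is the sum of the squared moduli of the products of
    \<open>v\<close> with the elements of \<open>b\<close>; thus \<open>T v = 0\<close> already
    forces orthogonality to \<open>M\<close>.\<close>
  define T where "T v = (\<Sum>u\<in>b. smul (ip v u) u)" for v
  have Tspan: "T v \<in> span b" for v unfolding T_def by (intro span_sum span_scale span_base)
  have ip_sum: "ip (\<Sum>i\<in>I. smul (a i) (x i)) u = (\<Sum>i\<in>I. a i * ip (x i) u)" for I :: "nat set" and a x u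
  proof (induction I rule: infinite_finite_induct)
    case (insert i I)
    then show ?case by (simp add: ip_add_left ip_scale_left)
  qed (use cip_eq_0_iff[of 0 u] in simp_all)
  have Tsum: "T (\<Sum>i\<in>I. smul (a i) (x i)) = (\<Sum>i\<in>I. smul (a i) (T (x i)))" for I :: "nat set" and a x
    unfolding T_def ip_sum scale_sum_left scale_sum_right scale_scale[symmetric]
    by (subst sum.swap) simp
  have "\<exists>a. (\<exists>i<Suc n. a i \<noteq> 0) \<and> T (\<Sum>i<Suc n. smul (a i) (e i)) = 0"
  proof (cases "inj_on (\<lambda>i. T (e i)) {..<Suc n}")
    case True
    let ?S = "(\<lambda>i. T (e i)) ` {..<Suc n}"
    have "card ?S = Suc n" using True by (simp add: card_image)
    then have "dependent ?S"
      using independent_span_bound[OF finb, of ?S] Tspan b(4) by (metis Suc_n_not_le_n image_subsetI)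
    then obtain u where u: "\<exists>v\<in>?S. u v \<noteq> 0" "(\<Sum>v\<in>?S. smul (u v) v) = 0"
      using dependent_finite[of ?S] by auto
    have "T (\<Sum>i<Suc n. smul (u (T (e i))) (e i)) = 0"
      unfolding Tsum using u(2) by (simp only: sum.reindex[OF True] o_def)
    then show ?thesis using u(1) by (intro exI[of _ "\<lambda>i. u (T (e i))"]) auto
  next
    case False
    then obtain i j where ij: "i < Suc n" "j < Suc n" "i \<noteq> j" "T (e i) = T (e j)"
      by (auto simp: inj_on_def)
    \<comment> \<open>Coinciding images are invisible to dependence of a set; the relation is then
      the difference of the two equal vectors.\<close>
    define a where "a k = (if k = i then 1 else if k = j then - 1 else 0 :: 'k)" for k
    have "(\<Sum>k<Suc n. smul (a k) (T (e k))) = (\<Sum>k\<in>{i, j}. smul (a k) (T (e k)))"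
      by (rule sum.mono_neutral_right) (use ij in \<open>auto simp: a_def\<close>)
    also have "\<dots> = 0" using ij by (simp add: a_def)
    finally have "T (\<Sum>k<Suc n. smul (a k) (e k)) = 0" unfolding Tsum .
    then show ?thesis using ij(1) by (intro exI[of _ a]) (auto simp: a_def)
  qed
  then obtain a i where i: "i < Suc n" "a i \<noteq> 0" and T0: "T (\<Sum>i<Suc n. smul (a i) (e i)) = 0"
    by blast
  define v where "v = (\<Sum>i<Suc n. smul (a i) (e i))"
  have "cip v (e i) = to_complex (a i)" unfolding v_def by (rule cip_combination[OF e i(1)])
  then have v0: "v \<noteq> 0" using i(2) by auto
  have "0 = Re (cip (T v) v)" using T0 by (simp add: v_def)
  also have "\<dots> = (\<Sum>u\<in>b. (cmod (cip v u))\<^sup>2)"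
  proof -
    have "cip (T v) v = (\<Sum>u\<in>b. cip v u * cnj (cip v u))"
      by (simp add: T_def cip_sum_left cip_scale_left cip_def[symmetric] cip_commute[symmetric])
    then show ?thesis by (simp add: complex_norm_square[symmetric] del: of_real_power)
  qed
  finally have "\<forall>u\<in>b. cip v u = 0"
    using sum_nonneg_eq_0_iff[OF finb, of "\<lambda>u. (cmod (cip v u))\<^sup>2"] by simp
  then have orth: "ip v w = 0" if "w \<in> M" for w
    using orthogonal_span[of b v w] b(3) that by (auto simp: cip_eq_0_iff)
  obtain c :: 'k where c: "to_complex c = of_real (1 / norm v)" using to_complex_of_real_ex by blast
  have sc: "(1 / norm v) *\<^sub>R v = (\<Sum>i<Suc n. smul (c * a i) (e i))"
    unfolding scale_of_real[OF c, symmetric] unfolding v_def scale_sum_right scale_scale ..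
  show ?thesis
  proof (rule that)
    show "norm ((1 / norm v) *\<^sub>R v) = 1" using v0 by simp
    show "proj (Suc n) e ((1 / norm v) *\<^sub>R v) = (1 / norm v) *\<^sub>R v"
      unfolding sc by (rule proj_combination[OF e])
    show "ip ((1 / norm v) *\<^sub>R v) w = 0" if "w \<in> M" for w
      using orth[OF that] unfolding cip_eq_0_iff[symmetric] by (simp add: cip_scaleR_left)
  qed
qed


section \<open>Eigenvectors of compact nonnegative operators and the min-max values\<close>

definition psd_compact :: "('h \<Rightarrow>\<^sub>L 'h) \<Rightarrow> bool" where
  "psd_compact B \<longleftrightarrow> compact_operator smul B \<and> selfadjoint_operator ip B \<and> nonneg_operator ip B"

lemma quad_form_eq: "quad_form ip B v = blinfun_apply B v \<bullet> v"
  by (simp add: quad_form_def Re_ip)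

lemma psd_compact_cip: "psd_compact B \<Longrightarrow> cip (blinfun_apply B v) w = cip v (blinfun_apply B w)"
  by (simp add: psd_compact_def selfadjoint_operator_def cip_def)

lemma psd_compact_inner: "psd_compact B \<Longrightarrow> blinfun_apply B v \<bullet> w = v \<bullet> blinfun_apply B w"
  using psd_compact_cip[of B v w] unfolding Re_cip[symmetric] by simp

lemma psd_compact_nonneg: "psd_compact B \<Longrightarrow> 0 \<le> blinfun_apply B v \<bullet> v"
  by (simp add: psd_compact_def nonneg_operator_def quad_form_eq)

lemma quad_le: "\<bar>blinfun_apply B v \<bullet> v\<bar> \<le> norm B * (norm v)\<^sup>2"
proof -
  have "\<bar>blinfun_apply B v \<bullet> v\<bar> \<le> norm (blinfun_apply B v) * norm v" by (rule Cauchy_Schwarz_ineq2)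
  also have "\<dots> \<le> (norm B * norm v) * norm v" by (intro mult_right_mono norm_blinfun) simp
  finally show ?thesis by (simp add: power2_eq_square mult.assoc)
qed

lemma psd_compact_subseq:
  assumes B: "psd_compact B" and v: "\<And>m. norm (v m) \<le> 1"
  obtains r y where "strict_mono (r :: nat \<Rightarrow> nat)" "(\<lambda>m. blinfun_apply B (v (r m))) \<longlonglongrightarrow> y"
proof -
  have comp: "compact (closure (blinfun_apply B ` cball 0 1))"
    using B by (simp add: psd_compact_def compact_operator_def)
  have "\<forall>m. blinfun_apply B (v m) \<in> closure (blinfun_apply B ` cball 0 1)"
    using v by (intro allI subsetD[OF closure_subset] imageI) simp
  then obtain y r where "strict_mono r" "((\<lambda>m. blinfun_apply B (v m)) \<circ> r) \<longlonglongrightarrow> y"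
    using comp[unfolded compact_def, THEN spec, of "\<lambda>m. blinfun_apply B (v m)"] by blast
  then show ?thesis by (intro that) (simp_all add: o_def)
qed

lemma cmod_cip_orthonormal_le:
  assumes "orthonormal n e" "i < n"
  shows "cmod (cip v (e i)) \<le> norm v"
proof (rule power2_le_imp_le)
  have "(cmod (cip v (e i)))\<^sup>2 \<le> (\<Sum>i<n. (cmod (cip v (e i)))\<^sup>2)"
    using assms(2) by (intro member_le_sum) auto
  also have "\<dots> \<le> (norm v)\<^sup>2" using pythagoras_proj[OF assms(1), of v] by simp
  finally show "(cmod (cip v (e i)))\<^sup>2 \<le> (norm v)\<^sup>2" .
qed simp

text \<open>The form is maximized over unit vectors of the complement \<open>S\<close> of the known
  eigenvectors, which \<open>B\<close> leaves invariant. Nonnegativity makes nearly maximal vectors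
  nearly eigenvectors, and compactness then yields a limit when the supremum \<open>m\<close> is
  positive.\<close>

lemma exists_top_eigenvector:
  assumes B: "psd_compact B" and e: "orthonormal n e"
    and eig: "\<And>i. i < n \<Longrightarrow> blinfun_apply B (e i) = \<mu> i *\<^sub>R e i"
    and ok: "index_ok smul (Suc n)"
  obtains u m where "norm u = 1" "\<And>i. i < n \<Longrightarrow> cip u (e i) = 0" "blinfun_apply B u = m *\<^sub>R u"
    "\<And>v. (\<And>i. i < n \<Longrightarrow> cip v (e i) = 0) \<Longrightarrow> blinfun_apply B v \<bullet> v \<le> m * (norm v)\<^sup>2"
proof -
  define S where "S = {v. \<forall>i<n. cip v (e i) = 0}"
  have S_diff: "v - t *\<^sub>R w \<in> S" if "v \<in> S" "w \<in> S" for v w t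
    using that by (simp add: S_def cip_diff_left cip_scaleR_left)
  have S_scale: "t *\<^sub>R v \<in> S" if "v \<in> S" for v t
    using that by (simp add: S_def cip_scaleR_left)
  have BS: "blinfun_apply B v \<in> S" if "v \<in> S" for v
    using that by (simp add: S_def psd_compact_cip[OF B] eig cip_scaleR_right)
  define Q where "Q = (\<lambda>v. blinfun_apply B v \<bullet> v) ` {v \<in> S. norm v = 1}"
  obtain u0 where "norm u0 = 1" "u0 \<in> S"
    by (rule exists_unit_orthogonal[OF e ok]) (auto simp: S_def)
  then have Qne: "Q \<noteq> {}" unfolding Q_def by blast
  have Qbdd: "bdd_above Q"
  proof (rule bdd_aboveI)
    fix x assume "x \<in> Q"
    then obtain v where "norm v = 1" "x = blinfun_apply B v \<bullet> v" unfolding Q_def by blast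
    then show "x \<le> norm B" using quad_le[of B v] by simp
  qed
  define m where "m = Sup Q"
  have le: "blinfun_apply B v \<bullet> v \<le> m * (norm v)\<^sup>2" if v: "v \<in> S" for v
  proof (cases "v = 0")
    case False
    have "blinfun_apply B ((1 / norm v) *\<^sub>R v) \<bullet> ((1 / norm v) *\<^sub>R v) \<in> Q"
      unfolding Q_def using S_scale[OF v] False by (intro imageI) simp
    then have "blinfun_apply B ((1 / norm v) *\<^sub>R v) \<bullet> ((1 / norm v) *\<^sub>R v) \<le> m"
      unfolding m_def by (rule cSup_upper[OF _ Qbdd])
    then show ?thesis
      using False by (simp add: blinfun.scaleR_right power2_eq_square field_simps)
  qed simp
  have "0 \<le> m"
  proof -
    obtain x where "x \<in> Q" using Qne by blast
    then have "0 \<le> x" "x \<le> m"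
      using psd_compact_nonneg[OF B] cSup_upper[OF _ Qbdd] by (auto simp: Q_def m_def)
    then show ?thesis by simp
  qed
  \<comment> \<open>Evaluating the form at \<open>v - t B v\<close> replaces the Cauchy-Schwarz
    inequality for the form of \<open>B\<close>: \<open>t = 1 / m\<close> gives |B v|^2 \<le> m
    \<langle>B v, v\<rangle>, and \<open>t = 1\<close> settles the case
    \<open>m = 0\<close>.\<close>
  have expand: "0 \<le> blinfun_apply B v \<bullet> v - 2 * t * (norm (blinfun_apply B v))\<^sup>2
      + t\<^sup>2 * (m * (norm (blinfun_apply B v))\<^sup>2)" if v: "v \<in> S" for v t
  proof -
    let ?w = "blinfun_apply B v"
    have "0 \<le> blinfun_apply B (v - t *\<^sub>R ?w) \<bullet> (v - t *\<^sub>R ?w)" by (rule psd_compact_nonneg[OF B])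
    also have "\<dots> = ?w \<bullet> v - t * (blinfun_apply B ?w \<bullet> v) - t * (?w \<bullet> ?w) + t\<^sup>2 * (blinfun_apply B ?w \<bullet> ?w)"
      by (simp add: blinfun.diff_right blinfun.scaleR_right inner_diff_left inner_diff_right
          power2_eq_square algebra_simps)
    also have "blinfun_apply B ?w \<bullet> v = ?w \<bullet> ?w" by (rule psd_compact_inner[OF B])
    also have "t\<^sup>2 * (blinfun_apply B ?w \<bullet> ?w) \<le> t\<^sup>2 * (m * (norm ?w)\<^sup>2)"
      by (intro mult_left_mono le BS v) simp
    finally show ?thesis by (simp add: power2_norm_eq_inner)
  qed
  show ?thesis
  proof (cases "m = 0")
    case True
    have "2 * (norm (blinfun_apply B u0))\<^sup>2 \<le> blinfun_apply B u0 \<bullet> u0"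
      using expand[OF \<open>u0 \<in> S\<close>, of 1] True by simp
    moreover have "blinfun_apply B u0 \<bullet> u0 \<le> 0" using le[OF \<open>u0 \<in> S\<close>] True by simp
    ultimately have "(norm (blinfun_apply B u0))\<^sup>2 \<le> 0" by linarith
    then have "blinfun_apply B u0 = 0 *\<^sub>R u0" by simp
    then show ?thesis
      using that[of u0 0] \<open>norm u0 = 1\<close> \<open>u0 \<in> S\<close> le True by (simp add: S_def)
  next
    case False
    then have m: "0 < m" using \<open>0 \<le> m\<close> by simp
    have close: "(norm (blinfun_apply B v - m *\<^sub>R v))\<^sup>2 \<le> m * (m - blinfun_apply B v \<bullet> v)"
      if v: "v \<in> S" "norm v = 1" for v
    proof -
      have "(norm (blinfun_apply B v))\<^sup>2 \<le> m * (blinfun_apply B v \<bullet> v)"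
        using expand[OF v(1), of "1 / m"] m by (simp add: field_simps power2_eq_square)
      moreover have "(norm (blinfun_apply B v - m *\<^sub>R v))\<^sup>2
          = (norm (blinfun_apply B v))\<^sup>2 - 2 * m * (blinfun_apply B v \<bullet> v) + m\<^sup>2 * (norm v)\<^sup>2"
        unfolding power2_norm_eq_inner
        by (simp add: inner_diff_left inner_diff_right inner_commute power2_eq_square algebra_simps)
      ultimately show ?thesis using v by (simp add: algebra_simps power2_eq_square)
    qed
    have "\<exists>v. v \<in> S \<and> norm v = 1 \<and> m - inverse (real (Suc k)) < blinfun_apply B v \<bullet> v" for k
    proof -
      have "m - inverse (real (Suc k)) < Sup Q" unfolding m_def by simp
      then obtain x where "x \<in> Q" "m - inverse (real (Suc k)) < x"
        using less_cSup_iff[OF Qne Qbdd] by blast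
      then show ?thesis unfolding Q_def by blast
    qed
    then obtain v where v: "\<And>k. v k \<in> S" "\<And>k. norm (v k) = 1"
      "\<And>k. m - inverse (real (Suc k)) < blinfun_apply B (v k) \<bullet> v k" by metis
    obtain r y where r: "strict_mono r" and y: "(\<lambda>k. blinfun_apply B (v (r k))) \<longlonglongrightarrow> y"
      using psd_compact_subseq[OF B, of v] v(2) by auto
    have inv0: "(\<lambda>k. inverse (real (Suc (r k)))) \<longlonglongrightarrow> 0"
      using LIMSEQ_subseq_LIMSEQ[OF LIMSEQ_inverse_real_of_nat r] by (simp add: o_def)
    have "(\<lambda>k. (norm (blinfun_apply B (v (r k)) - m *\<^sub>R v (r k)))\<^sup>2) \<longlonglongrightarrow> 0"
    proof (rule Lim_null_comparison[OF eventually_sequentiallyI[of 0]])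
      show "(\<lambda>k. m * inverse (real (Suc (r k)))) \<longlonglongrightarrow> 0"
        using tendsto_mult_left[OF inv0, of m] by simp
      fix k
      have "m * (m - blinfun_apply B (v (r k)) \<bullet> v (r k)) \<le> m * inverse (real (Suc (r k)))"
        using v(3)[of "r k"] m by (intro mult_left_mono) auto
      then show "norm ((norm (blinfun_apply B (v (r k)) - m *\<^sub>R v (r k)))\<^sup>2) \<le> m * inverse (real (Suc (r k)))"
        using close[OF v(1,2), of "r k"] by simp
    qed
    then have "(\<lambda>k. sqrt ((norm (blinfun_apply B (v (r k)) - m *\<^sub>R v (r k)))\<^sup>2)) \<longlonglongrightarrow> sqrt 0"
      by (rule tendsto_real_sqrt)
    then have "(\<lambda>k. blinfun_apply B (v (r k)) - m *\<^sub>R v (r k)) \<longlonglongrightarrow> 0"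
      by (simp add: tendsto_norm_zero_iff)
    \<comment> \<open>Convergence of the images carries over to \<open>m\<close> times the vectors;
      dividing by \<open>m\<close> is what requires the separate treatment of
      \<open>m = 0\<close>.\<close>
    from tendsto_diff[OF y this] have "(\<lambda>k. m *\<^sub>R v (r k)) \<longlonglongrightarrow> y" by simp
    from tendsto_scaleR[OF tendsto_const this, of "1 / m"]
    have u: "(\<lambda>k. v (r k)) \<longlonglongrightarrow> (1 / m) *\<^sub>R y" using m by simp
    define u where "u = (1 / m) *\<^sub>R y"
    have vu: "(\<lambda>k. v (r k)) \<longlonglongrightarrow> u" using u by (simp add: u_def)
    have "(\<lambda>k. blinfun_apply B (v (r k))) \<longlonglongrightarrow> blinfun_apply B u"
      by (intro blinfun.tendsto tendsto_const vu)
    then have "blinfun_apply B u = y" using y LIMSEQ_unique by blast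
    then have Bu: "blinfun_apply B u = m *\<^sub>R u" using m by (simp add: u_def)
    have nu: "norm u = 1"
      using LIMSEQ_unique[OF tendsto_norm[OF vu]] v(2) by simp
    have uS: "cip u (e i) = 0" if i: "i < n" for i
    proof -
      have "(\<lambda>k. norm (u - v (r k))) \<longlonglongrightarrow> norm (u - u)"
        by (intro tendsto_norm tendsto_diff tendsto_const vu)
      moreover have "cmod (cip u (e i)) \<le> norm (u - v (r k))" for k
        using cmod_cip_orthonormal_le[OF e i, of "u - v (r k)"] v(1)[of "r k"] i
        by (simp add: cip_diff_left S_def)
      ultimately have "cmod (cip u (e i)) \<le> norm (u - u)"
        by (intro LIMSEQ_le_const) auto
      then show ?thesis by simp
    qed
    have "blinfun_apply B v \<bullet> v \<le> m * (norm v)\<^sup>2" if "\<And>i. i < n \<Longrightarrow> cip v (e i) = 0" for v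
      by (rule le) (simp add: S_def that)
    with nu uS Bu show ?thesis by (rule that)
  qed
qed

text \<open>The last clause records that each vector was chosen as a maximizer on the complement of
  its predecessors; the decreasing order and the agreement with the min-max values follow from it.
  Indices start at 0, so \<open>\<mu> i\<close> is the eigenvalue number
  \<open>Suc i\<close>.\<close>

definition eigensystem :: "nat \<Rightarrow> ('h \<Rightarrow>\<^sub>L 'h) \<Rightarrow> (nat \<Rightarrow> 'h) \<Rightarrow> (nat \<Rightarrow> real) \<Rightarrow> bool" where
  "eigensystem n B e \<mu> \<longleftrightarrow> orthonormal n e \<and> (\<forall>i<n. blinfun_apply B (e i) = \<mu> i *\<^sub>R e i) \<and>
     (\<forall>i<n. \<forall>v. (\<forall>j<i. cip v (e j) = 0) \<longrightarrow> blinfun_apply B v \<bullet> v \<le> \<mu> i * (norm v)\<^sup>2)"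

lemma eigensystemD:
  assumes "eigensystem n B e \<mu>"
  shows "orthonormal n e" "i < n \<Longrightarrow> blinfun_apply B (e i) = \<mu> i *\<^sub>R e i"
    "i < n \<Longrightarrow> (\<And>j. j < i \<Longrightarrow> cip v (e j) = 0) \<Longrightarrow> blinfun_apply B v \<bullet> v \<le> \<mu> i * (norm v)\<^sup>2"
  using assms by (auto simp: eigensystem_def)

lemma eigensystem_extend:
  assumes B: "psd_compact B" and es: "eigensystem n B e \<mu>" and ok: "index_ok smul (Suc n)"
  obtains u m where "eigensystem (Suc n) B (e(n := u)) (\<mu>(n := m))"
proof -
  obtain u m where u: "norm u = 1" "\<And>i. i < n \<Longrightarrow> cip u (e i) = 0" "blinfun_apply B u = m *\<^sub>R u"
    "\<And>v. (\<And>i. i < n \<Longrightarrow> cip v (e i) = 0) \<Longrightarrow> blinfun_apply B v \<bullet> v \<le> m * (norm v)\<^sup>2"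
    using exists_top_eigenvector[OF B eigensystemD(1,2)[OF es] ok] by metis
  have "cip (e i) u = 0" if "i < n" for i
    using u(2)[OF that] cip_commute[of "e i" u] by simp
  then have "orthonormal (Suc n) (e(n := u))"
    using eigensystemD(1)[OF es] u(1,2) by (auto simp: orthonormal_def less_Suc_eq cip_self)
  then have "eigensystem (Suc n) B (e(n := u)) (\<mu>(n := m))"
    using eigensystemD(2,3)[OF es] u(3,4) by (auto simp: eigensystem_def less_Suc_eq)
  then show ?thesis by (rule that)
qed

lemma index_ok_Suc: "index_ok smul (Suc n) \<Longrightarrow> n \<noteq> 0 \<Longrightarrow> index_ok smul n"
  by (auto simp: index_ok_def)

lemma eigensystem_exists:
  assumes B: "psd_compact B" and ok: "index_ok smul n \<or> n = 0"
  obtains e \<mu> where "eigensystem n B e \<mu>"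
proof -
  have "\<exists>e \<mu>. eigensystem n B e \<mu>"
    using ok
  proof (induction n)
    case 0
    then show ?case by (auto simp: eigensystem_def orthonormal_def)
  next
    case (Suc n)
    then have ok: "index_ok smul (Suc n)" by simp
    then obtain e \<mu> where "eigensystem n B e \<mu>" using Suc.IH index_ok_Suc by blast
    then show ?case using eigensystem_extend[OF B _ ok] by metis
  qed
  then show ?thesis using that by blast
qed

lemma eigensystem_antimono:
  assumes es: "eigensystem n B e \<mu>" and ij: "i \<le> j" "j < n"
  shows "\<mu> j \<le> \<mu> i"
proof -
  have "cip (e j) (e k) = 0" if "k < i" for k
    using orthonormalD[OF eigensystemD(1)[OF es], of j k] that ij by simp
  then have "blinfun_apply B (e j) \<bullet> e j \<le> \<mu> i * (norm (e j))\<^sup>2"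
    using eigensystemD(3)[OF es, of i] ij by simp
  then show ?thesis
    using orthonormal_norm[OF eigensystemD(1)[OF es] ij(2)] eigensystemD(2)[OF es ij(2)]
    by (simp add: power2_norm_eq_inner[symmetric])
qed

text \<open>The span of the eigenvectors is invariant and \<open>B\<close> is symmetric, so the
  cross terms between the span and its complement vanish.\<close>

lemma quad_split:
  assumes B: "psd_compact B" and e: "orthonormal n e"
    and eig: "\<And>i. i < n \<Longrightarrow> blinfun_apply B (e i) = \<mu> i *\<^sub>R e i"
  shows "blinfun_apply B v \<bullet> v = (\<Sum>i<n. \<mu> i * (cmod (cip v (e i)))\<^sup>2)
    + blinfun_apply B (v - proj n e v) \<bullet> (v - proj n e v)"
proof -
  let ?P = "proj n e v" and ?Q = "v - proj n e v"
  have "cip (blinfun_apply B w) (e i) = of_real (\<mu> i) * cip w (e i)" if "i < n" for w i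
    using that by (simp add: psd_compact_cip[OF B] eig cip_scaleR_right)
  then have PB: "?P \<bullet> blinfun_apply B w = (\<Sum>i<n. \<mu> i * Re (cip v (e i) * cnj (cip w (e i))))" for w
    unfolding inner_proj_left by (intro sum.cong) (auto simp: algebra_simps)
  have "blinfun_apply B v \<bullet> v = ?P \<bullet> blinfun_apply B v + ?Q \<bullet> blinfun_apply B ?P + ?Q \<bullet> blinfun_apply B ?Q"
    by (simp add: inner_commute inner_diff_left inner_diff_right blinfun.diff_right)
  also have "?Q \<bullet> blinfun_apply B ?P = ?P \<bullet> blinfun_apply B ?Q"
    using psd_compact_inner[OF B, of ?Q ?P] by (simp add: inner_commute)
  also have "\<dots> = 0"
    unfolding PB by (intro sum.neutral) (simp add: cip_minus_proj[OF e])
  also have "?P \<bullet> blinfun_apply B v = (\<Sum>i<n. \<mu> i * (cmod (cip v (e i)))\<^sup>2)"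
    unfolding PB by (simp add: complex_norm_square[symmetric] del: of_real_power)
  finally show ?thesis by (simp add: inner_commute)
qed

text \<open>Each competing subspace of dimension \<open>i\<close> is orthogonal to a unit vector in
  the span of the first \<open>i + 1\<close> eigenvectors, where the form is at least
  \<open>\<mu> i\<close>; the span of the first \<open>i\<close> eigenvectors attains this value by
  the greedy choice.\<close>

lemma eigval_eq:
  assumes B: "psd_compact B" and es: "eigensystem n B e \<mu>" and i: "i < n"
  shows "eigval smul ip (Suc i) B = \<mu> i"
proof -
  note e = eigensystemD(1)[OF es]
  have ei: "orthonormal i e" "orthonormal (Suc i) e" using e i by (auto intro: orthonormal_mono)
  define X where "X M = {v. norm v = 1 \<and> (\<forall>w\<in>M. ip v w = 0)}" for M
  define F where "F M = (SUP v \<in> X M. quad_form ip B v)" for M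
  \<comment> \<open>A real supremum or infimum is meaningful only for nonempty bounded sets, hence
    these checks.\<close>
  have bdd: "bdd_above (quad_form ip B ` X M)" for M
  proof (rule bdd_aboveI2)
    fix v assume "v \<in> X M"
    then show "quad_form ip B v \<le> norm B" using quad_le[of B v] by (simp add: X_def quad_form_eq)
  qed
  have low: "\<mu> i \<le> F M" if M: "M \<in> subspaces_of_dim smul i" for M
  proof -
    obtain v where v: "norm v = 1" "proj (Suc i) e v = v" "\<And>w. w \<in> M \<Longrightarrow> ip v w = 0"
      using exists_unit_in_span_orthogonal[OF M ei(2)] by blast
    \<comment> \<open>The squared coefficients are weights of total 1, so the form at
      \<open>v\<close> is an average of eigenvalues none of which is below
      \<open>\<mu> i\<close>.\<close>
    have one: "(\<Sum>k<Suc i. (cmod (cip v (e k)))\<^sup>2) = 1"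
      using pythagoras_proj[OF ei(2), of v] v(1,2) by simp
    have "\<mu> i = (\<Sum>k<Suc i. \<mu> i * (cmod (cip v (e k)))\<^sup>2)"
      unfolding sum_distrib_left[symmetric] one by simp
    also have "\<dots> \<le> (\<Sum>k<Suc i. \<mu> k * (cmod (cip v (e k)))\<^sup>2)"
      by (intro sum_mono mult_right_mono eigensystem_antimono[OF es]) (use i in auto)
    also have "\<dots> = blinfun_apply B v \<bullet> v"
      using quad_split[OF B ei(2), of \<mu> v] eigensystemD(2)[OF es] i v(2) by simp
    also have "\<dots> \<le> F M"
      unfolding F_def quad_form_eq[symmetric]
      by (rule cSUP_upper[OF _ bdd]) (use v in \<open>simp add: X_def\<close>)
    finally show ?thesis .
  qed
  let ?M = "span (e ` {..<i})"
  have Mi: "?M \<in> subspaces_of_dim smul i" by (rule span_orthonormal_in[OF ei(1)])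
  have "F ?M \<le> \<mu> i"
    unfolding F_def
  proof (rule cSUP_least)
    have "ip (e i) w = 0" if "w \<in> ?M" for w
    proof (rule orthogonal_span[OF _ that])
      fix u assume "u \<in> e ` {..<i}"
      then obtain j where j: "j < i" "u = e j" by blast
      then show "ip (e i) u = 0"
        using orthonormalD[OF ei(2), of i j] by (simp add: cip_eq_0_iff)
    qed
    then show "X ?M \<noteq> {}" using orthonormal_norm[OF e i] unfolding X_def by blast
  next
    fix v assume v: "v \<in> X ?M"
    then have "cip v (e j) = 0" if "j < i" for j
      using that span_base[of "e j" "e ` {..<i}"] by (simp add: X_def cip_eq_0_iff)
    then show "quad_form ip B v \<le> \<mu> i"
      using eigensystemD(3)[OF es i, of v] v by (simp add: X_def quad_form_eq)
  qed
  moreover have "(INF M\<in>subspaces_of_dim smul i. F M) \<le> F ?M"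
    by (rule cINF_lower[OF bdd_belowI2[of _ "\<mu> i"] Mi]) (rule low)
  moreover have "\<mu> i \<le> (INF M\<in>subspaces_of_dim smul i. F M)"
    by (rule cINF_greatest) (use Mi low in auto)
  ultimately show ?thesis
    by (simp add: eigval_def F_def X_def)
qed

text \<open>Weyl's perturbation bound. One unit vector tests both operators: it lies in the span of
  the first \<open>i\<close> eigenvectors of \<open>B\<close> and is orthogonal to the first
  \<open>i - 1\<close> eigenvectors of \<open>C\<close>.\<close>

lemma eigval_le:
  assumes B: "psd_compact B" and C: "psd_compact C" and ok: "index_ok smul i"
  shows "eigval smul ip i B \<le> eigval smul ip i C + norm (B - C)"
proof -
  obtain k where k: "i = Suc k" using ok by (cases i) (auto simp: index_ok_def)
  obtain e \<mu> where es: "eigensystem i B e \<mu>" using eigensystem_exists[OF B] ok by blast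
  obtain f \<nu> where fs: "eigensystem i C f \<nu>" using eigensystem_exists[OF C] ok by blast
  have e: "orthonormal (Suc k) e" using eigensystemD(1)[OF es] k by simp
  have f: "orthonormal k f" using eigensystemD(1)[OF fs] k by (auto intro: orthonormal_mono)
  obtain v where v: "norm v = 1" "proj (Suc k) e v = v" "\<And>w. w \<in> span (f ` {..<k}) \<Longrightarrow> ip v w = 0"
    using exists_unit_in_span_orthogonal[OF span_orthonormal_in[OF f] e] by blast
  have one: "(\<Sum>j<Suc k. (cmod (cip v (e j)))\<^sup>2) = 1"
    using pythagoras_proj[OF e, of v] v(1,2) by simp
  have "\<mu> k = (\<Sum>j<Suc k. \<mu> k * (cmod (cip v (e j)))\<^sup>2)"
    unfolding sum_distrib_left[symmetric] one by simp
  also have "\<dots> \<le> (\<Sum>j<Suc k. \<mu> j * (cmod (cip v (e j)))\<^sup>2)"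
    by (intro sum_mono mult_right_mono eigensystem_antimono[OF es]) (use k in auto)
  also have "\<dots> = blinfun_apply B v \<bullet> v"
    using quad_split[OF B e, of \<mu> v] eigensystemD(2)[OF es] k v(2) by simp
  also have "\<dots> = blinfun_apply C v \<bullet> v + blinfun_apply (B - C) v \<bullet> v"
    by (simp add: blinfun.diff_left inner_diff_left)
  also have "blinfun_apply (B - C) v \<bullet> v \<le> norm (B - C)"
    using quad_le[of "B - C" v] v(1) by simp
  also have "blinfun_apply C v \<bullet> v \<le> \<nu> k * (norm v)\<^sup>2"
  proof (rule eigensystemD(3)[OF fs])
    show "cip v (f j) = 0" if "j < k" for j
      using v(3)[of "f j"] that by (simp add: cip_eq_0_iff span_base)
  qed (simp add: k)
  finally show ?thesis
    using eigval_eq[OF B es, of k] eigval_eq[OF C fs, of k] k v(1) by simp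
qed

lemma eigval_lipschitz:
  assumes "psd_compact B" "psd_compact C" "index_ok smul i"
  shows "\<bar>eigval smul ip i B - eigval smul ip i C\<bar> \<le> norm (B - C)"
  using eigval_le[OF assms] eigval_le[OF assms(2,1,3)] by (simp add: norm_minus_commute abs_le_iff)

lemma eigval_bounds:
  assumes B: "psd_compact B" and ok: "index_ok smul i"
  shows "0 \<le> eigval smul ip i B" "eigval smul ip i B \<le> norm B"
proof -
  obtain k where k: "i = Suc k" using ok by (cases i) (auto simp: index_ok_def)
  obtain e \<mu> where es: "eigensystem i B e \<mu>" using eigensystem_exists[OF B] ok by blast
  have "eigval smul ip i B = \<mu> k" using eigval_eq[OF B es, of k] k by simp
  also have "\<mu> k = blinfun_apply B (e k) \<bullet> e k"
    using eigensystemD(2)[OF es, of k] orthonormal_norm[OF eigensystemD(1)[OF es], of k] k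
    by (simp add: power2_norm_eq_inner[symmetric])
  finally have eq: "eigval smul ip i B = blinfun_apply B (e k) \<bullet> e k" .
  show "0 \<le> eigval smul ip i B" unfolding eq by (rule psd_compact_nonneg[OF B])
  show "eigval smul ip i B \<le> norm B"
    using quad_le[of B "e k"] orthonormal_norm[OF eigensystemD(1)[OF es], of k] k unfolding eq by simp
qed


lemma cmod_cip_le: "cmod (cip v w) \<le> norm v * norm w"
proof (cases "w = 0")
  case False
  define u where "u = (1 / norm w) *\<^sub>R w"
  have "cip u u = 1" using False by (simp add: cip_self u_def)
  then have "orthonormal 1 (\<lambda>_. u)" by (simp add: orthonormal_def)
  then have "cmod (cip v u) \<le> norm v" by (rule cmod_cip_orthonormal_le) simp
  then show ?thesis using False by (simp add: u_def cip_scaleR_right norm_mult norm_divide field_simps)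
qed simp

lemma bounded_bilinear_cip: "bounded_bilinear cip"
  by unfold_locales
    (auto simp: cip_add_left cip_add_right cip_scaleR_left cip_scaleR_right scaleR_conv_of_real
      intro!: exI[of _ 1] cmod_cip_le)

lemma tendsto_smul_ip:
  assumes "(\<lambda>m. y m) \<longlonglongrightarrow> y0" "norm e = 1"
  shows "(\<lambda>m. smul (ip (y m) e) e) \<longlonglongrightarrow> smul (ip y0 e) e"
proof (rule LIM_zero_cancel, rule Lim_null_comparison[OF eventually_sequentiallyI[of 0]])
  show "(\<lambda>m. norm (y m - y0)) \<longlonglongrightarrow> 0" using assms(1) by (simp add: LIM_zero_iff tendsto_norm_zero)
  fix m
  have "smul (ip (y m) e) e - smul (ip y0 e) e = smul (ip (y m) e - ip y0 e) e"
    by (simp add: scale_left_diff_distrib)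
  moreover have "to_complex (ip (y m) e - ip y0 e) = cip (y m - y0) e"
    by (simp add: cip_def[symmetric] cip_diff_left to_complex_diff)
  ultimately show "norm (smul (ip (y m) e) e - smul (ip y0 e) e) \<le> norm (y m - y0)"
    using cmod_cip_le[of "y m - y0" e] assms(2) by (simp add: norm_smul)
qed

lemma index_ok_le: "index_ok smul n \<Longrightarrow> 1 \<le> m \<Longrightarrow> m \<le> n \<Longrightarrow> index_ok smul m"
  by (auto simp: index_ok_def)

lemma orthonormal_le_dim:
  assumes e: "orthonormal n e" and S: "finite S" "span S = UNIV"
  shows "n \<le> dim (UNIV :: 'h set)"
proof -
  obtain b :: "'h set" where b: "independent b" "UNIV \<subseteq> span b" "card b = dim (UNIV :: 'h set)"
    using basis_exists[of UNIV] by metis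
  have "finite b" using independent_span_bound[OF S(1) b(1)] S(2) by simp
  then have "card (e ` {..<n}) \<le> card b"
    using independent_span_bound[of b "e ` {..<n}"] orthonormal_independent[OF e] b(2) by blast
  then show ?thesis using orthonormal_independent(1)[OF e] b(3) by (simp add: card_image)
qed

section \<open>Decay of the eigenvalues and the spectral gap\<close>

lemma eigval_antimono:
  assumes B: "psd_compact B" and ok: "index_ok smul n" and ij: "i \<le> j" "j < n"
  shows "eigval smul ip (Suc j) B \<le> eigval smul ip (Suc i) B"
proof -
  obtain e \<mu> where es: "eigensystem n B e \<mu>" using eigensystem_exists[OF B] ok by blast
  show ?thesis
    using eigensystem_antimono[OF es ij] eigval_eq[OF B es] ij by simp
qed

text \<open>If all eigenvalues were at least \<open>c\<close>, the images of orthonormal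
  eigenvectors would be at least \<open>c\<close> apart, against total boundedness. One eigenvector
  more than there are balls of radius \<open>c / 2\<close> gives the contradiction.\<close>

lemma eigval_less_ex:
  assumes B: "psd_compact B" and ok: "\<And>n. index_ok smul (Suc n)" and c: "0 < c"
  obtains n where "eigval smul ip (Suc n) B < c"
proof (rule ccontr)
  assume no: "\<not> thesis"
  have ge: "c \<le> eigval smul ip (Suc n) B" for n
    using no that[of n] by (meson not_le)
  have "compact (closure (blinfun_apply B ` cball 0 1))"
    using B by (simp add: psd_compact_def compact_operator_def)
  then obtain T where T: "finite T"
      "closure (blinfun_apply B ` cball 0 1) \<subseteq> (\<Union>x\<in>T. ball x (c / 2))"
    using compact_eq_totally_bounded[of "closure (blinfun_apply B ` cball 0 1)"] c
    by (meson half_gt_zero)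
  define n where "n = Suc (card T)"
  obtain e \<mu> where es: "eigensystem n B e \<mu>"
    using eigensystem_exists[OF B, of n] ok unfolding n_def by blast
  note e = eigensystemD(1)[OF es]
  have "\<exists>x\<in>T. dist x (blinfun_apply B (e i)) < c / 2" if "i < n" for i
  proof -
    have "blinfun_apply B (e i) \<in> closure (blinfun_apply B ` cball 0 1)"
      using orthonormal_norm[OF e that] by (intro subsetD[OF closure_subset] imageI) simp
    then have "blinfun_apply B (e i) \<in> (\<Union>x\<in>T. ball x (c / 2))" using T(2) by blast
    then show ?thesis unfolding UN_iff mem_ball .
  qed
  then obtain f where f: "\<And>i. i < n \<Longrightarrow> f i \<in> T" "\<And>i. i < n \<Longrightarrow> dist (f i) (blinfun_apply B (e i)) < c / 2"
    by metis
  have "card (f ` {..<n}) \<le> card T" using f(1) T(1) by (intro card_mono) auto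
  then have "\<not> inj_on f {..<n}" by (intro pigeonhole) (simp add: n_def)
  then obtain i j where ij: "i < n" "j < n" "i \<noteq> j" "f i = f j" by (auto simp: inj_on_def)
  have "dist (blinfun_apply B (e i)) (blinfun_apply B (e j)) < c"
    using f(2)[OF ij(1)] f(2)[OF ij(2), folded ij(4)] dist_triangle3[of "blinfun_apply B (e i)" "blinfun_apply B (e j)" "f i"]
    by linarith
  then have lt: "norm (\<mu> i *\<^sub>R e i - \<mu> j *\<^sub>R e j) < c"
    using eigensystemD(2)[OF es] ij by (simp add: dist_norm)
  have \<mu>: "c \<le> \<mu> i" "c \<le> \<mu> j" using ge eigval_eq[OF B es] ij by metis+
  have "e i \<bullet> e j = 0" "e j \<bullet> e i = 0"
    using orthonormalD[OF e ij(1,2)] orthonormalD[OF e ij(2,1)] ij(3) by (simp_all add: Re_cip[symmetric])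
  then have "(norm (\<mu> i *\<^sub>R e i - \<mu> j *\<^sub>R e j))\<^sup>2 = (\<mu> i)\<^sup>2 * (norm (e i))\<^sup>2 + (\<mu> j)\<^sup>2 * (norm (e j))\<^sup>2"
    unfolding power2_norm_eq_inner by (simp add: inner_diff_left inner_diff_right power2_eq_square)
  also have "\<dots> = (\<mu> i)\<^sup>2 + (\<mu> j)\<^sup>2" using orthonormal_norm[OF e] ij by simp
  also have "\<dots> \<ge> c\<^sup>2" using \<mu> c power_mono[of c "\<mu> i" 2] by (simp add: add_increasing2)
  finally have "c \<le> norm (\<mu> i *\<^sub>R e i - \<mu> j *\<^sub>R e j)" by (rule power2_le_imp_le) simp
  then show False using lt by simp
qed

text \<open>\<open>N\<close> may have to exceed \<open>k\<close>, because the k-th eigenvalue can be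
  multiple. In infinite dimension, decay below the positive k-th eigenvalue provides
  \<open>N\<close>, with \<gamma> the next eigenvalue. In finite dimension \<open>N\<close> is the
  dimension, the complement is trivial and \<gamma> is 0.\<close>

lemma eigensystem_gap:
  assumes B: "psd_compact B" and pos: "posdef_operator ip B" and ok: "index_ok smul k"
  obtains N e \<mu> \<gamma> where "k \<le> N" "eigensystem N B e \<mu>" "\<gamma> < \<mu> (k - 1)" "\<And>i. i < N \<Longrightarrow> 0 < \<mu> i"
    "\<And>v. (\<And>i. i < N \<Longrightarrow> cip v (e i) = 0) \<Longrightarrow> blinfun_apply B v \<bullet> v \<le> \<gamma> * (norm v)\<^sup>2"
proof -
  have k: "1 \<le> k" using ok by (simp add: index_ok_def)
  have posv: "0 < blinfun_apply B v \<bullet> v" if "v \<noteq> 0" for v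
    using pos that by (simp add: posdef_operator_def quad_form_eq)
  have pos\<mu>: "0 < \<mu> i" if es: "eigensystem N B e \<mu>" and i: "i < N" for N e \<mu> i
  proof -
    have "norm (e i) = 1" by (rule orthonormal_norm[OF eigensystemD(1)[OF es] i])
    moreover from this have "0 < blinfun_apply B (e i) \<bullet> e i" by (intro posv) auto
    ultimately show ?thesis
      using eigensystemD(2)[OF es i] by (simp add: power2_norm_eq_inner[symmetric])
  qed
  show ?thesis
  proof (cases "\<forall>n. index_ok smul (Suc n)")
    case True
    obtain e0 \<mu>0 where es0: "eigensystem k B e0 \<mu>0" using eigensystem_exists[OF B] ok by blast
    have ev: "eigval smul ip k B = \<mu>0 (k - 1)" using eigval_eq[OF B es0, of "k - 1"] k by simp
    have "0 < eigval smul ip k B" unfolding ev using pos\<mu>[OF es0, of "k - 1"] k by simp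
    then obtain N where N: "eigval smul ip (Suc N) B < eigval smul ip k B"
      using eigval_less_ex[OF B] True by metis
    \<comment> \<open>One eigenvector beyond \<open>N\<close> is taken because its eigenvalue bounds
      the form on the complement of the first \<open>N\<close>.\<close>
    obtain e \<mu> where es: "eigensystem (Suc N) B e \<mu>" using eigensystem_exists[OF B] True by blast
    have kN: "k \<le> N"
    proof (rule ccontr)
      assume "\<not> k \<le> N"
      then have "eigval smul ip (Suc (k - 1)) B \<le> eigval smul ip (Suc N) B"
        using k by (intro eigval_antimono[OF B ok]) auto
      then show False using N k by simp
    qed
    have es': "eigensystem N B e \<mu>"
      using es by (auto simp: eigensystem_def intro: orthonormal_mono)
    show ?thesis
    proof (rule that[OF kN es'])
      show "\<mu> N < \<mu> (k - 1)"
        using N eigval_eq[OF B es, of N] eigval_eq[OF B es, of "k - 1"] k kN by simp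
      show "0 < \<mu> i" if "i < N" for i using pos\<mu>[OF es' that] .
      show "blinfun_apply B v \<bullet> v \<le> \<mu> N * (norm v)\<^sup>2" if "\<And>i. i < N \<Longrightarrow> cip v (e i) = 0" for v
        using eigensystemD(3)[OF es, of N v] that by simp
    qed
  next
    case False
    then obtain n0 where n0: "\<not> index_ok smul (Suc n0)" by blast
    \<comment> \<open>The first inadmissible index is one more than the dimension, so
      \<open>N\<close> is the dimension.\<close>
    define N where "N = (LEAST n. \<not> index_ok smul (Suc n))"
    have N: "\<not> index_ok smul (Suc N)" unfolding N_def by (rule LeastI[of _ n0]) (rule n0)
    have less: "index_ok smul (Suc n)" if "n < N" for n
      using not_less_Least[OF that[unfolded N_def]] by simp
    have kN: "k \<le> N"
    proof (rule ccontr)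
      assume "\<not> k \<le> N"
      then show False using index_ok_le[OF ok, of "Suc N"] N by simp
    qed
    then have "index_ok smul N" using less[of "N - 1"] k by simp
    then obtain e \<mu> where es: "eigensystem N B e \<mu>" using eigensystem_exists[OF B] by blast
    obtain S :: "'h set" where S: "finite S" "span S = UNIV" "\<not> Suc N \<le> dim (UNIV :: 'h set)"
      using N unfolding index_ok_def by auto
    have zero: "v = 0" if v: "\<And>i. i < N \<Longrightarrow> cip v (e i) = 0" for v
    proof (rule ccontr)
      assume v0: "v \<noteq> 0"
      define u where "u = (1 / norm v) *\<^sub>R v"
      have "cip u u = 1" and u0: "\<And>i. i < N \<Longrightarrow> cip u (e i) = 0"
        using v0 v by (simp_all add: cip_self u_def cip_scaleR_left)
      moreover have "cip (e i) u = 0" if "i < N" for i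
        using u0[OF that] by (subst cip_commute) simp
      ultimately have "orthonormal (Suc N) (e(N := u))"
        using eigensystemD(1)[OF es] by (auto simp: orthonormal_def less_Suc_eq)
      then show False using orthonormal_le_dim[OF _ S(1,2)] S(3) by blast
    qed
    show ?thesis
    proof (rule that[OF kN es])
      show "0 < \<mu> (k - 1)" using pos\<mu>[OF es, of "k - 1"] k kN by simp
      show "0 < \<mu> i" if "i < N" for i using pos\<mu>[OF es that] .
      show "blinfun_apply B v \<bullet> v \<le> 0 * (norm v)\<^sup>2" if "\<And>i. i < N \<Longrightarrow> cip v (e i) = 0" for v
        using zero[OF that] by simp
    qed
  qed
qed

section \<open>Ky Fan's maximum principle with a remainder\<close>

definition frame_sum :: "nat \<Rightarrow> (nat \<Rightarrow> 'h) \<Rightarrow> ('h \<Rightarrow>\<^sub>L 'h) \<Rightarrow> real" where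
  "frame_sum k V B = (\<Sum>j<k. blinfun_apply B (V j) \<bullet> V j)"

definition eigensum :: "nat \<Rightarrow> ('h \<Rightarrow>\<^sub>L 'h) \<Rightarrow> real" where
  "eigensum k B = (\<Sum>i<k. eigval smul ip (Suc i) B)"

lemma frame_sum_diff: "frame_sum k V (B - C) = frame_sum k V B - frame_sum k V C"
  by (simp add: frame_sum_def blinfun.diff_left inner_diff_left sum_subtractf)

lemma frame_sum_le:
  assumes "orthonormal k V"
  shows "\<bar>frame_sum k V B\<bar> \<le> real k * norm B"
proof -
  have "\<bar>frame_sum k V B\<bar> \<le> (\<Sum>j<k. \<bar>blinfun_apply B (V j) \<bullet> V j\<bar>)"
    unfolding frame_sum_def by (rule sum_abs)
  also have "\<dots> \<le> (\<Sum>j<k. norm B)"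
  proof (rule sum_mono)
    show "\<bar>blinfun_apply B (V j) \<bullet> V j\<bar> \<le> norm B" if "j \<in> {..<k}" for j
      using quad_le[of B "V j"] orthonormal_norm[OF assms, of j] that by simp
  qed
  finally show ?thesis by simp
qed

text \<open>The frame distributes total weight \<open>k\<close>: at most 1 on each eigenvector, and
  a mass \<open>d\<close> outside their span, where the form is at most \<gamma>. Putting weight 1
  on the first \<open>k\<close> eigenvectors is optimal, and each unit of escaped mass costs
  \<open>\<mu> (k - 1) - \<gamma>\<close>.\<close>

lemma frame_sum_deficit:
  assumes B: "psd_compact B" and es: "eigensystem N B e \<mu>" and k: "1 \<le> k" "k \<le> N"
    and \<gamma>: "\<And>v. (\<And>i. i < N \<Longrightarrow> cip v (e i) = 0) \<Longrightarrow> blinfun_apply B v \<bullet> v \<le> \<gamma> * (norm v)\<^sup>2"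
    and V: "orthonormal k V"
  shows "frame_sum k V B \<le> (\<Sum>i<k. \<mu> i) - (\<mu> (k - 1) - \<gamma>) * (\<Sum>j<k. (norm (V j - proj N e (V j)))\<^sup>2)"
proof -
  note e = eigensystemD(1)[OF es]
  define d where "d = (\<Sum>j<k. (norm (V j - proj N e (V j)))\<^sup>2)"
  define c where "c i = (\<Sum>j<k. (cmod (cip (V j) (e i)))\<^sup>2)" for i
  define l where "l = \<mu> (k - 1)"
  \<comment> \<open>Bessel's inequality with exchanged roles: here \<open>e i\<close> is expanded in
    the frame \<open>V\<close>.\<close>
  have c1: "c i \<le> 1" if "i < N" for i
  proof -
    have "cmod (cip (V j) (e i)) = cmod (cip (e i) (V j))" for j
      using cip_commute[of "V j" "e i"] by simp
    then have "c i = (\<Sum>j<k. (cmod (cip (e i) (V j)))\<^sup>2)" by (simp add: c_def)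
    also have "\<dots> \<le> (norm (e i))\<^sup>2" using pythagoras_proj[OF V, of "e i"] by simp
    finally show ?thesis using orthonormal_norm[OF e that] by simp
  qed
  have c0: "0 \<le> c i" for i unfolding c_def by (intro sum_nonneg) simp
  have "(\<Sum>j<k. (norm (V j))\<^sup>2) = (\<Sum>j<k. (\<Sum>i<N. (cmod (cip (V j) (e i)))\<^sup>2)) + d"
    unfolding d_def sum.distrib[symmetric] by (intro sum.cong refl pythagoras_proj[OF e])
  also have "(\<Sum>j<k. (norm (V j))\<^sup>2) = real k" using orthonormal_norm[OF V] by simp
  also have "(\<Sum>j<k. (\<Sum>i<N. (cmod (cip (V j) (e i)))\<^sup>2)) = (\<Sum>i<N. c i)"
    unfolding c_def by (rule sum.swap)
  finally have total: "(\<Sum>i<N. c i) = real k - d" by simp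
  have "frame_sum k V B \<le> (\<Sum>j<k. (\<Sum>i<N. \<mu> i * (cmod (cip (V j) (e i)))\<^sup>2) + \<gamma> * (norm (V j - proj N e (V j)))\<^sup>2)"
    unfolding frame_sum_def
  proof (rule sum_mono)
    fix j
    show "blinfun_apply B (V j) \<bullet> V j \<le> (\<Sum>i<N. \<mu> i * (cmod (cip (V j) (e i)))\<^sup>2) + \<gamma> * (norm (V j - proj N e (V j)))\<^sup>2"
      using quad_split[OF B e eigensystemD(2)[OF es], of "V j"] \<gamma>[OF cip_minus_proj[OF e], of "V j"] by simp
  qed
  also have "\<dots> = (\<Sum>i<N. \<mu> i * c i) + \<gamma> * d"
    unfolding sum.distrib c_def d_def sum_distrib_left by (subst sum.swap) simp
  also have "(\<Sum>i<N. \<mu> i * c i) = (\<Sum>i<N. (\<mu> i - l) * c i) + l * (\<Sum>i<N. c i)"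
    by (simp add: left_diff_distrib sum_subtractf sum_distrib_left)
  \<comment> \<open>Centring at \<open>l\<close> makes the factors nonnegative before index
    \<open>k\<close> and nonpositive from there on, so the upper bound 1 and the lower bound 0 on
    \<open>c i\<close> each act with the right sign.\<close>
  also have "(\<Sum>i<N. (\<mu> i - l) * c i) \<le> (\<Sum>i<N. if i < k then \<mu> i - l else 0)"
  proof (rule sum_mono)
    fix i assume i: "i \<in> {..<N}"
    show "(\<mu> i - l) * c i \<le> (if i < k then \<mu> i - l else 0)"
    proof (cases "i < k")
      case True
      then have "l \<le> \<mu> i" unfolding l_def using k by (intro eigensystem_antimono[OF es]) auto
      then show ?thesis using True c1[of i] i mult_left_mono[of "c i" 1 "\<mu> i - l"] by simp
    next
      case False
      then have "\<mu> i \<le> l" unfolding l_def using i by (intro eigensystem_antimono[OF es]) auto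
      then show ?thesis using False c0[of i] by (simp add: mult_nonpos_nonneg)
    qed
  qed
  also have "(\<Sum>i<N. if i < k then \<mu> i - l else 0) = (\<Sum>i<k. \<mu> i - l)"
  proof -
    have "(\<Sum>i<N. if i < k then \<mu> i - l else 0) = (\<Sum>i<k. if i < k then \<mu> i - l else 0)"
      using k(2) by (intro sum.mono_neutral_right) auto
    then show ?thesis by simp
  qed
  finally show ?thesis
    unfolding total by (simp add: sum_subtractf l_def d_def algebra_simps)
qed

lemma frame_sum_le_eigensum:
  assumes B: "psd_compact B" and ok: "index_ok smul k" and V: "orthonormal k V"
  shows "frame_sum k V B \<le> eigensum k B"
proof -
  have k: "1 \<le> k" using ok by (simp add: index_ok_def)
  obtain e \<mu> where es: "eigensystem k B e \<mu>" using eigensystem_exists[OF B] ok by blast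
  \<comment> \<open>With \<open>N = k\<close> and \<gamma> the k-th eigenvalue itself the remainder
    has coefficient 0, which leaves the classical inequality.\<close>
  have "frame_sum k V B \<le> (\<Sum>i<k. \<mu> i) - (\<mu> (k - 1) - \<mu> (k - 1)) * (\<Sum>j<k. (norm (V j - proj k e (V j)))\<^sup>2)"
  proof (rule frame_sum_deficit[OF B es k order_refl _ V])
    show "blinfun_apply B v \<bullet> v \<le> \<mu> (k - 1) * (norm v)\<^sup>2" if "\<And>i. i < k \<Longrightarrow> cip v (e i) = 0" for v
      using eigensystemD(3)[OF es, of "k - 1" v] that k by simp
  qed
  also have "\<dots> = eigensum k B" using eigval_eq[OF B es] by (simp add: eigensum_def)
  finally show ?thesis .
qed

lemma eigensum_attained:
  assumes B: "psd_compact B" and ok: "index_ok smul k"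
  obtains V where "orthonormal k V" "frame_sum k V B = eigensum k B"
proof -
  obtain e \<mu> where es: "eigensystem k B e \<mu>" using eigensystem_exists[OF B] ok by blast
  have "frame_sum k e B = (\<Sum>i<k. \<mu> i)"
    unfolding frame_sum_def
    using eigensystemD(2)[OF es] orthonormal_norm[OF eigensystemD(1)[OF es]]
    by (intro sum.cong) (simp_all add: power2_norm_eq_inner[symmetric])
  also have "\<dots> = eigensum k B" using eigval_eq[OF B es] by (simp add: eigensum_def)
  finally show ?thesis using that eigensystemD(1)[OF es] by blast
qed

lemma eigensum_lipschitz:
  assumes B: "psd_compact B" and C: "psd_compact C" and ok: "index_ok smul k"
  shows "\<bar>eigensum k B - eigensum k C\<bar> \<le> real k * norm (B - C)"
proof -
  have "\<bar>eigensum k B - eigensum k C\<bar> \<le> (\<Sum>i<k. \<bar>eigval smul ip (Suc i) B - eigval smul ip (Suc i) C\<bar>)"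
    unfolding eigensum_def sum_subtractf[symmetric] by (rule sum_abs)
  also have "\<dots> \<le> (\<Sum>i<k. norm (B - C))"
    by (intro sum_mono eigval_lipschitz[OF B C] index_ok_le[OF ok]) auto
  finally show ?thesis by simp
qed

end

section \<open>Maximizing frames and derivatives of eigenvalue sums\<close>

text \<open>The hypothesis concerns every subsequence \<open>s\<close>, so that the extraction for
  the next index can refine the one already made.\<close>

lemma common_convergent_subsequence:
  fixes y :: "nat \<Rightarrow> nat \<Rightarrow> 'a::topological_space"
  assumes "\<And>j s. j < k \<Longrightarrow> strict_mono (s :: nat \<Rightarrow> nat) \<Longrightarrow>
      \<exists>r :: nat \<Rightarrow> nat. strict_mono r \<and> convergent (\<lambda>m. y (s (r m)) j)"
  shows "\<exists>r. strict_mono (r :: nat \<Rightarrow> nat) \<and> (\<forall>j<k. convergent (\<lambda>m. y (r m) j))"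
  using assms
proof (induction k)
  case 0
  then show ?case by (auto intro: exI[of _ id] simp: strict_mono_def)
next
  case (Suc k)
  have "\<exists>s. strict_mono (s :: nat \<Rightarrow> nat) \<and> (\<forall>j<k. convergent (\<lambda>m. y (s m) j))"
    by (rule Suc.IH) (use Suc.prems less_SucI in blast)
  then obtain s :: "nat \<Rightarrow> nat" where s: "strict_mono s" "\<And>j. j < k \<Longrightarrow> convergent (\<lambda>m. y (s m) j)"
    by blast
  obtain r :: "nat \<Rightarrow> nat" where r: "strict_mono r" "convergent (\<lambda>m. y (s (r m)) k)"
    using Suc.prems[OF lessI s(1)] by blast
  have "convergent (\<lambda>m. y ((s \<circ> r) m) j)" if "j < Suc k" for j
  proof (cases "j = k")
    case False
    then have "j < k" using that by simp
    from convergent_subseq_convergent[OF s(2)[OF this] r(1)] show ?thesis by (simp add: o_def)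
  qed (use r(2) in simp)
  moreover have "strict_mono (s \<circ> r)" using s(1) r(1) by (rule strict_mono_o)
  ultimately show ?case by blast
qed

context hilbert_space
begin

text \<open>Compactness makes only the images under \<open>B\<close> converge; expressing the
  projection through \<open>B v\<close> and dividing by the positive eigenvalues transfers this to
  the projected frames.\<close>

lemma proj_eigensystem:
  assumes B: "psd_compact B" and es: "eigensystem N B e \<mu>" and pos: "\<And>i. i < N \<Longrightarrow> 0 < \<mu> i"
  shows "proj N e v = (\<Sum>i<N. (1 / \<mu> i) *\<^sub>R smul (ip (blinfun_apply B v) (e i)) (e i))"
  unfolding proj_def
proof (rule sum.cong[OF refl])
  fix i assume "i \<in> {..<N}"
  then have i: "i < N" by simp
  obtain a :: 'k where a: "to_complex a = of_real (\<mu> i)" using to_complex_of_real_ex by blast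
  have "cip (blinfun_apply B v) (e i) = of_real (\<mu> i) * cip v (e i)"
    by (simp add: psd_compact_cip[OF B] eigensystemD(2)[OF es i] cip_scaleR_right)
  then have "to_complex (ip (blinfun_apply B v) (e i)) = to_complex (a * ip v (e i))"
    by (simp add: cip_def a to_complex_mult)
  then have "ip (blinfun_apply B v) (e i) = a * ip v (e i)" by simp
  then have "smul (ip (blinfun_apply B v) (e i)) (e i) = smul a (smul (ip v (e i)) (e i))" by simp
  also have "\<dots> = \<mu> i *\<^sub>R smul (ip v (e i)) (e i)" by (rule scale_of_real[OF a])
  finally have "smul (ip (blinfun_apply B v) (e i)) (e i) = \<mu> i *\<^sub>R smul (ip v (e i)) (e i)" .
  then show "smul (ip v (e i)) (e i) = (1 / \<mu> i) *\<^sub>R smul (ip (blinfun_apply B v) (e i)) (e i)"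
    using pos[OF i] by simp
qed

lemma maximizing_frames_converge:
  assumes B: "psd_compact B" and pos: "posdef_operator ip B" and ok: "index_ok smul k"
    and V: "\<And>m. orthonormal k (V m)" and lim: "(\<lambda>m. frame_sum k (V m) B) \<longlonglongrightarrow> eigensum k B"
  obtains r W where "strict_mono (r :: nat \<Rightarrow> nat)" "\<And>j. j < k \<Longrightarrow> (\<lambda>m. V (r m) j) \<longlonglongrightarrow> W j"
    "orthonormal k W" "frame_sum k W B = eigensum k B"
proof -
  obtain N e \<mu> \<gamma> where kN: "k \<le> N" and es: "eigensystem N B e \<mu>" and \<gamma>: "\<gamma> < \<mu> (k - 1)"
    and \<mu>: "\<And>i. i < N \<Longrightarrow> 0 < \<mu> i"
    and gap: "\<And>v. (\<And>i. i < N \<Longrightarrow> cip v (e i) = 0) \<Longrightarrow> blinfun_apply B v \<bullet> v \<le> \<gamma> * (norm v)\<^sup>2"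
    using eigensystem_gap[OF B pos ok] by blast
  note e = eigensystemD(1)[OF es]
  have k: "1 \<le> k" using ok by (simp add: index_ok_def)
  define d where "d m = (\<Sum>j<k. (norm (V m j - proj N e (V m j)))\<^sup>2)" for m
  have sum_eq: "(\<Sum>i<k. \<mu> i) = eigensum k B"
    using eigval_eq[OF B es] kN by (simp add: eigensum_def)
  \<comment> \<open>The deficit inequality read backwards: a nearly maximal frame sum leaves little
    mass outside the span of the \<open>e i\<close>.\<close>
  have d_le: "d m \<le> (eigensum k B - frame_sum k (V m) B) / (\<mu> (k - 1) - \<gamma>)" for m
    using frame_sum_deficit[OF B es k kN gap V[of m]] \<gamma>
    by (simp add: d_def sum_eq pos_le_divide_eq mult.commute)
  have rest: "(\<lambda>m. V m j - proj N e (V m j)) \<longlonglongrightarrow> 0" if j: "j < k" for j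
  proof -
    have "(\<lambda>m. (eigensum k B - frame_sum k (V m) B) / (\<mu> (k - 1) - \<gamma>)) \<longlonglongrightarrow>
        (eigensum k B - eigensum k B) / (\<mu> (k - 1) - \<gamma>)"
      using \<gamma> by (intro tendsto_divide tendsto_diff tendsto_const lim) simp
    then have lim0: "(\<lambda>m. (eigensum k B - frame_sum k (V m) B) / (\<mu> (k - 1) - \<gamma>)) \<longlonglongrightarrow> 0" by simp
    have "(norm (V m j - proj N e (V m j)))\<^sup>2 \<le> d m" for m
      unfolding d_def using j by (intro member_le_sum) auto
    then have "norm ((norm (V m j - proj N e (V m j)))\<^sup>2) \<le> (eigensum k B - frame_sum k (V m) B) / (\<mu> (k - 1) - \<gamma>)" for m
      using d_le[of m] order_trans by auto
    then have "(\<lambda>m. (norm (V m j - proj N e (V m j)))\<^sup>2) \<longlonglongrightarrow> 0"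
      by (intro Lim_null_comparison[OF eventually_sequentiallyI[of 0] lim0])
    then have "(\<lambda>m. sqrt ((norm (V m j - proj N e (V m j)))\<^sup>2)) \<longlonglongrightarrow> sqrt 0"
      by (rule tendsto_real_sqrt)
    then show ?thesis by (simp add: tendsto_norm_zero_iff)
  qed
  have "\<exists>r. strict_mono (r :: nat \<Rightarrow> nat) \<and> (\<forall>j<k. convergent (\<lambda>m. blinfun_apply B (V (r m) j)))"
  proof (rule common_convergent_subsequence)
    fix j and s :: "nat \<Rightarrow> nat" assume "j < k"
    then have "norm (V (s m) j) \<le> 1" for m using orthonormal_norm[OF V] by simp
    then obtain r y where "strict_mono (r :: nat \<Rightarrow> nat)" "(\<lambda>m. blinfun_apply B (V (s (r m)) j)) \<longlonglongrightarrow> y"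
      using psd_compact_subseq[OF B, of "\<lambda>m. V (s m) j"] by blast
    then show "\<exists>r. strict_mono r \<and> convergent (\<lambda>m. blinfun_apply B (V (s (r m)) j))"
      by (auto simp: convergent_def)
  qed
  then obtain r where r: "strict_mono r" "\<And>j. j < k \<Longrightarrow> convergent (\<lambda>m. blinfun_apply B (V (r m) j))"
    by blast
  define y where "y j = lim (\<lambda>m. blinfun_apply B (V (r m) j))" for j
  have y: "(\<lambda>m. blinfun_apply B (V (r m) j)) \<longlonglongrightarrow> y j" if "j < k" for j
    using r(2)[OF that] unfolding y_def convergent_LIMSEQ_iff .
  \<comment> \<open>The expression of the projection through the images, evaluated at their limit
    \<open>y j\<close>.\<close>
  define W where "W j = (\<Sum>i<N. (1 / \<mu> i) *\<^sub>R smul (ip (y j) (e i)) (e i))" for j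
  have W: "(\<lambda>m. V (r m) j) \<longlonglongrightarrow> W j" if j: "j < k" for j
  proof -
    have pe: "proj N e v = (\<Sum>i<N. (1 / \<mu> i) *\<^sub>R smul (ip (blinfun_apply B v) (e i)) (e i))" for v
      by (rule proj_eigensystem[OF B es]) (rule \<mu>)
    have "(\<lambda>m. proj N e (V (r m) j)) \<longlonglongrightarrow> W j"
      unfolding W_def pe
      by (intro tendsto_sum tendsto_scaleR tendsto_const tendsto_smul_ip y j orthonormal_norm[OF e]) simp
    moreover have "(\<lambda>m. V (r m) j - proj N e (V (r m) j)) \<longlonglongrightarrow> 0"
      using LIMSEQ_subseq_LIMSEQ[OF rest[OF j] r(1)] by (simp add: o_def)
    ultimately have "(\<lambda>m. proj N e (V (r m) j) + (V (r m) j - proj N e (V (r m) j))) \<longlonglongrightarrow> W j + 0"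
      by (rule tendsto_add)
    then show ?thesis by simp
  qed
  have "orthonormal k W"
    unfolding orthonormal_def
  proof (intro allI impI)
    fix i j assume ij: "i < k" "j < k"
    have "(\<lambda>m. cip (V (r m) i) (V (r m) j)) \<longlonglongrightarrow> cip (W i) (W j)"
      by (rule bounded_bilinear.tendsto[OF bounded_bilinear_cip W[OF ij(1)] W[OF ij(2)]])
    moreover have "(\<lambda>m. cip (V (r m) i) (V (r m) j)) = (\<lambda>m. if i = j then 1 else 0)"
      using orthonormalD[OF V ij] by (intro ext) simp
    ultimately show "cip (W i) (W j) = (if i = j then 1 else 0)"
      using LIMSEQ_unique[OF _ tendsto_const] by metis
  qed
  moreover have "(\<lambda>m. frame_sum k (V (r m)) B) \<longlonglongrightarrow> frame_sum k W B"
    unfolding frame_sum_def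
    by (intro tendsto_sum tendsto_inner blinfun.tendsto tendsto_const W) simp_all
  then have "frame_sum k W B = eigensum k B"
    using LIMSEQ_subseq_LIMSEQ[OF lim r(1)] LIMSEQ_unique by (simp add: o_def) blast
  ultimately show ?thesis using that[OF r(1) W] by blast
qed

lemma quad_diff_le:
  assumes "norm v = 1" "norm w = 1"
  shows "blinfun_apply X v \<bullet> v - blinfun_apply X w \<bullet> w \<le> 2 * norm X * norm (v - w)"
proof -
  have "blinfun_apply X v \<bullet> v - blinfun_apply X w \<bullet> w = blinfun_apply X (v - w) \<bullet> v + blinfun_apply X w \<bullet> (v - w)"
    by (simp add: blinfun.diff_right inner_diff_left inner_diff_right)
  also have "blinfun_apply X (v - w) \<bullet> v \<le> norm (blinfun_apply X (v - w)) * norm v"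
    by (rule norm_cauchy_schwarz)
  also have "\<dots> \<le> norm X * norm (v - w)" using norm_blinfun[of X "v - w"] assms by simp
  also have "blinfun_apply X w \<bullet> (v - w) \<le> norm (blinfun_apply X w) * norm (v - w)"
    by (rule norm_cauchy_schwarz)
  also have "\<dots> \<le> norm X * norm (v - w)"
    using norm_blinfun[of X w] assms by (intro mult_right_mono) auto
  finally show ?thesis by simp
qed

lemma eigensum_derivative_upper:
  fixes A :: "real \<Rightarrow> ('h \<Rightarrow>\<^sub>L 'h)" and An :: "nat \<Rightarrow> real \<Rightarrow> ('h \<Rightarrow>\<^sub>L 'h)"
  assumes \<delta>: "0 < \<delta>"
    and A: "\<And>t. \<bar>t\<bar> < \<delta> \<Longrightarrow> psd_compact (A t)" and An: "\<And>n t. \<bar>t\<bar> < \<delta> \<Longrightarrow> psd_compact (An n t)"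
    and pos: "posdef_operator ip (A 0)" and ok: "index_ok smul k"
    and L: "\<And>t. \<bar>t\<bar> < \<delta> \<Longrightarrow> norm (A t - A 0) \<le> L * \<bar>t\<bar>"
    and \<epsilon>: "\<epsilon> \<longlonglongrightarrow> 0"
    and sup: "\<And>n t. \<bar>t\<bar> < \<delta> \<Longrightarrow> norm (An n t - A t) \<le> \<epsilon> n"
    and quot: "\<And>n t. \<bar>t\<bar> < \<delta> \<Longrightarrow> norm ((An n t - A t) - (An n 0 - A 0)) \<le> \<epsilon> n * \<bar>t\<bar>"
    and D: "((\<lambda>t. eigensum k (A t)) has_real_derivative D) (at 0)"
    and Dn: "\<And>n. ((\<lambda>t. eigensum k (An n t)) has_real_derivative D' n) (at 0)"
    and c: "0 < c"
  shows "\<forall>\<^sub>F n in sequentially. D' n < D + c"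
proof (rule ccontr)
  assume "\<not> ?thesis"
  then obtain s :: "nat \<Rightarrow> nat" where s: "strict_mono s" and ge: "\<And>n. D + c \<le> D' (s n)"
    using not_eventually_sequentiallyD[of "\<lambda>n. D' n < D + c"] by (auto simp: not_less)
  define h where "h n = inverse (real (Suc n))" for n
  have h: "h \<longlonglongrightarrow> 0" unfolding h_def by (rule LIMSEQ_inverse_real_of_nat)
  have hpos: "0 < h n" for n by (simp add: h_def)
  \<comment> \<open>The rates of differentiability are not uniform in \<open>n\<close>, so
    \<open>t\<close> is chosen for each \<open>n\<close>; \<open>h n\<close> bounds both
    \<open>t\<close> and the shortfall of the quotient below the derivative.\<close>
  have "\<exists>t. 0 < t \<and> t < \<delta> \<and> t < h n \<and> D' (s n) - h n < (eigensum k (An (s n) t) - eigensum k (An (s n) 0)) / t" for n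
  proof -
    let ?q = "\<lambda>t. (eigensum k (An (s n) t) - eigensum k (An (s n) 0)) / t"
    have "(?q \<longlongrightarrow> D' (s n)) (at_right 0)"
      using Dn[of "s n"] unfolding DERIV_def by (auto intro: tendsto_mono[OF at_le[OF subset_UNIV]])
    then have "\<forall>\<^sub>F t in at_right 0. D' (s n) - h n < ?q t"
      using hpos[of n] by (intro order_tendstoD(1)) auto
    moreover have "\<forall>\<^sub>F t in at_right 0. t \<in> {0<..<min \<delta> (h n)}"
      by (rule eventually_at_right_real) (use \<delta> hpos in simp)
    ultimately have "\<forall>\<^sub>F t in at_right 0. 0 < t \<and> t < \<delta> \<and> t < h n \<and> D' (s n) - h n < ?q t"
      by eventually_elim auto
    then show ?thesis by (rule eventually_happens'[OF trivial_limit_at_right_real])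
  qed
  then obtain t where t: "\<And>n. 0 < t n" "\<And>n. t n < \<delta>" "\<And>n. t n < h n"
    "\<And>n. D' (s n) - h n < (eigensum k (An (s n) (t n)) - eigensum k (An (s n) 0)) / t n" by metis
  have abst: "\<bar>t n\<bar> < \<delta>" "\<bar>t n\<bar> = t n" for n using t(1,2)[of n] by auto
  have t0: "t \<longlonglongrightarrow> 0"
  proof (rule Lim_null_comparison[OF eventually_sequentiallyI[of 0] h])
    show "norm (t n) \<le> h n" for n using abst(2)[of n] t(3)[of n] by simp
  qed
  have "\<exists>V. orthonormal k V \<and> frame_sum k V (An (s n) (t n)) = eigensum k (An (s n) (t n))" for n
    using eigensum_attained[OF An[OF abst(1)] ok] by metis
  then obtain V where V: "\<And>n. orthonormal k (V n)"
    "\<And>n. frame_sum k (V n) (An (s n) (t n)) = eigensum k (An (s n) (t n))" by metis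
  have \<delta>0: "\<bar>0\<bar> < \<delta>" using \<delta> by simp
  have \<epsilon>s: "(\<lambda>n. \<epsilon> (s n)) \<longlonglongrightarrow> 0" using LIMSEQ_subseq_LIMSEQ[OF \<epsilon> s] by (simp add: o_def)
  have near: "norm (An (s n) (t n) - A 0) \<le> \<epsilon> (s n) + L * t n" for n
    using norm_triangle_ineq[of "An (s n) (t n) - A (t n)" "A (t n) - A 0"]
      sup[OF abst(1), of "s n" n] L[OF abst(1), of n] abst(2)[of n] by simp
  \<comment> \<open>Passing from \<open>An (s n) (t n)\<close> to \<open>A 0\<close> costs
    \<open>k\<close> times their distance for the frame sum and once more for the eigenvalue sum,
    whence the factor 2.\<close>
  have "(\<lambda>n. frame_sum k (V n) (A 0)) \<longlonglongrightarrow> eigensum k (A 0)"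
  proof (rule LIM_zero_cancel, rule Lim_null_comparison[OF eventually_sequentiallyI[of 0]])
    have "(\<lambda>n. 2 * real k * (\<epsilon> (s n) + L * t n)) \<longlonglongrightarrow> 2 * real k * (0 + L * 0)"
      by (intro tendsto_intros \<epsilon>s t0)
    then show "(\<lambda>n. 2 * real k * (\<epsilon> (s n) + L * t n)) \<longlonglongrightarrow> 0" by simp
    fix n
    have "\<bar>frame_sum k (V n) (An (s n) (t n)) - frame_sum k (V n) (A 0)\<bar> \<le> real k * norm (An (s n) (t n) - A 0)"
      unfolding frame_sum_diff[symmetric] by (rule frame_sum_le[OF V(1)])
    moreover have "\<bar>eigensum k (An (s n) (t n)) - eigensum k (A 0)\<bar> \<le> real k * norm (An (s n) (t n) - A 0)"
      by (rule eigensum_lipschitz[OF An[OF abst(1)] A[OF \<delta>0] ok])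
    moreover have "real k * norm (An (s n) (t n) - A 0) \<le> real k * (\<epsilon> (s n) + L * t n)"
      by (intro mult_left_mono near) simp
    ultimately show "norm (frame_sum k (V n) (A 0) - eigensum k (A 0)) \<le> 2 * real k * (\<epsilon> (s n) + L * t n)"
      using V(2)[of n] by (simp add: abs_le_iff)
  qed
  then obtain r W where r: "strict_mono (r :: nat \<Rightarrow> nat)" and VW: "\<And>j. j < k \<Longrightarrow> (\<lambda>m. V (r m) j) \<longlonglongrightarrow> W j"
    and W: "orthonormal k W" "frame_sum k W (A 0) = eigensum k (A 0)"
    by (rule maximizing_frames_converge[OF A[OF \<delta>0] pos ok V(1)]) blast
  define z where "z n = (\<Sum>j<k. norm (V n j - W j))" for n
  \<comment> \<open>The errors: \<open>h n\<close> from the choice of \<open>t n\<close>,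
    \<open>real k * \<epsilon> (s n)\<close> from replacing the increment of \<open>An\<close> by
    that of \<open>A\<close>, and \<open>2 * L * z n\<close> from replacing \<open>V n\<close> by
    \<open>W\<close>.\<close>
  have est: "D + c \<le> h n + real k * \<epsilon> (s n) + 2 * L * z n + (eigensum k (A (t n)) - eigensum k (A 0)) / t n" for n
  proof -
    let ?X = "A (t n) - A 0"
    have tn: "0 < t n" by (rule t(1))
    have "eigensum k (An (s n) (t n)) - eigensum k (An (s n) 0)
        \<le> frame_sum k (V n) (An (s n) (t n)) - frame_sum k (V n) (An (s n) 0)"
      using V(2)[of n] frame_sum_le_eigensum[OF An[OF \<delta>0] ok V(1), of n "s n"] by simp
    also have "\<dots> = frame_sum k (V n) ?X
        + frame_sum k (V n) ((An (s n) (t n) - A (t n)) - (An (s n) 0 - A 0))"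
      by (simp add: frame_sum_diff)
    also have "frame_sum k (V n) ((An (s n) (t n) - A (t n)) - (An (s n) 0 - A 0)) \<le> real k * (\<epsilon> (s n) * t n)"
    proof -
      have "frame_sum k (V n) ((An (s n) (t n) - A (t n)) - (An (s n) 0 - A 0))
          \<le> real k * norm ((An (s n) (t n) - A (t n)) - (An (s n) 0 - A 0))"
        using frame_sum_le[OF V(1)] abs_le_iff by blast
      also have "\<dots> \<le> real k * (\<epsilon> (s n) * t n)"
        using quot[OF abst(1), of "s n" n] abst(2)[of n] by (intro mult_left_mono) auto
      finally show ?thesis .
    qed
    also have "frame_sum k (V n) ?X \<le> frame_sum k W ?X + 2 * (L * t n) * z n"
    proof -
      have "frame_sum k (V n) ?X - frame_sum k W ?X \<le> (\<Sum>j<k. 2 * norm ?X * norm (V n j - W j))"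
        unfolding frame_sum_def sum_subtractf[symmetric]
        by (intro sum_mono quad_diff_le orthonormal_norm[OF V(1)] orthonormal_norm[OF W(1)]) auto
      also have "\<dots> \<le> (\<Sum>j<k. 2 * (L * t n) * norm (V n j - W j))"
        using L[OF abst(1), of n] abst(2)[of n] by (intro sum_mono mult_right_mono mult_left_mono) auto
      finally show ?thesis by (simp add: z_def sum_distrib_left)
    qed
    \<comment> \<open>The counterpart of the first estimate: there \<open>V n\<close> is optimal at
      \<open>t n\<close> and competes at 0, here \<open>W\<close> is optimal at 0 and competes at
      \<open>t n\<close>.\<close>
    also have "frame_sum k W ?X \<le> eigensum k (A (t n)) - eigensum k (A 0)"
      using frame_sum_le_eigensum[OF A[OF abst(1)] ok W(1), of n] W(2) by (simp add: frame_sum_diff)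
    finally have "(eigensum k (An (s n) (t n)) - eigensum k (An (s n) 0)) / t n
        \<le> ((eigensum k (A (t n)) - eigensum k (A 0)) + 2 * (L * t n) * z n + real k * (\<epsilon> (s n) * t n)) / t n"
      using tn by (intro divide_right_mono) auto
    also have "\<dots> = (eigensum k (A (t n)) - eigensum k (A 0)) / t n + 2 * L * z n + real k * \<epsilon> (s n)"
      using tn by (simp add: add_divide_distrib)
    finally show ?thesis using t(4)[of n] ge[of n] by linarith
  qed
  have zr: "(\<lambda>m. z (r m)) \<longlonglongrightarrow> (\<Sum>j<k. norm (W j - W j))"
    unfolding z_def by (intro tendsto_sum tendsto_norm tendsto_diff tendsto_const VW) simp
  have "filterlim t (at 0) sequentially"
    using t0 t(1) by (intro filterlim_atI) (auto intro!: always_eventually simp: less_imp_neq[symmetric])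
  moreover have "((\<lambda>t. (eigensum k (A t) - eigensum k (A 0)) / t) \<longlongrightarrow> D) (at 0)"
    using D by (simp add: DERIV_def)
  ultimately have "(\<lambda>n. (eigensum k (A (t n)) - eigensum k (A 0)) / t n) \<longlonglongrightarrow> D"
    by (rule filterlim_compose[rotated])
  then have "(\<lambda>m. h (r m) + real k * \<epsilon> (s (r m)) + 2 * L * z (r m) + (eigensum k (A (t (r m))) - eigensum k (A 0)) / t (r m))
      \<longlonglongrightarrow> 0 + real k * 0 + 2 * L * (\<Sum>j<k. norm (W j - W j)) + D"
    using LIMSEQ_subseq_LIMSEQ[OF h r] LIMSEQ_subseq_LIMSEQ[OF \<epsilon>s r]
      LIMSEQ_subseq_LIMSEQ[OF _ r, of "\<lambda>n. (eigensum k (A (t n)) - eigensum k (A 0)) / t n" D]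
    by (intro tendsto_add tendsto_mult tendsto_const zr) (simp_all add: o_def)
  then have "D + c \<le> 0 + real k * 0 + 2 * L * (\<Sum>j<k. norm (W j - W j)) + D"
    using est by (intro LIMSEQ_le_const) auto
  then show False using c by simp
qed

lemma eigensum_derivative_tendsto:
  fixes A :: "real \<Rightarrow> ('h \<Rightarrow>\<^sub>L 'h)" and An :: "nat \<Rightarrow> real \<Rightarrow> ('h \<Rightarrow>\<^sub>L 'h)"
  assumes \<delta>: "0 < \<delta>"
    and A: "\<And>t. \<bar>t\<bar> < \<delta> \<Longrightarrow> psd_compact (A t)" and An: "\<And>n t. \<bar>t\<bar> < \<delta> \<Longrightarrow> psd_compact (An n t)"
    and pos: "posdef_operator ip (A 0)" and ok: "index_ok smul k"
    and L: "\<And>t. \<bar>t\<bar> < \<delta> \<Longrightarrow> norm (A t - A 0) \<le> L * \<bar>t\<bar>"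
    and \<epsilon>: "\<epsilon> \<longlonglongrightarrow> 0"
    and sup: "\<And>n t. \<bar>t\<bar> < \<delta> \<Longrightarrow> norm (An n t - A t) \<le> \<epsilon> n"
    and quot: "\<And>n t. \<bar>t\<bar> < \<delta> \<Longrightarrow> norm ((An n t - A t) - (An n 0 - A 0)) \<le> \<epsilon> n * \<bar>t\<bar>"
    and D: "((\<lambda>t. eigensum k (A t)) has_real_derivative D) (at 0)"
    and Dn: "\<And>n. ((\<lambda>t. eigensum k (An n t)) has_real_derivative D' n) (at 0)"
  shows "D' \<longlonglongrightarrow> D"
proof (rule LIMSEQ_I)
  fix c :: real assume c: "0 < c"
  have mirror: "((\<lambda>t. f (- t)) has_real_derivative - E) (at 0)"
    if "(f has_real_derivative E) (at 0)" for f :: "real \<Rightarrow> real" and E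
    using DERIV_mirror[of f E 0] that by simp
  have "\<forall>\<^sub>F n in sequentially. D' n < D + c"
    by (rule eigensum_derivative_upper[OF assms c])
  moreover have "\<forall>\<^sub>F n in sequentially. - D' n < - D + c"
  proof (rule eigensum_derivative_upper[of \<delta> "\<lambda>t. A (- t)" "\<lambda>n t. An n (- t)" k L \<epsilon>, OF \<delta> _ _ _ ok _ \<epsilon>])
    show "posdef_operator ip (A (- 0))" using pos by simp
    show "norm (A (- t) - A (- 0)) \<le> L * \<bar>t\<bar>" if "\<bar>t\<bar> < \<delta>" for t using L[of "- t"] that by simp
    show "norm ((An n (- t) - A (- t)) - (An n (- 0) - A (- 0))) \<le> \<epsilon> n * \<bar>t\<bar>" if "\<bar>t\<bar> < \<delta>" for n t
      using quot[of "- t" n] that by simp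
  qed (use A An sup mirror[OF D] mirror[OF Dn] c in simp_all)
  ultimately have "\<forall>\<^sub>F n in sequentially. norm (D' n - D) < c"
    by eventually_elim (simp add: abs_less_iff)
  then show "\<exists>N. \<forall>n\<ge>N. norm (D' n - D) < c" by (simp add: eventually_sequentially)
qed

end

section \<open>Lipschitz families of operators\<close>

lemma C01_norm_bounds:
  fixes f :: "'a::metric_space \<Rightarrow> 'b::real_normed_vector"
  assumes fin: "C01_norm U f < \<infinity>"
  shows "x \<in> U \<Longrightarrow> norm (f x) \<le> enn2real (C01_norm U f)"
    and "(enn2real (C01_norm U f))-lipschitz_on U f"
proof -
  have eq: "ennreal (enn2real (C01_norm U f)) = C01_norm U f"
    using fin by (simp add: less_top)
  have le: "r \<le> enn2real (C01_norm U f)" if "ennreal r \<le> C01_norm U f" for r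
  proof -
    have "ennreal r \<le> ennreal (enn2real (C01_norm U f))" using that by (simp only: eq)
    then show ?thesis by (simp only: ennreal_le_iff enn2real_nonneg)
  qed
  show "norm (f x) \<le> enn2real (C01_norm U f)" if "x \<in> U"
  proof (rule le)
    have "ennreal (norm (f x)) \<le> (SUP x\<in>U. ennreal (norm (f x)))" by (rule SUP_upper[OF that])
    then show "ennreal (norm (f x)) \<le> C01_norm U f"
      unfolding C01_norm_def by (rule add_increasing2[OF zero_le])
  qed
  show "(enn2real (C01_norm U f))-lipschitz_on U f"
  proof (rule lipschitz_onI)
    fix x y assume xy: "x \<in> U" "y \<in> U"
    show "dist (f x) (f y) \<le> enn2real (C01_norm U f) * dist x y"
    proof (cases "x = y")
      case False
      have "(x, y) \<in> {(x, y). x \<in> U \<and> y \<in> U \<and> x \<noteq> y}" using xy False by simp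
      then have "ennreal (norm (f x - f y) / dist x y) \<le>
          (SUP (x, y)\<in>{(x, y). x \<in> U \<and> y \<in> U \<and> x \<noteq> y}. ennreal (norm (f x - f y) / dist x y))"
        by (rule SUP_upper2) simp
      then have "ennreal (norm (f x - f y) / dist x y) \<le> C01_norm U f"
        unfolding C01_norm_def by (rule add_increasing[OF zero_le])
      then have "norm (f x - f y) / dist x y \<le> enn2real (C01_norm U f)" by (rule le)
      then show ?thesis using False by (simp add: dist_norm[of "f x"] divide_le_eq)
    qed simp
  qed simp
qed

lemma C01I:
  assumes cont: "continuous_on (closure U) f" and bound: "\<And>x. x \<in> U \<Longrightarrow> norm (f x) \<le> M"
    and lip: "L-lipschitz_on U f"
  shows "f \<in> C01 U"
proof -
  have "(SUP x\<in>U. ennreal (norm (f x))) \<le> ennreal M"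
    by (intro SUP_least ennreal_leI bound)
  moreover have "(SUP (x, y)\<in>{(x, y). x \<in> U \<and> y \<in> U \<and> x \<noteq> y}. ennreal (norm (f x - f y) / dist x y)) \<le> ennreal L"
  proof (rule SUP_least, clarify, rule ennreal_leI)
    fix x y assume xy: "x \<in> U" "y \<in> U" "x \<noteq> y"
    then show "norm (f x - f y) / dist x y \<le> L"
      using lipschitz_onD[OF lip xy(1,2)] by (simp add: dist_norm[of "f x"] divide_le_eq)
  qed
  ultimately have "C01_norm U f \<le> ennreal M + ennreal L"
    unfolding C01_norm_def by (rule add_mono)
  also have "\<dots> < \<infinity>" by simp
  finally show ?thesis using cont by (simp add: C01_def)
qed

context hilbert_space
begin

text \<open>Everything passes through because \<open>eigval\<close> is 1-Lipschitz in the operator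
  norm. The explicit constant \<open>L\<close> later yields one Lipschitz constant for a whole
  sequence.\<close>

lemma eigval_C01:
  fixes A :: "'a::metric_space \<Rightarrow> ('h \<Rightarrow>\<^sub>L 'h)"
  assumes A: "A \<in> C01 U" and psd: "\<And>x. x \<in> closure U \<Longrightarrow> psd_compact (A x)"
    and ok: "index_ok smul i"
  shows "(\<lambda>x. eigval smul ip i (A x)) \<in> C01 U"
    and "L-lipschitz_on U A \<Longrightarrow> L-lipschitz_on U (\<lambda>x. eigval smul ip i (A x))"
proof -
  have le: "dist (eigval smul ip i (A x)) (eigval smul ip i (A y)) \<le> dist (A x) (A y)"
    if "x \<in> closure U" "y \<in> closure U" for x y
    using eigval_lipschitz[OF psd psd ok] that by (simp add: dist_norm)
  have sub: "U \<subseteq> closure U" by (rule closure_subset)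
  show lip: "L-lipschitz_on U (\<lambda>x. eigval smul ip i (A x))" if L: "L-lipschitz_on U A" for L
  proof (rule lipschitz_onI)
    fix x y assume "x \<in> U" "y \<in> U"
    then show "dist (eigval smul ip i (A x)) (eigval smul ip i (A y)) \<le> L * dist x y"
      using le[of x y] sub lipschitz_onD[OF L, of x y] by fastforce
  qed (rule lipschitz_on_nonneg[OF L])
  have cont: "continuous_on (closure U) A" and fin: "C01_norm U A < \<infinity>"
    using A by (auto simp: C01_def)
  have cont': "continuous_on (closure U) (\<lambda>x. eigval smul ip i (A x))"
    unfolding continuous_on_iff
  proof (intro ballI allI impI)
    fix x and e :: real assume x: "x \<in> closure U" "0 < e"
    then obtain d where "0 < d" "\<And>y. y \<in> closure U \<Longrightarrow> dist y x < d \<Longrightarrow> dist (A y) (A x) < e"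
      using cont unfolding continuous_on_iff by metis
    then show "\<exists>d>0. \<forall>y\<in>closure U. dist y x < d \<longrightarrow>
        dist (eigval smul ip i (A y)) (eigval smul ip i (A x)) < e"
      using le[OF _ x(1)] by (intro exI[of _ d]) (auto intro: le_less_trans)
  qed
  have bound: "norm (eigval smul ip i (A x)) \<le> enn2real (C01_norm U A)" if "x \<in> U" for x
  proof -
    have "psd_compact (A x)" using that sub psd by blast
    then show ?thesis
      using eigval_bounds[OF _ ok, of "A x"] C01_norm_bounds(1)[OF fin that] by simp
  qed
  show "(\<lambda>x. eigval smul ip i (A x)) \<in> C01 U"
    by (rule C01I[OF cont' bound lip[OF C01_norm_bounds(2)[OF fin]]])
qed

lemma eigensum_partial_DERIV:
  fixes A :: "real^'m::finite \<Rightarrow> ('h \<Rightarrow>\<^sub>L 'h)"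
  assumes "\<And>i. i < k \<Longrightarrow> partially_differentiable j (\<lambda>y. eigval smul ip (Suc i) (A y)) x"
  shows "((\<lambda>t. eigensum k (A (x + t *\<^sub>R axis j 1))) has_real_derivative
    (\<Sum>i<k. partial j (\<lambda>y. eigval smul ip (Suc i) (A y)) x)) (at 0)"
  unfolding eigensum_def
proof (rule DERIV_sum)
  fix i assume "i \<in> {..<k}"
  then show "((\<lambda>t. eigval smul ip (Suc i) (A (x + t *\<^sub>R axis j 1))) has_real_derivative
      partial j (\<lambda>y. eigval smul ip (Suc i) (A y)) x) (at 0)"
    using assms[of i] unfolding partial_def partially_differentiable_def
    by (simp add: DERIV_deriv_iff_real_differentiable)
qed

text \<open>An eigenvalue is the difference of two consecutive eigenvalue sums, and the derivatives
  of both sums converge.\<close>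

lemma eigval_partial_tendsto:
  fixes A :: "real^'m::finite \<Rightarrow> ('h \<Rightarrow>\<^sub>L 'h)" and An :: "nat \<Rightarrow> real^'m \<Rightarrow> ('h \<Rightarrow>\<^sub>L 'h)"
  assumes U: "open U" and x: "x \<in> U"
    and psd: "\<And>x. x \<in> U \<Longrightarrow> psd_compact (A x)" "\<And>n x. x \<in> U \<Longrightarrow> psd_compact (An n x)"
    and pos: "posdef_operator ip (A x)" and ok: "index_ok smul i"
    and L: "L-lipschitz_on U A" and \<epsilon>: "\<epsilon> \<longlonglongrightarrow> 0"
    and sup: "\<And>n y. y \<in> U \<Longrightarrow> norm (An n y - A y) \<le> \<epsilon> n"
    and lip: "\<And>n. (\<epsilon> n)-lipschitz_on U (\<lambda>y. An n y - A y)"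
    and pd: "\<And>l. index_ok smul l \<Longrightarrow> partially_differentiable j (\<lambda>y. eigval smul ip l (A y)) x"
      "\<And>n l. index_ok smul l \<Longrightarrow> partially_differentiable j (\<lambda>y. eigval smul ip l (An n y)) x"
  shows "(\<lambda>n. partial j (\<lambda>y. eigval smul ip i (An n y)) x) \<longlonglongrightarrow> partial j (\<lambda>y. eigval smul ip i (A y)) x"
proof -
  let ?e = "axis j 1 :: real^'m"
  obtain \<delta> where \<delta>: "0 < \<delta>" "ball x \<delta> \<subseteq> U" using U x by (meson openE)
  have inU: "x + t *\<^sub>R ?e \<in> U" if "\<bar>t\<bar> < \<delta>" for t
    using \<delta>(2) that by (intro subsetD[OF \<delta>(2)]) (simp add: dist_norm norm_axis_1)
  have dist: "dist (x + t *\<^sub>R ?e) x = \<bar>t\<bar>" for t by (simp add: dist_norm norm_axis_1)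
  have sums: "(\<lambda>n. \<Sum>l<k. partial j (\<lambda>y. eigval smul ip (Suc l) (An n y)) x)
      \<longlonglongrightarrow> (\<Sum>l<k. partial j (\<lambda>y. eigval smul ip (Suc l) (A y)) x)" if k: "index_ok smul k \<or> k = 0" for k
  proof (cases "k = 0")
    case False
    then have ok: "index_ok smul k" using k by simp
    have okl: "index_ok smul (Suc l)" if "l < k" for l using that by (intro index_ok_le[OF ok]) auto
    show ?thesis
    proof (rule eigensum_derivative_tendsto[OF \<delta>(1), of "\<lambda>t. A (x + t *\<^sub>R ?e)" "\<lambda>n t. An n (x + t *\<^sub>R ?e)" k L \<epsilon>,
          OF _ _ _ ok _ \<epsilon>])
      show "psd_compact (A (x + t *\<^sub>R ?e))" "psd_compact (An n (x + t *\<^sub>R ?e))" if "\<bar>t\<bar> < \<delta>" for n t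
        using psd inU[OF that] by blast+
      show "posdef_operator ip (A (x + 0 *\<^sub>R ?e))" using pos by simp
      show "norm (A (x + t *\<^sub>R ?e) - A (x + 0 *\<^sub>R ?e)) \<le> L * \<bar>t\<bar>" if "\<bar>t\<bar> < \<delta>" for t
        using lipschitz_onD[OF L inU[OF that] x] dist[of t] by (simp add: dist_norm[of "A _"])
      show "norm (An n (x + t *\<^sub>R ?e) - A (x + t *\<^sub>R ?e)) \<le> \<epsilon> n" if "\<bar>t\<bar> < \<delta>" for n t
        by (rule sup[OF inU[OF that]])
      show "norm ((An n (x + t *\<^sub>R ?e) - A (x + t *\<^sub>R ?e)) - (An n (x + 0 *\<^sub>R ?e) - A (x + 0 *\<^sub>R ?e))) \<le> \<epsilon> n * \<bar>t\<bar>"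
        if "\<bar>t\<bar> < \<delta>" for n t
        using lipschitz_onD[OF lip inU[OF that] x, of n] dist[of t] by (simp add: dist_norm[of "An _ _ - _"])
    qed (intro eigensum_partial_DERIV pd okl; assumption)+
  qed simp
  obtain k where k: "i = Suc k" using ok by (cases i) (auto simp: index_ok_def)
  have "index_ok smul k \<or> k = 0" using ok index_ok_Suc unfolding k by blast
  from tendsto_diff[OF sums[of "Suc k"] sums[OF this]] show ?thesis
    using ok by (simp add: k)
qed

end

section \<open>Partial derivatives of the eigenvalues and the conclusion\<close>

lemma AE_partially_differentiable:
  fixes f :: "real^'m::finite \<Rightarrow> real"
  assumes "open U" "L-lipschitz_on U f"
  shows "AE x in lebesgue_on U. partially_differentiable j f x"
proof -
  obtain g where "AE x in lebesgue_on U. partially_differentiable j f x \<and> g x = partial j f x \<and> \<bar>g x\<bar> \<le> L"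
    by (rule lipschitz_weak_partial[OF assms])
  then show ?thesis by eventually_elim simp
qed

lemma partial_diff:
  assumes "partially_differentiable j f x" "partially_differentiable j g x"
  shows "partial j (\<lambda>y. f y - g y) x = partial j f x - partial j g x"
  using assms unfolding partial_def partially_differentiable_def
  by (intro DERIV_imp_deriv DERIV_diff) (simp_all add: DERIV_deriv_iff_real_differentiable)

theorem theorem1p21:
  fixes U :: "(real^'m::finite) set"
    and smul :: "'k::real_or_complex \<Rightarrow> 'h::{real_inner,complete_space} \<Rightarrow> 'h"
    and ip :: "'h \<Rightarrow> 'h \<Rightarrow> 'k"
    and A :: "real^'m \<Rightarrow> ('h \<Rightarrow>\<^sub>L 'h)"
    and An :: "nat \<Rightarrow> real^'m \<Rightarrow> ('h \<Rightarrow>\<^sub>L 'h)"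
  assumes "bounded U" and "open U"
    and "hilbert_space smul ip"
    and "A \<in> C01 U"
    and "\<And>n. n \<ge> 1 \<Longrightarrow> An n \<in> C01 U"
    and "\<And>x. x \<in> closure U \<Longrightarrow>
           compact_operator smul (A x) \<and> selfadjoint_operator ip (A x) \<and> nonneg_operator ip (A x)"
    and "\<And>n x. n \<ge> 1 \<Longrightarrow> x \<in> closure U \<Longrightarrow>
           compact_operator smul (An n x) \<and> selfadjoint_operator ip (An n x)
             \<and> nonneg_operator ip (An n x)"
    and "\<And>x. x \<in> U \<Longrightarrow> posdef_operator ip (A x)"
    and "(\<lambda>n. C01_norm U (\<lambda>x. An n x - A x)) \<longlonglongrightarrow> 0"
  shows "((\<forall>i. index_ok smul i \<longrightarrow> (\<lambda>x. eigval smul ip i (A x)) \<in> C01 U) \<and>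
          (\<forall>\<^sub>F n in sequentially. \<forall>i. index_ok smul i \<longrightarrow>
             (\<lambda>x. eigval smul ip i (An n x)) \<in> C01 U)) \<and>
         (\<forall>j. AE x in lebesgue_on U. \<forall>i. index_ok smul i \<longrightarrow>
            partially_differentiable j (\<lambda>y. eigval smul ip i (A y)) x \<and>
            (\<forall>\<^sub>F n in sequentially.
               partially_differentiable j (\<lambda>y. eigval smul ip i (An n y)) x) \<and>
            (\<lambda>n. partial j (\<lambda>y. eigval smul ip i (An n y)) x)
               \<longlonglongrightarrow> partial j (\<lambda>y. eigval smul ip i (A y)) x) \<and>
         (\<forall>q::real. 1 \<le> q \<longrightarrow> (\<forall>i. index_ok smul i \<longrightarrow>
            (\<lambda>n. W1q_norm q U (\<lambda>x. eigval smul ip i (A x) - eigval smul ip i (An n x)))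
               \<longlonglongrightarrow> 0))"
proof -
  interpret hilbert_space smul ip by fact
  note U = \<open>open U\<close> \<open>bounded U\<close>
  have psdA: "psd_compact (A x)" if "x \<in> closure U" for x
    using assms(6)[OF that] by (simp add: psd_compact_def)
  have psdAn: "psd_compact (An n x)" if "1 \<le> n" "x \<in> closure U" for n x
    using assms(7)[OF that] by (simp add: psd_compact_def)
  have sub: "x \<in> closure U" if "x \<in> U" for x using that closure_subset by blast
  have "\<forall>\<^sub>F n in sequentially. C01_norm U (\<lambda>x. An n x - A x) < 1"
    using assms(9) by (rule order_tendstoD) simp
  then obtain N where N: "\<And>n. N \<le> n \<Longrightarrow> C01_norm U (\<lambda>x. An n x - A x) < 1"
    unfolding eventually_sequentially by blast
  \<comment> \<open>Beyond \<open>N\<close> the distance to \<open>A\<close> is finite and below 1;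
    the successor also keeps every index at least 1, where the hypotheses on \<open>An\<close>
    hold.\<close>
  define N0 where "N0 = Suc N"
  define An' where "An' n = An (n + N0)" for n
  define \<epsilon> where "\<epsilon> n = enn2real (C01_norm U (\<lambda>x. An' n x - A x))" for n
  have norm1: "C01_norm U (\<lambda>x. An' n x - A x) < 1" for n
    unfolding An'_def by (rule N) (simp add: N0_def)
  then have fin: "C01_norm U (\<lambda>x. An' n x - A x) < \<infinity>" for n
    using less_trans[OF norm1] by simp
  have \<epsilon>1: "\<epsilon> n \<le> 1" for n
    using enn2real_mono[OF less_imp_le[OF norm1[of n]]] by (simp add: \<epsilon>_def)
  have "(\<lambda>n. C01_norm U (\<lambda>x. An' n x - A x)) \<longlonglongrightarrow> 0"
    unfolding An'_def by (rule LIMSEQ_ignore_initial_segment[OF assms(9)])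
  then have \<epsilon>0: "\<epsilon> \<longlonglongrightarrow> 0"
    unfolding \<epsilon>_def using tendsto_enn2real[of "\<lambda>n. C01_norm U (\<lambda>x. An' n x - A x)" 0 sequentially] by simp
  have sup: "norm (An' n x - A x) \<le> \<epsilon> n" if "x \<in> U" for n x
    using C01_norm_bounds(1)[OF fin that] by (simp add: \<epsilon>_def)
  have dlip: "(\<epsilon> n)-lipschitz_on U (\<lambda>x. An' n x - A x)" for n
    unfolding \<epsilon>_def by (rule C01_norm_bounds(2)[OF fin])
  define c where "c = enn2real (C01_norm U A)"
  have cA: "c-lipschitz_on U A"
    unfolding c_def using assms(4) by (intro C01_norm_bounds(2)) (simp add: C01_def)
  \<comment> \<open>The constant of \<open>A\<close> plus \<open>\<epsilon> n \<le> 1\<close> does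
    not depend on \<open>n\<close>, as the domination of the gradients requires.\<close>
  have cAn: "(c + 1)-lipschitz_on U (An' n)" for n
  proof -
    have "(c + \<epsilon> n)-lipschitz_on U (\<lambda>x. A x + (An' n x - A x))"
      by (rule lipschitz_on_add[OF cA dlip])
    then show ?thesis
      by (rule lipschitz_on_mono[OF _ subset_refl, THEN lipschitz_on_transform]) (use \<epsilon>1[of n] in auto)
  qed
  have An': "An' n \<in> C01 U" "x \<in> closure U \<Longrightarrow> psd_compact (An' n x)" for n x
    using assms(5) psdAn by (auto simp: An'_def N0_def)
  have lipA: "c-lipschitz_on U (\<lambda>x. eigval smul ip i (A x))" if "index_ok smul i" for i
    by (rule eigval_C01(2)[OF assms(4) psdA that cA])
  have lipAn: "(c + 1)-lipschitz_on U (\<lambda>x. eigval smul ip i (An' n x))" if "index_ok smul i" for i n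
    by (rule eigval_C01(2)[OF An'(1) An'(2) that cAn])
  \<comment> \<open>There are countably many eigenvalue indices and operators, so a single null set
    serves all of them.\<close>
  have main: "AE x in lebesgue_on U. \<forall>i. index_ok smul i \<longrightarrow>
      partially_differentiable j (\<lambda>y. eigval smul ip i (A y)) x \<and>
      (\<forall>n. partially_differentiable j (\<lambda>y. eigval smul ip i (An' n y)) x) \<and>
      (\<lambda>n. partial j (\<lambda>y. eigval smul ip i (An' n y)) x) \<longlonglongrightarrow> partial j (\<lambda>y. eigval smul ip i (A y)) x" for j
  proof -
    have "AE x in lebesgue_on U. \<forall>i. index_ok smul i \<longrightarrow> partially_differentiable j (\<lambda>y. eigval smul ip i (A y)) x"
      unfolding AE_all_countable using AE_partially_differentiable[OF U(1) lipA] by auto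
    moreover have "AE x in lebesgue_on U. \<forall>n i. index_ok smul i \<longrightarrow>
        partially_differentiable j (\<lambda>y. eigval smul ip i (An' n y)) x"
      unfolding AE_all_countable using AE_partially_differentiable[OF U(1) lipAn] by auto
    moreover have "AE x in lebesgue_on U. x \<in> U" by (rule AE_I2) simp
    ultimately show ?thesis
    proof eventually_elim
      fix x assume pd: "\<forall>i. index_ok smul i \<longrightarrow> partially_differentiable j (\<lambda>y. eigval smul ip i (A y)) x"
        "\<forall>n i. index_ok smul i \<longrightarrow> partially_differentiable j (\<lambda>y. eigval smul ip i (An' n y)) x"
        and x: "x \<in> U"
      have "(\<lambda>n. partial j (\<lambda>y. eigval smul ip i (An' n y)) x) \<longlonglongrightarrow> partial j (\<lambda>y. eigval smul ip i (A y)) x"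
        if ok: "index_ok smul i" for i
        using eigval_partial_tendsto[OF U(1) x psdA[OF sub] An'(2)[OF sub] assms(8)[OF x] ok cA \<epsilon>0 sup dlip] pd
        by blast
      then show "\<forall>i. index_ok smul i \<longrightarrow>
        partially_differentiable j (\<lambda>y. eigval smul ip i (A y)) x \<and>
        (\<forall>n. partially_differentiable j (\<lambda>y. eigval smul ip i (An' n y)) x) \<and>
        (\<lambda>n. partial j (\<lambda>y. eigval smul ip i (An' n y)) x) \<longlonglongrightarrow> partial j (\<lambda>y. eigval smul ip i (A y)) x"
        using pd by blast
    qed
  qed
  have 2: "AE x in lebesgue_on U. \<forall>i. index_ok smul i \<longrightarrow>
            partially_differentiable j (\<lambda>y. eigval smul ip i (A y)) x \<and>
            (\<forall>\<^sub>F n in sequentially.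
               partially_differentiable j (\<lambda>y. eigval smul ip i (An n y)) x) \<and>
            (\<lambda>n. partial j (\<lambda>y. eigval smul ip i (An n y)) x)
               \<longlonglongrightarrow> partial j (\<lambda>y. eigval smul ip i (A y)) x" for j
    using main[of j]
  proof eventually_elim
    fix x assume x: "\<forall>i. index_ok smul i \<longrightarrow>
      partially_differentiable j (\<lambda>y. eigval smul ip i (A y)) x \<and>
      (\<forall>n. partially_differentiable j (\<lambda>y. eigval smul ip i (An' n y)) x) \<and>
      (\<lambda>n. partial j (\<lambda>y. eigval smul ip i (An' n y)) x) \<longlonglongrightarrow> partial j (\<lambda>y. eigval smul ip i (A y)) x"
    show "\<forall>i. index_ok smul i \<longrightarrow>
            partially_differentiable j (\<lambda>y. eigval smul ip i (A y)) x \<and>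
            (\<forall>\<^sub>F n in sequentially.
               partially_differentiable j (\<lambda>y. eigval smul ip i (An n y)) x) \<and>
            (\<lambda>n. partial j (\<lambda>y. eigval smul ip i (An n y)) x)
               \<longlonglongrightarrow> partial j (\<lambda>y. eigval smul ip i (A y)) x"
    proof (intro allI impI conjI)
      fix i assume ok: "index_ok smul i"
      show "partially_differentiable j (\<lambda>y. eigval smul ip i (A y)) x" using x ok by blast
      show "\<forall>\<^sub>F n in sequentially. partially_differentiable j (\<lambda>y. eigval smul ip i (An n y)) x"
      proof (rule eventually_sequentiallyI)
        fix n assume "N0 \<le> n"
        then have "An n = An' (n - N0)" by (simp add: An'_def)
        then show "partially_differentiable j (\<lambda>y. eigval smul ip i (An n y)) x" using x ok by simp
      qed
      show "(\<lambda>n. partial j (\<lambda>y. eigval smul ip i (An n y)) x) \<longlonglongrightarrow> partial j (\<lambda>y. eigval smul ip i (A y)) x"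
        by (rule LIMSEQ_offset[where k=N0]) (use x ok in \<open>simp add: An'_def\<close>)
    qed
  qed
  have 3: "(\<lambda>n. W1q_norm q U (\<lambda>x. eigval smul ip i (A x) - eigval smul ip i (An n x))) \<longlonglongrightarrow> 0"
    if q: "1 \<le> q" and ok: "index_ok smul i" for q i
  proof (rule LIMSEQ_offset[where k=N0])
    have "(\<lambda>n. W1q_norm q U (\<lambda>x. eigval smul ip i (A x) - eigval smul ip i (An' n x))) \<longlonglongrightarrow> 0"
    \<comment> \<open>Weyl's bound lets \<epsilon> control the functions themselves; the gradients
      are dominated by the sum of the two Lipschitz constants and converge by
      \<open>main\<close>.\<close>
    proof (rule W1q_norm_tendsto_0[OF U q _ _ \<epsilon>0])
      show "(c + (c + 1))-lipschitz_on U (\<lambda>x. eigval smul ip i (A x) - eigval smul ip i (An' n x))" for n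
        by (rule lipschitz_on_diff[OF lipA[OF ok] lipAn[OF ok]])
      show "\<bar>eigval smul ip i (A x) - eigval smul ip i (An' n x)\<bar> \<le> \<epsilon> n" if "x \<in> U" for n x
        using eigval_lipschitz[OF psdA[OF sub[OF that]] An'(2)[OF sub[OF that]] ok, of n] sup[OF that, of n]
        by (simp add: norm_minus_commute)
      show "AE x in lebesgue_on U.
          (\<lambda>n. partial j (\<lambda>x. eigval smul ip i (A x) - eigval smul ip i (An' n x)) x) \<longlonglongrightarrow> 0" for j
        using main[of j]
      proof eventually_elim
        fix x assume "\<forall>i. index_ok smul i \<longrightarrow>
          partially_differentiable j (\<lambda>y. eigval smul ip i (A y)) x \<and>
          (\<forall>n. partially_differentiable j (\<lambda>y. eigval smul ip i (An' n y)) x) \<and>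
          (\<lambda>n. partial j (\<lambda>y. eigval smul ip i (An' n y)) x) \<longlonglongrightarrow> partial j (\<lambda>y. eigval smul ip i (A y)) x"
        then have pd: "partially_differentiable j (\<lambda>y. eigval smul ip i (A y)) x"
            "\<And>n. partially_differentiable j (\<lambda>y. eigval smul ip i (An' n y)) x"
          and lim: "(\<lambda>n. partial j (\<lambda>y. eigval smul ip i (An' n y)) x) \<longlonglongrightarrow> partial j (\<lambda>y. eigval smul ip i (A y)) x"
          using ok by blast+
        have "(\<lambda>n. partial j (\<lambda>y. eigval smul ip i (A y)) x - partial j (\<lambda>y. eigval smul ip i (An' n y)) x)
            \<longlonglongrightarrow> partial j (\<lambda>y. eigval smul ip i (A y)) x - partial j (\<lambda>y. eigval smul ip i (A y)) x"
          by (intro tendsto_diff tendsto_const lim)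
        then show "(\<lambda>n. partial j (\<lambda>x. eigval smul ip i (A x) - eigval smul ip i (An' n x)) x) \<longlonglongrightarrow> 0"
          by (simp add: partial_diff[OF pd])
      qed
    qed
    then show "(\<lambda>n. W1q_norm q U (\<lambda>x. eigval smul ip i (A x) - eigval smul ip i (An (n + N0) x))) \<longlonglongrightarrow> 0"
      by (simp add: An'_def)
  qed
  have "\<forall>\<^sub>F n in sequentially. \<forall>i. index_ok smul i \<longrightarrow> (\<lambda>x. eigval smul ip i (An n x)) \<in> C01 U"
    by (rule eventually_sequentiallyI[of 1]) (use eigval_C01(1)[OF assms(5) psdAn] in blast)
  then show ?thesis
    using eigval_C01(1)[OF assms(4) psdA] 2 3 by blast
qed

end
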